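(* Let $\Omega$ be a compact 2-dimensional Riemannian manifold without boundary, with a mesh $\mathcal M_h$ and local polynomial spaces satisfying hypotheses (H) and (T) of the context, let $r\ge0$ and $T>0$. Let $(\underline{\mathbf E}_h,\underline{\mathbf B}'_h)\in C^1([0,T];\underline X^1_{r,h}\times\underline X^2_{r,h})$ be a solution of the semi-discrete scheme in the absence of a current density ($\widetilde J=0$), that is: for all $(\underline v^1_h,\underline v_h^2)\in\underline X^1_{r,h}\times\underline X^2_{r,h}$ and all $t\in(0,T)$, $$\langle\underline{\mathrm d}^1_{r,h}\underline{\mathbf E}_h(t),\underline v^2_h\rangle=-\langle\partial_t\underline{\mathbf B}'_h(t),\underline v_h^2\rangle,\qquad \langle\underline{\mathbf B}'_h(t),\underline{\mathrm d}^1_{r,h}\underline v^1_h\rangle=\langle\partial_t\underline{\mathbf E}_h(t),\underline v^1_h\rangle.$$ Then $$\partial_t\big(\langle\underline{\mathbf E}_h,\underline{\mathbf E}_h\rangle+\langle\underline{\mathbf B}'_h,\underline{\mathbf B}'_h\rangle\big)=0.$$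
   Context: Here $n=2$ is the dimension of $\Omega$. $\mathrm d$ is the exterior derivative, $\operatorname{tr}_{f'}$ the trace (pullback by inclusion) of forms on $f'$. **Mesh.** $\mathcal M_h$ is a finite collection of pairwise disjoint (oriented) submanifolds ("cells") of dimensions $0,\dots,n$, covering $\Omega$; $\Delta_d(\mathcal M_h)$ is the set of $d$-dimensional cells ($d$-cells). If $f$ is a $d$-cell, $d\ge1$, and $f'$ is a $d'$-cell with $d'<d$ and $f'\cap\overline f\ne\emptyset$, then $f'\subset\partial f$. For $d'<d$, $\Delta_{d'}(f)$ is the set of $d'$-cells contained in $\partial f$, and $\Delta_d(f)=\{f\}$. For $d\ge1$, $h_f:=|f|^{1/d}$. **Polynomial spaces.** For every $d$-cell $f$ we are given finite-dimensional spaces $\mathcal P_r\Lambda^l(f)$ ($r,l\in\mathbb Z$) of $l$-forms of class $C^1$ on $f$ (up to the boundary, so that traces make sense), with $\mathrm d\mathcal P_r\Lambda^l(f)\subset\mathcal P_{r-1}\Lambda^{l+1}(f)$, and a linear graded map $\kappa=\kappa_f$ with $\kappa\mathcal P_r\Lambda^l(f)\subset\mathcal P_{r+1}\Lambda^{l-1}(f)$ and $\kappa\circ\kappa=0$. (Forms of degree $<0$ or $>d$ on $f$ are zero.) **(H) Homogeneous polynomials.** For all $d\in[0,n]$ and $f\in\Delta_d(\mathcal M_h)$: (a) there are spaces $\mathcal H_s\Lambda^l(f)$ ($s,l\in\mathbb Z$), with $\mathcal H_s\Lambda^l(f)=\{0\}$ for $s<0$, such that $\mathcal P_r\Lambda^l(f)=\bigoplus_{s\le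 r}\mathcal H_s\Lambda^l(f)$, and real numbers $\lambda_{s,l}$ such that $(\mathrm d\kappa+\kappa\mathrm d)p=\lambda_{s,l}\,p$ for all $p\in\mathcal H_s\Lambda^l(f)$; for $s<0$ one fixes $\lambda_{s,l}=\lambda_{s+l,0}$, with $\lambda_{s+l,0}=0$ if $s+l<0$; (b) if $d>0$, $l\in[0,d]$, $s,s'\ge0$ and $\lambda_{s,l}=\lambda_{s',l}$, then $s=s'$; moreover, for $s\ge0$ (and $l\in[0,d]$), $\lambda_{s,l}=0$ iff $(s,l)=(0,0)$; (c) $\mathrm d\mathcal H_s\Lambda^l(f)\ne\{0\}$ when $s>0$ and $l<d$. **Trimmed spaces.** For $r\ge0$: $\mathcal P^-_r\Lambda^0(f):=\mathcal P_r\Lambda^0(f)$ and $\mathcal P^-_r\Lambda^l(f):=\mathrm d\mathcal P_r\Lambda^{l-1}(f)\oplus\kappa\mathcal P_{r-1}\Lambda^{l+1}(f)$ for $l\ge1$. **(T)** For all $l\in\mathbb Z$, $d\in[0,n]$, $f\in\Delta_d(\mathcal M_h)$, $d'\in[0,d]$, $r\ge0$ and $f'\in\Delta_{d'}(f)$: $\operatorname{tr}_{f'}\mathcal P^-_r\Lambda^l(f)\subset\mathcal P^-_r\Lambda^l(f')$. **Hodge star and projector.** On a $d$-cell $f$ with the induced metric, $\star$ maps $k$-forms to $(d-k)$-forms via $\langle\star\omega,\mu\rangle\,\mathrm{vol}=\omega\wedge\mu$ for all $(d-k)$-forms $\mu$. $\pi^{-,l}_{r,f}$ is the $L^2$-orthogonal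 projector from $L^2\Lambda^l(f)$ onto $\mathcal P^-_r\Lambda^l(f)$. **Discrete spaces.** $\underline X^k_{r,h}:=\prod_{d=k}^{n}\prod_{f\in\Delta_d(\mathcal M_h)}\star^{-1}\mathcal P^-_r\Lambda^{d-k}(f)$, with elements $\underline\omega_h=(\omega_f)_f$; $\underline\omega_f=(\omega_{f'})_{f'\in\Delta_{d'}(f),\,d'\in[k,d]}$ denotes restriction to a $d$-cell $f$, and $\underline X^k_{r,f}$ the space of such restrictions. **Local discrete exterior derivative and potential.** For $f\in\Delta_d(\mathcal M_h)$, $\mathrm d^k_{r,f}:\underline X^k_{r,f}\to\star^{-1}\mathcal P_r\Lambda^{d-k-1}(f)$ and $P^k_{r,f}:\underline X^k_{r,f}\to\star^{-1}\mathcal P_r\Lambda^{d-k}(f)$ are defined by induction on $d$. If $d=k$: $P^k_{r,f}\underline\omega_f:=\omega_f$. If $d\ge k+1$: for all $\mu_f\in\mathcal P_r\Lambda^{d-k-1}(f)$, $$\int_f\mathrm d^k_{r,f}\underline\omega_f\wedge\mu_f=(-1)^{k+1}\int_f\omega_f\wedge\mathrm d\mu_f+\int_{\partial f}P^k_{r,\partial f}\underline\omega_f\wedge\operatorname{tr}_{\partial f}\mu_f,$$ where $P^k_{r,\partial f}\underline\omega_f$ equals $P^k_{r,f'}\underline\omega_{f'}$ on each $f'\in\Delta_{d-1}(f)$ and $\partial f$ has the orientation induced by $f$; and for all $\mu_f\in\kappa\mathcal P_r\Lambda^{d-k}(f)$, $\nu_f\in\kappa\mathcal P_{r-1}\Lambda^{d-k+1}(f)$,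 $$(-1)^{k+1}\int_fP^k_{r,f}\underline\omega_f\wedge(\mathrm d\mu_f+\nu_f)=\int_f\mathrm d^k_{r,f}\underline\omega_f\wedge\mu_f-\int_{\partial f}P^k_{r,\partial f}\underline\omega_f\wedge\operatorname{tr}_{\partial f}\mu_f+(-1)^{k+1}\int_f\omega_f\wedge\nu_f.$$ **Global discrete exterior derivative.** $\underline{\mathrm d}^k_{r,h}:\underline X^k_{r,h}\to\underline X^{k+1}_{r,h}$, $\underline{\mathrm d}^k_{r,h}\underline\omega_h:=(\star^{-1}\pi^{-,d-k-1}_{r,f}\star\mathrm d^k_{r,f}\underline\omega_f)_{f\in\Delta_d(\mathcal M_h),\,d\in[k+1,n]}$. **Discrete $L^2$-like inner product** on $\underline X^k_{r,h}$: $$\langle\underline\omega_h,\underline\mu_h\rangle=\sum_{f\in\Delta_n(\mathcal M_h)}\Big(\int_fP^k_{r,f}\underline\omega_f\wedge\star P^k_{r,f}\underline\mu_f+\sum_{d=k}^{n-1}h_f^{n-d}\sum_{f'\in\Delta_d(f)}\int_{f'}(P^k_{r,f'}\underline\omega_{f'}-\operatorname{tr}_{f'}P^k_{r,f}\underline\omega_f)\wedge\star(P^k_{r,f'}\underline\mu_{f'}-\operatorname{tr}_{f'}P^k_{r,f}\underline\mu_f)\Big).$$ *)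

theory Defs
  imports
    "HOL-Analysis.Analysis"
    "HOL-Combinatorics.Permutations"
    "HOL-Library.Function_Algebras"
begin

section \<open>Smooth maps between open sets of the plane\<close>

text \<open>Only used on open sets \<open>S\<close>.\<close>

primrec Ck_on :: "nat \<Rightarrow> (real^2 \<Rightarrow> 'b::real_normed_vector) \<Rightarrow> (real^2) set \<Rightarrow> bool" where
  "Ck_on 0 f S \<longleftrightarrow> continuous_on S f"
| "Ck_on (Suc k) f S \<longleftrightarrow> f differentiable_on S \<and>
     (\<forall>v. Ck_on k (\<lambda>x. frechet_derivative f (at x) v) S)"

definition smooth_on :: "(real^2 \<Rightarrow> 'b::real_normed_vector) \<Rightarrow> (real^2) set \<Rightarrow> bool" where
  "smooth_on f S \<longleftrightarrow> (\<forall>k. Ck_on k f S)"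

section \<open>Riemannian surfaces\<close>

text \<open>
  A chart is a pair of its domain and its coordinate map. The tangent space at \<open>x\<close> is \<open>real^2\<close>,
  read through the chart \<open>chart_at M x\<close> chosen once and for all at \<open>x\<close>; \<open>dchart\<close> and \<open>dchart_inv\<close>
  convert between this model and the coordinates of any other chart. A differential form
  maps a point and a list of tangent vectors to a real; it vanishes on lists of the wrong length,
  on vectors outside the relevant tangent space, and at points outside its domain, so that forms
  of all degrees live in one vector space and equality of forms is equality of functions.
\<close>

type_synonym 'a chart = "'a set \<times> ('a \<Rightarrow> real^2)"
type_synonym covector = "(real^2) list \<Rightarrow> real"
type_synonym 'a form = "'a \<Rightarrow> covector"

record 'a surface =
  points :: "'a set"
  atlas :: "'a chart set"
  riem :: "'a \<Rightarrow> real^2 \<Rightarrow> real^2 \<Rightarrow> real"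

definition chart_inv :: "'a chart \<Rightarrow> real^2 \<Rightarrow> 'a" where
  "chart_inv c = inv_into (fst c) (snd c)"

definition transition :: "'a chart \<Rightarrow> 'a chart \<Rightarrow> real^2 \<Rightarrow> real^2" where
  "transition c c' = snd c' \<circ> chart_inv c"

definition is_chart :: "'a::t2_space set \<Rightarrow> 'a chart \<Rightarrow> bool" where
  "is_chart X c \<longleftrightarrow> openin (top_of_set X) (fst c) \<and> open (snd c ` fst c) \<and>
     homeomorphism (fst c) (snd c ` fst c) (snd c) (chart_inv c)"

definition smooth_compatible :: "'a chart \<Rightarrow> 'a chart \<Rightarrow> bool" where
  "smooth_compatible c c' \<longleftrightarrow>
     smooth_on (transition c c') (snd c ` (fst c \<inter> fst c')) \<and>
     smooth_on (transition c' c) (snd c' ` (fst c \<inter> fst c'))"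

definition smooth_chart :: "('a::t2_space, 'z) surface_scheme \<Rightarrow> 'a chart \<Rightarrow> bool" where
  "smooth_chart M c \<longleftrightarrow> is_chart (points M) c \<and> (\<forall>c'\<in>atlas M. smooth_compatible c c')"

definition chart_at :: "('a, 'z) surface_scheme \<Rightarrow> 'a \<Rightarrow> 'a chart" where
  "chart_at M x = (SOME c. c \<in> atlas M \<and> x \<in> fst c)"

definition dchart :: "('a, 'z) surface_scheme \<Rightarrow> 'a chart \<Rightarrow> 'a \<Rightarrow> real^2 \<Rightarrow> real^2" where
  "dchart M c x = frechet_derivative (transition (chart_at M x) c) (at (snd (chart_at M x) x))"

definition dchart_inv :: "('a, 'z) surface_scheme \<Rightarrow> 'a chart \<Rightarrow> 'a \<Rightarrow> real^2 \<Rightarrow> real^2" where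
  "dchart_inv M c x = frechet_derivative (transition c (chart_at M x)) (at (snd c x))"

text \<open>Coordinate representation of a form, i.e. its pullback by the inverse chart.\<close>

definition pull :: "('a, 'z) surface_scheme \<Rightarrow> 'a chart \<Rightarrow> 'a form \<Rightarrow> real^2 \<Rightarrow> covector" where
  "pull M c \<omega> y ws = \<omega> (chart_inv c y) (map (dchart_inv M c (chart_inv c y)) ws)"

definition inner_product_on_plane :: "(real^2 \<Rightarrow> real^2 \<Rightarrow> real) \<Rightarrow> bool" where
  "inner_product_on_plane g \<longleftrightarrow> (\<forall>v. linear (g v)) \<and> (\<forall>v w. g v w = g w v) \<and>
     (\<forall>v. v \<noteq> 0 \<longrightarrow> g v v > 0)"

text \<open>Charts take values in open subsets of the plane, so there is no boundary.\<close>

definition compact_riemannian_surface :: "('a::t2_space, 'z) surface_scheme \<Rightarrow> bool" where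
  "compact_riemannian_surface M \<longleftrightarrow>
     compact (points M) \<and>
     (\<forall>c\<in>atlas M. smooth_chart M c) \<and> (\<Union>c\<in>atlas M. fst c) = points M \<and>
     (\<forall>x\<in>points M. inner_product_on_plane (riem M x)) \<and>
     (\<forall>c\<in>atlas M. \<forall>w w'. smooth_on
        (\<lambda>y. riem M (chart_inv c y) (dchart_inv M c (chart_inv c y) w)
                                     (dchart_inv M c (chart_inv c y) w')) (snd c ` fst c))"

section \<open>Submanifolds and forms on them\<close>

definition std_basis :: "(real^2) list" where
  "std_basis = [axis 1 1, axis 2 1]"

definition slice_chart :: "('a::t2_space, 'z) surface_scheme \<Rightarrow> nat \<Rightarrow> 'a set \<Rightarrow> 'a chart \<Rightarrow> bool" where
  "slice_chart M d f c \<longleftrightarrow> smooth_chart M c \<and>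
     snd c ` (fst c \<inter> f) = snd c ` fst c \<inter> span (set (take d std_basis))"

definition submanifold :: "('a::t2_space, 'z) surface_scheme \<Rightarrow> nat \<Rightarrow> 'a set \<Rightarrow> bool" where
  "submanifold M d f \<longleftrightarrow> d \<le> 2 \<and> f \<subseteq> points M \<and> (\<forall>x\<in>f. \<exists>c. slice_chart M d f c \<and> x \<in> fst c)"

text \<open>Velocities at \<open>x\<close> of curves running in \<open>f\<close>.\<close>

definition tangent :: "('a, 'z) surface_scheme \<Rightarrow> 'a set \<Rightarrow> 'a \<Rightarrow> (real^2) set" where
  "tangent M f x = {v. \<exists>\<gamma>. \<gamma> 0 = x \<and>
     (\<forall>\<^sub>F t in nhds (0::real). \<gamma> t \<in> f \<inter> fst (chart_at M x)) \<and>
     ((snd (chart_at M x) \<circ> \<gamma>) has_vector_derivative v) (at 0)}"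

definition covectors :: "(real^2) set \<Rightarrow> int \<Rightarrow> covector set" where
  "covectors V l = {\<alpha>.
     (\<forall>vs. \<not> (int (length vs) = l \<and> set vs \<subseteq> V) \<longrightarrow> \<alpha> vs = 0) \<and>
     (\<forall>vs i u w a b. int (length vs) = l \<and> set vs \<subseteq> V \<and> i < length vs \<and> u \<in> V \<and> w \<in> V \<longrightarrow>
        \<alpha> (vs[i := a *\<^sub>R u + b *\<^sub>R w]) = a * \<alpha> (vs[i := u]) + b * \<alpha> (vs[i := w])) \<and>
     (\<forall>vs i j. i < j \<and> j < length vs \<and> vs ! i = vs ! j \<longrightarrow> \<alpha> vs = 0)}"

definition forms :: "('a, 'z) surface_scheme \<Rightarrow> 'a set \<Rightarrow> int \<Rightarrow> 'a form set" where
  "forms M f l = {\<omega>. (\<forall>x\<in>f. \<omega> x \<in> covectors (tangent M f x) l) \<and> (\<forall>x. x \<notin> f \<longrightarrow> \<omega> x = 0)}"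

definition C1_forms :: "('a, 'z) surface_scheme \<Rightarrow> int \<Rightarrow> 'a form set" where
  "C1_forms M l = {\<eta>\<in>forms M (points M) l.
     \<forall>c\<in>atlas M. \<forall>ws. Ck_on 1 (\<lambda>y. pull M c \<eta> y ws) (snd c ` fst c)}"

text \<open>Pullback by the inclusion of \<open>f\<close> in the surface.\<close>

definition restrict_form :: "('a, 'z) surface_scheme \<Rightarrow> 'a set \<Rightarrow> 'a form \<Rightarrow> 'a form" where
  "restrict_form M f \<eta> x vs = (if x \<in> f \<and> set vs \<subseteq> tangent M f x then \<eta> x vs else 0)"

text \<open>Forms on \<open>f\<close> of class \<open>C\<^sup>1\<close> up to the boundary: those which extend beyond the closure of \<open>f\<close>.\<close>

definition C1_closed_forms :: "('a, 'z) surface_scheme \<Rightarrow> 'a set \<Rightarrow> int \<Rightarrow> 'a form set" where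
  "C1_closed_forms M f l = restrict_form M f ` C1_forms M l"

text \<open>
  Trace on \<open>f'\<close>, contained in the closure of the cell \<open>f\<close>, of a form \<open>\<omega>\<close> on \<open>f\<close> that is \<open>C\<^sup>1\<close> up to the
  boundary. By continuity it does not depend on the extension \<open>\<eta>\<close>; which cell \<open>\<omega>\<close> lives on is
  the argument \<open>f\<close>.
\<close>

definition trace_form :: "('a, 'z) surface_scheme \<Rightarrow> 'a set \<Rightarrow> 'a set \<Rightarrow> 'a form \<Rightarrow> 'a form" where
  "trace_form M f f' \<omega> =
     restrict_form M f' (SOME \<eta>. (\<exists>l. \<eta> \<in> C1_forms M l) \<and> restrict_form M f \<eta> = \<omega>)"

text \<open>
  The wedge product of inhomogeneous forms: \<open>p\<close> is the degree of the first factor, and only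
  the term matching the degrees of the factors survives.
\<close>

definition cov_wedge :: "covector \<Rightarrow> covector \<Rightarrow> covector" where
  "cov_wedge \<alpha> \<beta> vs = (\<Sum>p\<le>length vs.
     (\<Sum>\<sigma> | \<sigma> permutes {..<length vs}.
        of_int (sign \<sigma>) * \<alpha> (take p (permute_list \<sigma> vs)) * \<beta> (drop p (permute_list \<sigma> vs)))
     / (fact p * fact (length vs - p)))"

definition wedge :: "'a form \<Rightarrow> 'a form \<Rightarrow> 'a form" where
  "wedge \<omega> \<mu> x = cov_wedge (\<omega> x) (\<mu> x)"

text \<open>
  In a slice chart, \<open>d\<omega>(v\<^sub>0,\<dots>,v\<^sub>l)\<close> is the alternating sum of the derivatives in the
  direction \<open>v\<^sub>i\<close> of \<open>\<omega>(v\<^sub>0,\<dots>,v\<^sub>l)\<close> with \<open>v\<^sub>i\<close> omitted.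
\<close>

definition ext_deriv :: "('a::t2_space, 'z) surface_scheme \<Rightarrow> nat \<Rightarrow> 'a set \<Rightarrow> 'a form \<Rightarrow> 'a form" where
  "ext_deriv M d f \<omega> x vs =
     (if x \<in> f \<and> set vs \<subseteq> tangent M f x then
        let c = (SOME c. slice_chart M d f c \<and> x \<in> fst c); ws = map (dchart M c x) vs in
        (\<Sum>i<length vs. (-1) ^ i *
           deriv (\<lambda>t. pull M c \<omega> (snd c x + t *\<^sub>R (ws ! i)) (take i ws @ drop (Suc i) ws)) 0)
      else 0)"

text \<open>
  Inner product of covectors of equal degree \<open>m\<close> on the tangent space of \<open>f\<close>, induced by the
  metric: the sum over all \<open>m\<close>-tuples of vectors of an orthonormal basis, divided by \<open>m!\<close>.
\<close>

definition onb :: "('a, 'z) surface_scheme \<Rightarrow> 'a set \<Rightarrow> 'a \<Rightarrow> (real^2) list" where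
  "onb M f x = (SOME es. span (set es) = tangent M f x \<and>
     (\<forall>i<length es. \<forall>j<length es. riem M x (es ! i) (es ! j) = of_bool (i = j)))"

definition cov_inner :: "('a, 'z) surface_scheme \<Rightarrow> 'a set \<Rightarrow> 'a \<Rightarrow> covector \<Rightarrow> covector \<Rightarrow> real" where
  "cov_inner M f x \<alpha> \<beta> =
     (\<Sum>vs | set vs \<subseteq> set (onb M f x) \<and> length vs \<le> length (onb M f x).
        \<alpha> vs * \<beta> vs / fact (length vs))"

section \<open>Meshes\<close>

text \<open>
  \<open>cdim\<close> gives the dimension of each cell. The orientation of a cell is recorded by its Riemannian
  volume form \<open>vol\<close>; on a \<open>0\<close>-cell this is a sign at each point.
\<close>

record 'a mesh_surface = "'a surface" +
  cells :: "'a set set"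
  cdim :: "'a set \<Rightarrow> nat"
  vol :: "'a set \<Rightarrow> 'a form"

definition oriented_by_vol :: "('a::t2_space, 'z) mesh_surface_scheme \<Rightarrow> 'a set \<Rightarrow> bool" where
  "oriented_by_vol M f \<longleftrightarrow> vol M f \<in> forms M f (int (cdim M f)) \<and>
     (\<forall>x\<in>f. cov_inner M f x (vol M f x) (vol M f x) = 1) \<and>
     (\<forall>c. slice_chart M (cdim M f) f c \<longrightarrow>
        continuous_on (snd c ` (fst c \<inter> f))
          (\<lambda>y. pull M c (vol M f) y (take (cdim M f) std_basis)))"

text \<open>
  The Riemannian measure of a cell. The cell is cut into countably many pieces, each inside a slice
  chart, and on each piece the measure has density \<open>sqrt (det g)\<close>, the absolute value of the volume
  form on the coordinate basis. The result does not depend on the charts.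
\<close>

definition lebesgue_slice :: "nat \<Rightarrow> (real^2) measure" where
  "lebesgue_slice d = distr (Pi\<^sub>M {..<d} (\<lambda>_. lborel)) borel (\<lambda>t. \<Sum>i<d. t i *\<^sub>R (std_basis ! i))"

definition cell_charts :: "('a::t2_space, 'z) mesh_surface_scheme \<Rightarrow> 'a set \<Rightarrow> nat \<Rightarrow> 'a chart" where
  "cell_charts M f = (SOME c. (\<forall>i. slice_chart M (cdim M f) f (c i)) \<and> f \<subseteq> (\<Union>i. fst (c i)))"

definition cell_piece :: "('a::t2_space, 'z) mesh_surface_scheme \<Rightarrow> 'a set \<Rightarrow> nat \<Rightarrow> 'a set" where
  "cell_piece M f i = f \<inter> fst (cell_charts M f i) - (\<Union>j<i. fst (cell_charts M f j))"

definition cell_measure :: "('a::t2_space, 'z) mesh_surface_scheme \<Rightarrow> 'a set \<Rightarrow> 'a measure" where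
  "cell_measure M f = measure_of f (sets (restrict_space borel f))
     (\<lambda>B. \<Sum>i. \<integral>\<^sup>+ y. ennreal \<bar>pull M (cell_charts M f i) (vol M f) y (take (cdim M f) std_basis)\<bar>
        * indicator (snd (cell_charts M f i) ` (B \<inter> cell_piece M f i)) y
        \<partial>lebesgue_slice (cdim M f))"

text \<open>The integral over \<open>f\<close> of the top-degree form \<open>\<omega> = \<langle>\<omega>, vol\<rangle> vol\<close>.\<close>

definition form_int :: "('a::t2_space, 'z) mesh_surface_scheme \<Rightarrow> 'a set \<Rightarrow> 'a form \<Rightarrow> real" where
  "form_int M f \<omega> = (LINT x|cell_measure M f. cov_inner M f x (\<omega> x) (vol M f x))"

definition cell_diam :: "('a::t2_space, 'z) mesh_surface_scheme \<Rightarrow> 'a set \<Rightarrow> real" where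
  "cell_diam M f = measure (cell_measure M f) f powr (1 / real (cdim M f))"

definition cell_boundary :: "'a::topological_space set \<Rightarrow> 'a set" where
  "cell_boundary f = closure f - f"

definition faces :: "('a::t2_space, 'z) mesh_surface_scheme \<Rightarrow> nat \<Rightarrow> 'a set \<Rightarrow> 'a set set" where
  "faces M d' f =
     (if d' = cdim M f then {f}
      else if d' < cdim M f then {f'\<in>cells M. cdim M f' = d' \<and> f' \<subseteq> cell_boundary f}
      else {})"

text \<open>
  Besides the combinatorial axioms, cells have a finite measure (so that \<open>cell_diam\<close> and integrals
  of bounded forms make sense), and the orientation of a \<open>2\<close>-cell extends to its closure (so
  that the Hodge star preserves \<open>C\<^sup>1\<close> regularity up to the boundary and the boundary orientation
  makes sense); the latter is expressed by its volume form being \<open>C\<^sup>1\<close> up to the boundary.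
\<close>

definition mesh :: "('a::t2_space, 'z) mesh_surface_scheme \<Rightarrow> bool" where
  "mesh M \<longleftrightarrow>
     finite (cells M) \<and> \<Union> (cells M) = points M \<and> disjoint (cells M) \<and>
     (\<forall>f\<in>cells M. submanifold M (cdim M f) f \<and> oriented_by_vol M f \<and>
        emeasure (cell_measure M f) f < \<infinity> \<and>
        (cdim M f = 2 \<longrightarrow> vol M f \<in> C1_closed_forms M f 2)) \<and>
     (\<forall>f\<in>cells M. \<forall>f'\<in>cells M. cdim M f' < cdim M f \<and> f' \<inter> closure f \<noteq> {} \<longrightarrow>
        f' \<subseteq> cell_boundary f)"

text \<open>
  Orientation induced on the boundary, by the outward-vector-first rule. \<open>outward_side M f f' s x\<close>
  states that \<open>f\<close> lies, at \<open>x \<in> f'\<close>, on a side of \<open>f'\<close> for which the relative orientation is \<open>s\<close>.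
  The path \<open>p\<close>, in the coordinates of the chart at \<open>x\<close>, leaves \<open>f\<close> through \<open>x\<close> at time \<open>0\<close> with a
  velocity \<open>v\<close> transverse to \<open>f'\<close>; its velocity \<open>u t\<close> just before stands for the outward vector.
\<close>

definition outward_side ::
  "('a::t2_space, 'z) mesh_surface_scheme \<Rightarrow> 'a set \<Rightarrow> 'a set \<Rightarrow> real \<Rightarrow> 'a \<Rightarrow> bool" where
  "outward_side M f f' s x \<longleftrightarrow> (let c = chart_at M x in
     \<exists>p u v es. \<exists>\<delta>>0.
       (\<forall>t\<in>{-\<delta><..<0}. p t \<in> snd c ` (f \<inter> fst c) \<and> (p has_vector_derivative u t) (at t)) \<and>
       (p \<longlongrightarrow> snd c x) (at_left 0) \<and> (u \<longlongrightarrow> v) (at_left 0) \<and> v \<notin> tangent M f' x \<and>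
       set es \<subseteq> tangent M f' x \<and>
       (\<forall>\<^sub>F t in at_left 0. 0 < s * vol M f' x es * pull M c (vol M f) (p t) (u t # es)))"

text \<open>
  Relative orientation of \<open>f'\<close> and \<open>f\<close>, computed on each connected component of \<open>f'\<close>.
  If \<open>f\<close> lies on both sides of \<open>f'\<close> with opposite induced orientations, both contributions to the
  integral on the boundary cancel, as traces are single-valued; hence the value \<open>0\<close>.
\<close>

definition rel_orient :: "('a::t2_space, 'z) mesh_surface_scheme \<Rightarrow> 'a set \<Rightarrow> 'a set \<Rightarrow> 'a \<Rightarrow> real" where
  "rel_orient M f f' x =
     of_bool (\<exists>z\<in>connected_component_set f' x. outward_side M f f' 1 z) -
     of_bool (\<exists>z\<in>connected_component_set f' x. outward_side M f f' (-1) z)"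

abbreviation cell_d :: "('a::t2_space, 'z) mesh_surface_scheme \<Rightarrow> 'a set \<Rightarrow> 'a form \<Rightarrow> 'a form" where
  "cell_d M f \<equiv> ext_deriv M (cdim M f) f"

text \<open>Hodge star of a \<open>k\<close>-form on the cell \<open>f\<close>.\<close>

definition hodge :: "('a::t2_space, 'z) mesh_surface_scheme \<Rightarrow> 'a set \<Rightarrow> nat \<Rightarrow> 'a form \<Rightarrow> 'a form" where
  "hodge M f k \<omega> x =
     (if x \<in> f then
        THE \<beta>. \<beta> \<in> covectors (tangent M f x) (int (cdim M f) - int k) \<and>
          (\<forall>\<mu>\<in>covectors (tangent M f x) (int (cdim M f) - int k).
             (\<lambda>vs. cov_inner M f x \<beta> \<mu> * vol M f x vs) = cov_wedge (\<omega> x) \<mu>)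
      else 0)"

definition hodge_inv :: "('a::t2_space, 'z) mesh_surface_scheme \<Rightarrow> 'a set \<Rightarrow> nat \<Rightarrow> 'a form \<Rightarrow> 'a form" where
  "hodge_inv M f k \<mu> = (THE \<omega>. \<omega> \<in> forms M f (int k) \<and> hodge M f k \<omega> = \<mu>)"

text \<open>The space \<open>\<star>\<^sup>-\<^sup>1 S\<close> of \<open>k\<close>-forms.\<close>

definition hodge_inv_space ::
  "('a::t2_space, 'z) mesh_surface_scheme \<Rightarrow> 'a set \<Rightarrow> nat \<Rightarrow> 'a form set \<Rightarrow> 'a form set" where
  "hodge_inv_space M f k S = {\<omega>\<in>forms M f (int k). hodge M f k \<omega> \<in> S}"

section \<open>Local polynomial spaces\<close>

definition form_scale :: "real \<Rightarrow> 'a form \<Rightarrow> 'a form" (infixr "*\<^sub>F" 75) where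
  "a *\<^sub>F \<omega> = (\<lambda>x vs. a * \<omega> x vs)"

global_interpretation form: vector_space form_scale
  by unfold_locales (auto simp: form_scale_def fun_eq_iff algebra_simps)

text \<open>\<open>poly_forms M f r l\<close> is the space of \<open>l\<close>-forms of index \<open>r\<close> on \<open>f\<close>, and \<open>koszul M f\<close> the map \<open>\<kappa>\<close> on \<open>f\<close>.\<close>

record 'a poly_mesh = "'a mesh_surface" +
  poly_forms :: "'a set \<Rightarrow> int \<Rightarrow> int \<Rightarrow> 'a form set"
  koszul :: "'a set \<Rightarrow> 'a form \<Rightarrow> 'a form"

definition poly_spaces :: "('a::t2_space, 'z) poly_mesh_scheme \<Rightarrow> bool" where
  "poly_spaces M \<longleftrightarrow> (\<forall>f\<in>cells M. \<forall>r l.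
     (\<exists>B. finite B \<and> poly_forms M f r l = form.span B) \<and>
     poly_forms M f r l \<subseteq> C1_closed_forms M f l \<and>
     cell_d M f ` poly_forms M f r l \<subseteq> poly_forms M f (r - 1) (l + 1) \<and>
     koszul M f ` poly_forms M f r l \<subseteq> poly_forms M f (r + 1) (l - 1) \<and>
     (\<forall>p\<in>poly_forms M f r l. \<forall>q\<in>poly_forms M f r l. koszul M f (p + q) = koszul M f p + koszul M f q) \<and>
     (\<forall>a. \<forall>p\<in>poly_forms M f r l. koszul M f (a *\<^sub>F p) = a *\<^sub>F koszul M f p) \<and>
     (\<forall>p\<in>poly_forms M f r l. koszul M f (koszul M f p) = 0))"

text \<open>
  As \<open>H s l\<close> is trivial for negative \<open>s\<close>, the direct sum over \<open>s \<le> r\<close> is the finite one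
  over \<open>s \<in> {0..r}\<close>.
\<close>

definition homogeneous_decomposition ::
  "('a::t2_space, 'z) poly_mesh_scheme \<Rightarrow> 'a set \<Rightarrow> (int \<Rightarrow> int \<Rightarrow> 'a form set) \<Rightarrow> bool" where
  "homogeneous_decomposition M f H \<longleftrightarrow>
     (\<forall>s l. form.subspace (H s l)) \<and> (\<forall>s l. s < 0 \<longrightarrow> H s l = {0}) \<and>
     (\<forall>r l. poly_forms M f r l = {\<Sum>s\<in>{0..r}. h s | h. \<forall>s. h s \<in> H s l} \<and>
        (\<forall>h. (\<forall>s. h s \<in> H s l) \<and> (\<Sum>s\<in>{0..r}. h s) = 0 \<longrightarrow> (\<forall>s\<in>{0..r}. h s = 0)))"

definition hypothesis_H :: "('a::t2_space, 'z) poly_mesh_scheme \<Rightarrow> bool" where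
  "hypothesis_H M \<longleftrightarrow> (\<forall>f\<in>cells M. \<exists>H (lam :: int \<Rightarrow> int \<Rightarrow> real).
     homogeneous_decomposition M f H \<and>
     (\<forall>s l. \<forall>p\<in>H s l.
        cell_d M f (koszul M f p) + koszul M f (cell_d M f p) = lam s l *\<^sub>F p) \<and>
     (\<forall>s l. s < 0 \<longrightarrow> lam s l = (if s + l < 0 then 0 else lam (s + l) 0)) \<and>
     (cdim M f > 0 \<longrightarrow>
        (\<forall>l\<in>{0..int (cdim M f)}. \<forall>s\<ge>0. \<forall>s'\<ge>0. lam s l = lam s' l \<longrightarrow> s = s') \<and>
        (\<forall>l\<in>{0..int (cdim M f)}. \<forall>s\<ge>0. lam s l = 0 \<longleftrightarrow> (s, l) = (0, 0))) \<and>
     (\<forall>s l. s > 0 \<and> 0 \<le> l \<and> l < int (cdim M f) \<longrightarrow> cell_d M f ` H s l \<noteq> {0}))"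

text \<open>For \<open>l < 0\<close> this is the trivial space.\<close>

definition trimmed :: "('a::t2_space, 'z) poly_mesh_scheme \<Rightarrow> 'a set \<Rightarrow> int \<Rightarrow> int \<Rightarrow> 'a form set" where
  "trimmed M f r l = (if l = 0 then poly_forms M f r 0 else
     {cell_d M f p + koszul M f q | p q. p \<in> poly_forms M f r (l - 1) \<and> q \<in> poly_forms M f (r - 1) (l + 1)})"

definition hypothesis_T :: "('a::t2_space, 'z) poly_mesh_scheme \<Rightarrow> bool" where
  "hypothesis_T M \<longleftrightarrow> (\<forall>l. \<forall>f\<in>cells M. \<forall>d'\<le>cdim M f. \<forall>r\<ge>0. \<forall>f'\<in>faces M d' f.
     trace_form M f f' ` trimmed M f r l \<subseteq> trimmed M f' r l)"

text \<open>\<open>L\<^sup>2\<close>-orthogonal projector on the trimmed space.\<close>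

definition trimmed_proj ::
  "('a::t2_space, 'z) poly_mesh_scheme \<Rightarrow> 'a set \<Rightarrow> int \<Rightarrow> int \<Rightarrow> 'a form \<Rightarrow> 'a form" where
  "trimmed_proj M f r l \<omega> = (THE p. p \<in> trimmed M f r l \<and>
     (\<forall>q\<in>trimmed M f r l. (LINT x|cell_measure M f. cov_inner M f x ((\<omega> - p) x) (q x)) = 0))"

section \<open>The discrete complex\<close>

text \<open>
  Discrete forms are families of forms indexed by all sets, null except on cells of dimension at
  least \<open>k\<close>. The local operators on \<open>f\<close> take the whole family but use only the components on \<open>f\<close>
  and its faces.
\<close>

type_synonym 'a cochain = "'a set \<Rightarrow> 'a form"

definition disc_space :: "('a::t2_space, 'z) poly_mesh_scheme \<Rightarrow> int \<Rightarrow> nat \<Rightarrow> 'a cochain set" where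
  "disc_space M r k = {\<omega>. \<forall>f.
     if f \<in> cells M \<and> k \<le> cdim M f
     then \<omega> f \<in> hodge_inv_space M f k (trimmed M f r (int (cdim M f) - int k))
     else \<omega> f = 0}"

text \<open>In the next two definitions \<open>P f'\<close> stands for the potential on the face \<open>f'\<close> of \<open>f\<close>.\<close>

definition boundary_int ::
  "('a::t2_space, 'z) poly_mesh_scheme \<Rightarrow> 'a set \<Rightarrow> 'a cochain \<Rightarrow> 'a form \<Rightarrow> real" where
  "boundary_int M f P \<mu> = (\<Sum>f'\<in>faces M (cdim M f - 1) f.
     form_int M f' (\<lambda>x vs. rel_orient M f f' x * wedge (P f') (trace_form M f f' \<mu>) x vs))"

definition local_d_from ::
  "('a::t2_space, 'z) poly_mesh_scheme \<Rightarrow> int \<Rightarrow> nat \<Rightarrow> 'a cochain \<Rightarrow> 'a cochain \<Rightarrow> 'a set \<Rightarrow> 'a form"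
where
  "local_d_from M r k P \<omega> f =
     (let S = poly_forms M f r (int (cdim M f) - int k - 1) in
      THE \<eta>. \<eta> \<in> hodge_inv_space M f (k + 1) S \<and>
        (\<forall>\<mu>\<in>S. form_int M f (wedge \<eta> \<mu>) =
           (-1) ^ (k + 1) * form_int M f (wedge (\<omega> f) (cell_d M f \<mu>)) + boundary_int M f P \<mu>))"

text \<open>The potential on \<open>d\<close>-cells, by recursion on \<open>d\<close>.\<close>

primrec potential_dim ::
  "('a::t2_space, 'z) poly_mesh_scheme \<Rightarrow> int \<Rightarrow> nat \<Rightarrow> nat \<Rightarrow> 'a cochain \<Rightarrow> 'a set \<Rightarrow> 'a form"
where
  "potential_dim M r k 0 \<omega> f = \<omega> f"
| "potential_dim M r k (Suc d) \<omega> f =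
     (if Suc d \<le> k then \<omega> f
      else let P = potential_dim M r k d \<omega>; l = int (Suc d) - int k in
        THE p. p \<in> hodge_inv_space M f k (poly_forms M f r l) \<and>
          (\<forall>\<mu>\<in>koszul M f ` poly_forms M f r l. \<forall>\<nu>\<in>koszul M f ` poly_forms M f (r - 1) (l + 1).
             (-1) ^ (k + 1) * form_int M f (wedge p (cell_d M f \<mu> + \<nu>)) =
               form_int M f (wedge (local_d_from M r k P \<omega> f) \<mu>) - boundary_int M f P \<mu>
               + (-1) ^ (k + 1) * form_int M f (wedge (\<omega> f) \<nu>)))"

definition potential ::
  "('a::t2_space, 'z) poly_mesh_scheme \<Rightarrow> int \<Rightarrow> nat \<Rightarrow> 'a cochain \<Rightarrow> 'a set \<Rightarrow> 'a form" where
  "potential M r k \<omega> f = potential_dim M r k (cdim M f) \<omega> f"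

definition local_d ::
  "('a::t2_space, 'z) poly_mesh_scheme \<Rightarrow> int \<Rightarrow> nat \<Rightarrow> 'a cochain \<Rightarrow> 'a set \<Rightarrow> 'a form" where
  "local_d M r k \<omega> f = local_d_from M r k (potential M r k \<omega>) \<omega> f"

definition global_d ::
  "('a::t2_space, 'z) poly_mesh_scheme \<Rightarrow> int \<Rightarrow> nat \<Rightarrow> 'a cochain \<Rightarrow> 'a cochain" where
  "global_d M r k \<omega> f =
     (if f \<in> cells M \<and> k + 1 \<le> cdim M f then
        hodge_inv M f (k + 1)
          (trimmed_proj M f r (int (cdim M f) - int k - 1) (hodge M f (k + 1) (local_d M r k \<omega> f)))
      else 0)"

definition disc_inner ::
  "('a::t2_space, 'z) poly_mesh_scheme \<Rightarrow> int \<Rightarrow> nat \<Rightarrow> 'a cochain \<Rightarrow> 'a cochain \<Rightarrow> real" where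
  "disc_inner M r k \<omega> \<mu> =
     (\<Sum>f | f \<in> cells M \<and> cdim M f = 2.
        form_int M f (wedge (potential M r k \<omega> f) (hodge M f k (potential M r k \<mu> f))) +
        (\<Sum>d\<in>{k..<2}. cell_diam M f ^ (2 - d) *
           (\<Sum>f'\<in>faces M d f. form_int M f'
              (wedge (potential M r k \<omega> f' - trace_form M f f' (potential M r k \<omega> f))
                 (hodge M f' k (potential M r k \<mu> f' - trace_form M f f' (potential M r k \<mu> f)))))))"

section \<open>Time-dependent discrete forms\<close>

definition C1_on_Icc :: "real \<Rightarrow> (real \<Rightarrow> real) \<Rightarrow> bool" where
  "C1_on_Icc T c \<longleftrightarrow> (\<exists>c'. continuous_on {0..T} c' \<and>
     (\<forall>t\<in>{0..T}. (c has_real_derivative c' t) (at t within {0..T})))"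

text \<open>
  \<open>C\<^sup>1\<close> curves on \<open>[0,T]\<close> in a finite-dimensional space of discrete forms: those with \<open>C\<^sup>1\<close> coordinates.
  Their derivative is then the pointwise one.
\<close>

definition C1_curve :: "real \<Rightarrow> 'a cochain set \<Rightarrow> (real \<Rightarrow> 'a cochain) \<Rightarrow> bool" where
  "C1_curve T X u \<longleftrightarrow> (\<exists>N (e :: nat \<Rightarrow> 'a cochain) c.
     (\<forall>i<N. e i \<in> X \<and> C1_on_Icc T (c i)) \<and>
     (\<forall>t\<in>{0..T}. u t \<in> X \<and> (\<forall>f x vs. u t f x vs = (\<Sum>i<N. c i t * e i f x vs))))"

definition time_deriv :: "(real \<Rightarrow> 'a cochain) \<Rightarrow> real \<Rightarrow> 'a cochain" where
  "time_deriv u t = (\<lambda>f x vs. deriv (\<lambda>s. u s f x vs) t)"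

end

theory Submission
  imports Defs
begin

text \<open>
  Testing the scheme with \<open>v\<^sup>1 = E\<close> and \<open>v\<^sup>2 = B\<close> gives
  \<open>\<langle>E', E\<rangle> = \<langle>B, dE\<rangle> = \<langle>dE, B\<rangle> = -\<langle>B', B\<rangle>\<close>, so the energy, a quadratic form along a \<open>C\<^sup>1\<close>
  curve, has zero derivative inside \<open>(0,T)\<close> and is constant on \<open>[0,T]\<close> by continuity.

  All the work is in showing that the discrete inner products are symmetric and bilinear and that
  \<open>d\<close> maps discrete \<open>1\<close>-forms to discrete \<open>2\<close>-forms, i.e. that the descriptions (\<open>THE\<close>, \<open>SOME\<close>)
  defining the operators denote and depend linearly on their arguments. As
  \<open>\<omega> \<and> \<mu> = \<langle>\<star>\<omega>, \<mu>\<rangle> vol\<close>, the local derivative and the potential are Riesz representatives for the \<open>L\<^sup>2\<close> inner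
  product on a polynomial space. It is positive definite because the Riemannian measure of a
  \<open>2\<close>-cell charges nonempty open sets, and the integrands are integrable because they are
  continuous and, by compactness of the surface, bounded. For the potential one also needs the decomposition
  \<open>P\<^sub>r\<Lambda>\<^sup>1 = d\<kappa>P\<^sub>r\<Lambda>\<^sup>1 \<oplus> \<kappa>P\<^sub>r\<^sub>-\<^sub>1\<Lambda>\<^sup>2\<close> with \<open>d\<close> injective on \<open>\<kappa>P\<^sub>r\<Lambda>\<^sup>1\<close>, which follows from the homotopy formula;
  and its trace is linear because \<open>\<star>\<^sup>-\<^sup>1\<close> preserves \<open>C\<^sup>1\<close> regularity up to the boundary.
\<close>

section \<open>Covectors of low degree\<close>

text \<open>Only the degrees k = 1 and k = 2 occur, so vertices never enter, and on an edge the
  potential is the component itself; the one genuine recursion step leads from edges to 2-cells. The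
  two dimensions are treated by different means. On a 2-cell the relevant forms extend to C1 forms
  on the whole surface. Their pointwise inner products are expressed in coordinate frames, because
  the orthonormal bases come from \<open>SOME\<close> and vary without any regularity. On an edge
  the volume form is only known to be continuous on the open edge, so regularity up to the end
  points cannot be passed through the star; the class \<open>edge_forms\<close> therefore keeps just
  a continuous bounded density. In the definition of the potential the test pair (\<mu>, \<nu>) has
  to be recovered from d \<mu> + \<nu>: the choice of preimages under \<kappa> need not be linear,
  but their images under \<kappa> are. Finally, for k = 1 on a 2-cell the starred derivative has
  degree 0, where the trimmed space is the full polynomial space, so the projector in
  \<open>global_d\<close> changes nothing.\<close>

definition const_cov :: "real \<Rightarrow> covector" where
  "const_cov a vs = (if vs = [] then a else 0)"

lemma covectors_0: "covectors V 0 = range const_cov"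
proof -
  have "\<alpha> \<in> range const_cov" if "\<alpha> \<in> covectors V 0" for \<alpha>
  proof -
    have "\<alpha> = const_cov (\<alpha> [])"
      using that by (fastforce simp: covectors_def const_cov_def)
    then show ?thesis by blast
  qed
  moreover have "const_cov a \<in> covectors V 0" for a
    by (auto simp: covectors_def const_cov_def)
  ultimately show ?thesis by blast
qed

lemma const_cov_in [simp]: "const_cov a \<in> covectors V 0"
  by (simp add: covectors_0)

lemma covectors_vanish:
  assumes "\<alpha> \<in> covectors V l" "\<not> (int (length vs) = l \<and> set vs \<subseteq> V)"
  shows "\<alpha> vs = 0"
  using assms by (auto simp: covectors_def)

lemma covectors_0D:
  assumes "\<alpha> \<in> covectors V 0"
  shows "\<alpha> = const_cov (\<alpha> [])"
  using assms by (auto simp: covectors_0 const_cov_def)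

lemma covectors_zero [simp]: "0 \<in> covectors V l"
  by (auto simp: covectors_def)

lemma covectors_multilinear:
  assumes "\<alpha> \<in> covectors V l" "int (length vs) = l" "set vs \<subseteq> V" "i < length vs" "u \<in> V" "w \<in> V"
  shows "\<alpha> (vs[i := a *\<^sub>R u + b *\<^sub>R w]) = a * \<alpha> (vs[i := u]) + b * \<alpha> (vs[i := w])"
proof -
  have "\<forall>vs i u w a b. int (length vs) = l \<and> set vs \<subseteq> V \<and> i < length vs \<and> u \<in> V \<and> w \<in> V \<longrightarrow>
        \<alpha> (vs[i := a *\<^sub>R u + b *\<^sub>R w]) = a * \<alpha> (vs[i := u]) + b * \<alpha> (vs[i := w])"
    using assms(1) unfolding covectors_def mem_Collect_eq by (elim conjE)
  then show ?thesis using assms(2-) by simp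
qed

lemma covectors_alternating:
  assumes "\<alpha> \<in> covectors V l" "i < j" "j < length vs" "vs ! i = vs ! j"
  shows "\<alpha> vs = 0"
proof -
  have "\<forall>vs i j. i < j \<and> j < length vs \<and> vs ! i = vs ! j \<longrightarrow> \<alpha> vs = 0"
    using assms(1) unfolding covectors_def mem_Collect_eq by (elim conjE)
  then show ?thesis using assms(2-) by blast
qed

lemma covectorsI:
  assumes "\<And>vs. \<not> (int (length vs) = l \<and> set vs \<subseteq> V) \<Longrightarrow> \<alpha> vs = 0"
    and "\<And>vs i u w a b. int (length vs) = l \<Longrightarrow> set vs \<subseteq> V \<Longrightarrow> i < length vs \<Longrightarrow> u \<in> V \<Longrightarrow> w \<in> V \<Longrightarrow>
        \<alpha> (vs[i := a *\<^sub>R u + b *\<^sub>R w]) = a * \<alpha> (vs[i := u]) + b * \<alpha> (vs[i := w])"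
    and "\<And>vs i j. i < j \<Longrightarrow> j < length vs \<Longrightarrow> vs ! i = vs ! j \<Longrightarrow> \<alpha> vs = 0"
  shows "\<alpha> \<in> covectors V l"
  unfolding covectors_def mem_Collect_eq
proof (intro conjI allI impI; (elim conjE)?)
  show "\<alpha> vs = 0" if "\<not> (int (length vs) = l \<and> set vs \<subseteq> V)" for vs by (rule assms(1)[OF that])
  show "\<alpha> (vs[i := a *\<^sub>R u + b *\<^sub>R w]) = a * \<alpha> (vs[i := u]) + b * \<alpha> (vs[i := w])"
    if "int (length vs) = l" "set vs \<subseteq> V" "i < length vs" "u \<in> V" "w \<in> V" for vs i u w a b
    by (rule assms(2)[OF that])
  show "\<alpha> vs = 0" if "i < j" "j < length vs" "vs ! i = vs ! j" for vs i j by (rule assms(3)[OF that])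
qed

lemma covectors_lin:
  assumes "\<alpha> \<in> covectors V l" "\<beta> \<in> covectors V l"
  shows "(\<lambda>vs. a * \<alpha> vs + b * \<beta> vs) \<in> covectors V l"
proof (rule covectorsI)
  show "a * \<alpha> (vs[i := p *\<^sub>R u + q *\<^sub>R w]) + b * \<beta> (vs[i := p *\<^sub>R u + q *\<^sub>R w]) =
      p * (a * \<alpha> (vs[i := u]) + b * \<beta> (vs[i := u])) +
      q * (a * \<alpha> (vs[i := w]) + b * \<beta> (vs[i := w]))"
    if "int (length vs) = l" "set vs \<subseteq> V" "i < length vs" "u \<in> V" "w \<in> V" for vs i u w p q
    using covectors_multilinear[OF assms(1) that, of p q] covectors_multilinear[OF assms(2) that, of p q]
    by (simp add: algebra_simps)
  show "a * \<alpha> vs + b * \<beta> vs = 0" if "\<not> (int (length vs) = l \<and> set vs \<subseteq> V)" for vs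
    using assms[THEN covectors_vanish] that by simp
  show "a * \<alpha> vs + b * \<beta> vs = 0" if "i < j" "j < length vs" "vs ! i = vs ! j" for vs i j
    using assms[THEN covectors_alternating[OF _ that]] by simp
qed

text \<open>Alternation is vacuous in degree 1: a list with two distinct positions has the wrong
  length.\<close>

lemma covectors_1I:
  assumes "\<And>vs. \<not> (length vs = 1 \<and> set vs \<subseteq> V) \<Longrightarrow> \<alpha> vs = 0"
    and "\<And>u w a b. u \<in> V \<Longrightarrow> w \<in> V \<Longrightarrow> \<alpha> [a *\<^sub>R u + b *\<^sub>R w] = a * \<alpha> [u] + b * \<alpha> [w]"
  shows "\<alpha> \<in> covectors V 1"
proof (rule covectorsI)
  show "\<alpha> (vs[i := a *\<^sub>R u + b *\<^sub>R w]) = a * \<alpha> (vs[i := u]) + b * \<alpha> (vs[i := w])"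
    if "int (length vs) = 1" "i < length vs" "u \<in> V" "w \<in> V" for vs i u w a b
  proof -
    obtain v where "vs = [v]" using \<open>int (length vs) = 1\<close> by (auto simp: length_Suc_conv)
    then show ?thesis using that assms(2) by simp
  qed
  show "\<alpha> vs = 0" if "i < j" "j < length vs" "vs ! i = vs ! j" for vs i j
    using assms(1)[of vs] that by auto
  show "\<alpha> vs = 0" if "\<not> (int (length vs) = 1 \<and> set vs \<subseteq> V)" for vs
    using assms(1)[of vs] that by auto
qed

lemma covectors_1D:
  assumes "\<alpha> \<in> covectors V 1" "u \<in> V" "w \<in> V"
  shows "\<alpha> [a *\<^sub>R u + b *\<^sub>R w] = a * \<alpha> [u] + b * \<alpha> [w]"
  using covectors_multilinear[OF assms(1), of "[u]" 0 u w a b] assms by simp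

lemma covectors_2D:
  assumes "\<alpha> \<in> covectors V 2" "u \<in> V" "w \<in> V" "v \<in> V"
  shows "\<alpha> [a *\<^sub>R u + b *\<^sub>R w, v] = a * \<alpha> [u, v] + b * \<alpha> [w, v]"
    and "\<alpha> [v, a *\<^sub>R u + b *\<^sub>R w] = a * \<alpha> [v, u] + b * \<alpha> [v, w]"
    and "\<alpha> [v, v] = 0"
proof -
  show "\<alpha> [a *\<^sub>R u + b *\<^sub>R w, v] = a * \<alpha> [u, v] + b * \<alpha> [w, v]"
    using covectors_multilinear[OF assms(1), of "[v, v]" 0 u w a b] assms by simp
  show "\<alpha> [v, a *\<^sub>R u + b *\<^sub>R w] = a * \<alpha> [v, u] + b * \<alpha> [v, w]"
    using covectors_multilinear[OF assms(1), of "[v, v]" 1 u w a b] assms by simp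
  show "\<alpha> [v, v] = 0"
    using covectors_alternating[OF assms(1), of 0 1 "[v, v]"] by simp
qed

text \<open>Polarisation: expand the vanishing value of \<alpha> at [u + v, u + v].\<close>

lemma covectors_2_antisym:
  assumes "\<alpha> \<in> covectors V 2" "u \<in> V" "v \<in> V" "subspace V"
  shows "\<alpha> [v, u] = - \<alpha> [u, v]"
proof -
  have "u + v \<in> V" using assms by (simp add: subspace_add)
  then have "\<alpha> [u + v, u + v] = 0" using covectors_2D(3)[OF assms(1)] by blast
  moreover have "\<alpha> [u + v, u + v] = \<alpha> [u, u + v] + \<alpha> [v, u + v]"
    using covectors_2D(1)[OF assms(1-3) \<open>u + v \<in> V\<close>, of 1 1] by simp
  moreover have "\<alpha> [u, u + v] = \<alpha> [u, u] + \<alpha> [u, v]" "\<alpha> [v, u + v] = \<alpha> [v, u] + \<alpha> [v, v]"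
    using covectors_2D(2)[OF assms(1-3), of _ 1 1] assms by simp_all
  moreover have "\<alpha> [u, u] = 0" "\<alpha> [v, v] = 0"
    using covectors_2D(3)[OF assms(1-2)] covectors_2D(3)[OF assms(1) assms(3)] assms by auto
  ultimately show ?thesis by simp
qed

text \<open>The scalar is the determinant of the coefficients. Comparisons between orthonormal and
  coordinate bases in degree 2 rest on this.\<close>

lemma covectors_2_expand:
  assumes "\<alpha> \<in> covectors V 2" "subspace V" "u \<in> V" "v \<in> V"
  shows "\<alpha> [p *\<^sub>R u + q *\<^sub>R v, r *\<^sub>R u + s *\<^sub>R v] = (p * s - q * r) * \<alpha> [u, v]"
proof -
  have rs: "r *\<^sub>R u + s *\<^sub>R v \<in> V" using assms by (simp add: subspace_add subspace_scale)
  have "\<alpha> [p *\<^sub>R u + q *\<^sub>R v, r *\<^sub>R u + s *\<^sub>R v] =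
      p * (r * \<alpha> [u, u] + s * \<alpha> [u, v]) + q * (r * \<alpha> [v, u] + s * \<alpha> [v, v])"
    using assms rs by (simp add: covectors_2D(1,2)[OF assms(1)])
  then show ?thesis
    using covectors_2D(3)[OF assms(1,3,3,3)] covectors_2D(3)[OF assms(1,4,4,4)]
      covectors_2_antisym[OF assms(1,3,4,2)]
    by (simp add: algebra_simps)
qed

section \<open>Wedge products of low degree\<close>

lemma cov_wedge_lin:
  "cov_wedge (\<lambda>vs. a * \<alpha> vs + b * \<alpha>' vs) \<beta> vs = a * cov_wedge \<alpha> \<beta> vs + b * cov_wedge \<alpha>' \<beta> vs"
  by (simp add: cov_wedge_def sum_distrib_left sum_divide_distrib algebra_simps sum.distrib add_divide_distrib)

text \<open>In each summand the first p entries must form a list of length a in V and the others a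
  list of length b in V, while permuting a list preserves its length and its set. Identities between
  wedge products thus need checking only on lists of the product degree.\<close>

lemma cov_wedge_vanish:
  assumes "\<alpha> \<in> covectors V a" "\<beta> \<in> covectors V b"
    and "\<not> (int (length vs) = a + b \<and> set vs \<subseteq> V)"
  shows "cov_wedge \<alpha> \<beta> vs = 0"
proof -
  have "\<alpha> (take p (permute_list \<sigma> vs)) * \<beta> (drop p (permute_list \<sigma> vs)) = 0"
    if "p \<le> length vs" "\<sigma> permutes {..<length vs}" for p \<sigma>
  proof (rule ccontr)
    let ?w = "permute_list \<sigma> vs"
    assume "\<not> ?thesis"
    then have "\<alpha> (take p ?w) \<noteq> 0" "\<beta> (drop p ?w) \<noteq> 0" by auto
    then have "int (length (take p ?w)) = a" "set (take p ?w) \<subseteq> V"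
      "int (length (drop p ?w)) = b" "set (drop p ?w) \<subseteq> V"
      using covectors_vanish[OF assms(1)] covectors_vanish[OF assms(2)] by blast+
    moreover have "set ?w = set (take p ?w) \<union> set (drop p ?w)"
      by (metis append_take_drop_id set_append)
    moreover have "set ?w = set vs" using that by simp
    ultimately show False using assms(3) that by simp
  qed
  then have "(\<Sum>\<sigma> | \<sigma> permutes {..<length vs}.
      of_int (sign \<sigma>) * \<alpha> (take p (permute_list \<sigma> vs)) * \<beta> (drop p (permute_list \<sigma> vs))) = 0"
    if "p \<le> length vs" for p
    using that by (intro sum.neutral ballI) (simp add: mult.assoc)
  then show ?thesis unfolding cov_wedge_def by simp
qed

lemma permutes_lessThan_1: "{\<sigma>. \<sigma> permutes {..<Suc 0}} = {id}"
  by (simp add: lessThan_Suc permutes_sing)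

lemma permutes_lessThan_2: "{\<sigma>. \<sigma> permutes {..<Suc (Suc 0)}} = {id, Transposition.transpose 0 1}"
proof -
  have "\<sigma> \<in> {id, Transposition.transpose 0 1}" if "\<sigma> permutes {..<Suc (Suc 0)}" for \<sigma> :: "nat \<Rightarrow> nat"
  proof -
    have *: "\<sigma> permutes {0, 1}" using that by (simp add: lessThan_Suc insert_commute)
    then show ?thesis by (simp add: permutes_doubleton_iff)
  qed
  moreover have "Transposition.transpose 0 1 permutes {..<Suc (Suc 0)}"
    by (rule permutes_swap_id) auto
  ultimately show ?thesis by (auto simp: permutes_id)
qed

lemma cov_wedge_1: "cov_wedge \<alpha> \<beta> [v] = \<alpha> [] * \<beta> [v] + \<alpha> [v] * \<beta> []"
  by (simp add: cov_wedge_def permutes_lessThan_1 sign_id permute_list_id)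

text \<open>The factors are any functions on lists, which is why the outer terms appear
  antisymmetrised and halved; for a 2-covector the halved difference is its value.\<close>

lemma cov_wedge_2:
  "cov_wedge \<alpha> \<beta> [v, w] = \<alpha> [] * (\<beta> [v, w] - \<beta> [w, v]) / 2 + (\<alpha> [v] * \<beta> [w] - \<alpha> [w] * \<beta> [v])
     + (\<alpha> [v, w] - \<alpha> [w, v]) * \<beta> [] / 2"
proof -
  have ne: "id \<noteq> Transposition.transpose (0::nat) 1" by (metis id_apply transpose_apply_first zero_neq_one)
  have "permute_list (Transposition.transpose 0 1) [v, w] = [w, v]"
    by (simp add: permute_list_def upt_rec)
  then show ?thesis using ne
    by (simp add: cov_wedge_def permutes_lessThan_2 sign_id permute_list_id numeral_2_eq_2
        atMost_Suc sign_swap_id algebra_simps diff_divide_distrib)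
qed

section \<open>Orthonormal bases and the Hodge star at a point\<close>

lemma inner_product_on_planeD:
  assumes "inner_product_on_plane g"
  shows "g v (a *\<^sub>R u + b *\<^sub>R w) = a * g v u + b * g v w"
    and "g (a *\<^sub>R u + b *\<^sub>R w) v = a * g u v + b * g w v"
    and "g u v = g v u" and "v \<noteq> 0 \<Longrightarrow> g v v > 0" and "g v 0 = 0" and "g 0 v = 0"
    and "g v (a *\<^sub>R u) = a * g v u" and "g (a *\<^sub>R u) v = a * g u v"
    and "linear (g v)"
proof -
  have lin: "linear (g v)" for v using assms by (simp add: inner_product_on_plane_def)
  show sym: "g u v = g v u" for u v using assms by (simp add: inner_product_on_plane_def)
  show *: "g v (a *\<^sub>R u + b *\<^sub>R w) = a * g v u + b * g v w" for v
    using lin[of v] by (simp add: linear_add linear_scale)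
  show "g (a *\<^sub>R u + b *\<^sub>R w) v = a * g u v + b * g w v"
    using *[of v] sym by simp
  show "v \<noteq> 0 \<Longrightarrow> g v v > 0" using assms by (simp add: inner_product_on_plane_def)
  show "g v 0 = 0" using lin by (simp add: linear_0)
  then show "g 0 v = 0" using sym by metis
  show "g v (a *\<^sub>R u) = a * g v u" for v using lin[of v] by (simp add: linear_scale)
  then show "g (a *\<^sub>R u) v = a * g u v" using sym by metis
  show "linear (g v)" by fact
qed

definition orthonormal_list :: "(real^2 \<Rightarrow> real^2 \<Rightarrow> real) \<Rightarrow> (real^2) list \<Rightarrow> bool" where
  "orthonormal_list g es \<longleftrightarrow> (\<forall>i<length es. \<forall>j<length es. g (es ! i) (es ! j) = of_bool (i = j))"

lemma orthonormal_list_distinct: "orthonormal_list g es \<Longrightarrow> distinct es"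
  unfolding orthonormal_list_def distinct_conv_nth
  by (metis (full_types) of_bool_eq_1_iff)

lemma orthonormal_list_independent:
  assumes g: "inner_product_on_plane g" and es: "orthonormal_list g es"
  shows "independent (set es)"
proof
  assume "dependent (set es)"
  then obtain c v where c: "(\<Sum>v\<in>set es. c v *\<^sub>R v) = 0" "v \<in> set es" "c v \<noteq> 0"
    by (auto simp: dependent_finite)
  have "g v (\<Sum>w\<in>set es. c w *\<^sub>R w) = (\<Sum>w\<in>set es. c w * g v w)"
    using inner_product_on_planeD(9)[OF g] by (simp add: linear_sum linear_scale)
  also have "\<dots> = (\<Sum>w\<in>set es. if w = v then c w else 0)"
  proof (rule sum.cong)
    fix w assume "w \<in> set es"
    then show "c w * g v w = (if w = v then c w else 0)"
      using es c(2) by (auto simp: orthonormal_list_def in_set_conv_nth)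
  qed simp
  also have "\<dots> = c v" using c(2) by simp
  finally show False using c inner_product_on_planeD(5)[OF g] by simp
qed

lemma orthonormal_list_length:
  assumes "inner_product_on_plane g" "orthonormal_list g es" "span (set es) = V"
  shows "length es = dim V"
  using orthonormal_list_independent[OF assms(1,2)] orthonormal_list_distinct[OF assms(2)] assms(3)
  by (metis dim_eq_card_independent dim_span distinct_card)

text \<open>Gram-Schmidt for \<open>g\<close>. The induction preserves the span of the vectors
  treated so far, so a vector whose residual vanishes is simply dropped.\<close>

lemma orthonormal_list_exists:
  assumes g: "inner_product_on_plane g" and V: "subspace V"
  shows "\<exists>es. span (set es) = V \<and> orthonormal_list g es"
proof -
  note gD = inner_product_on_planeD[OF g]
  obtain B where B: "finite B" "independent B" "span B = V"
    using V by (metis finiteI_independent basis_exists span_subspace)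
  have "\<exists>es. span (set es) = span B \<and> orthonormal_list g es"
    using B(1)
  proof (induction B)
    case empty
    show ?case by (rule exI[of _ "[]"]) (simp add: orthonormal_list_def)
  next
    case (insert b B)
    then obtain es where es: "span (set es) = span B" "orthonormal_list g es" by blast
    \<comment> \<open>The \<open>g\<close>-orthogonal projection of b on the span built so
      far.\<close>
    define q where "q = (\<Sum>i<length es. g b (es ! i) *\<^sub>R (es ! i))"
    define e where "e = b - q"
    have q: "q \<in> span (set es)" unfolding q_def
      by (intro span_sum span_scale span_base) simp
    have ge: "g (es ! i) e = 0" if "i < length es" for i
    proof -
      have lin: "linear (g (es ! i))" by (rule gD(9))
      have "g (es ! i) q = (\<Sum>j<length es. g b (es ! j) * g (es ! i) (es ! j))"
        unfolding q_def using lin by (simp add: linear_sum linear_scale)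
      also have "\<dots> = (\<Sum>j<length es. if j = i then g b (es ! j) else 0)"
        by (rule sum.cong) (use es(2) that in \<open>auto simp: orthonormal_list_def\<close>)
      also have "\<dots> = g (es ! i) b" using that gD(3) by simp
      finally show ?thesis unfolding e_def using lin by (simp add: linear_diff)
    qed
    show ?case
    proof (cases "e = 0")
      case True
      then have "b \<in> span B" using q es(1) e_def by simp
      then show ?thesis using es by (metis span_redundant)
    next
      case False
      define u where "u = (1 / sqrt (g e e)) *\<^sub>R e"
      have pos: "g e e > 0" using False gD(4) by blast
      have uu: "g u u = 1"
      proof -
        have "g u u = g e e / (sqrt (g e e) * sqrt (g e e))"
          unfolding u_def by (simp only: gD(7,8)) simp
        then show ?thesis using pos by simp
      qed
      have gu: "g (es ! i) u = 0" if "i < length es" for i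
        unfolding u_def using ge[OF that] by (simp only: gD(7) mult_zero_right)
      then have gu': "g u (es ! i) = 0" if "i < length es" for i
        using that by (simp only: gD(3)[of u])
      have "orthonormal_list g (u # es)"
        unfolding orthonormal_list_def
      proof (intro allI impI)
        fix i j assume ij: "i < length (u # es)" "j < length (u # es)"
        show "g ((u # es) ! i) ((u # es) ! j) = of_bool (i = j)"
          using ij es(2) by (cases i; cases j) (simp_all add: orthonormal_list_def uu gu gu')
      qed
      moreover have "span (set (u # es)) = span (insert b B)"
      proof -
        have "u \<in> span (insert e (set es))" unfolding u_def by (simp add: span_scale span_base)
        moreover have "e = sqrt (g e e) *\<^sub>R u" unfolding u_def using pos by simp
        then have "e \<in> span (insert u (set es))" by (metis insertI1 span_base span_scale)
        ultimately have "span (insert u (set es)) = span (insert e (set es))"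
          unfolding span_eq by (auto intro: span_base)
        also have "\<dots> = span (insert b (set es))"
        proof -
          have q2: "q \<in> span (insert b (set es))" "q \<in> span (insert e (set es))"
            using q span_mono[of "set es"] by blast+
          have "e \<in> span (insert b (set es))"
            unfolding e_def by (rule span_diff[OF span_base q2(1)]) simp
          moreover have "b \<in> span (insert e (set es))"
            using span_add[OF span_base q2(2), of e] by (simp add: e_def)
          ultimately show ?thesis unfolding span_eq by (auto intro: span_base)
        qed
        also have "\<dots> = span (insert b B)" using es(1) by (simp only: span_insert)
        finally show ?thesis by simp
      qed
      ultimately show ?thesis by blast
    qed
  qed
  then show ?thesis using B(3) by simp
qed

lemma onb_props:
  assumes "inner_product_on_plane (riem M x)" "subspace (tangent M f x)"
  shows "span (set (onb M f x)) = tangent M f x" "orthonormal_list (riem M x) (onb M f x)"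
    "length (onb M f x) = dim (tangent M f x)"
proof -
  have "span (set (onb M f x)) = tangent M f x \<and>
     (\<forall>i<length (onb M f x). \<forall>j<length (onb M f x). riem M x (onb M f x ! i) (onb M f x ! j) = of_bool (i = j))"
    unfolding onb_def
    by (rule someI_ex) (use orthonormal_list_exists[OF assms] in \<open>simp add: orthonormal_list_def\<close>)
  then show *: "span (set (onb M f x)) = tangent M f x" "orthonormal_list (riem M x) (onb M f x)"
    unfolding orthonormal_list_def by blast+
  show "length (onb M f x) = dim (tangent M f x)"
    using orthonormal_list_length[OF assms(1) *(2,1)] .
qed

lemma onb_1:
  assumes "inner_product_on_plane (riem M x)" "subspace (tangent M f x)" "dim (tangent M f x) = 1"
  obtains u where "onb M f x = [u]" "tangent M f x = span {u}" "riem M x u u = 1"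
proof -
  note * = onb_props[OF assms(1,2)]
  obtain u where u: "onb M f x = [u]" using *(3) assms(3) by (auto simp: length_Suc_conv)
  then show ?thesis using * that[of u] by (auto simp: orthonormal_list_def)
qed

lemma span_pair: "(v::'b::real_vector) \<in> span {a, b} \<Longrightarrow> \<exists>p q. v = p *\<^sub>R a + q *\<^sub>R b"
  by (auto simp: span_insert) (metis add.commute diff_add_cancel)

lemma onb_2:
  assumes "inner_product_on_plane (riem M x)" "subspace (tangent M f x)" "dim (tangent M f x) = 2"
  obtains u v where "onb M f x = [u, v]" "u \<noteq> v" "tangent M f x = UNIV" "\<And>w. \<exists>p q. w = p *\<^sub>R u + q *\<^sub>R v"
    "riem M x u u = 1" "riem M x u v = 0" "riem M x v u = 0" "riem M x v v = 1"
proof -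
  note * = onb_props[OF assms(1,2)]
  obtain u v where u: "onb M f x = [u, v]" using *(3) assms(3)
    by (auto simp: length_Suc_conv numeral_2_eq_2)
  have "tangent M f x = UNIV" using assms(2,3) dim_eq_full[of "tangent M f x"]
    by (simp add: span_eq_iff[THEN iffD2])
  moreover have "u \<noteq> v" using orthonormal_list_distinct[OF *(2)] u by simp
  moreover have "\<exists>p q. w = p *\<^sub>R u + q *\<^sub>R v" for w
    using span_pair[of w u v] *(1) u calculation(1) by simp
  moreover have "riem M x u u = 1" "riem M x u v = 0" "riem M x v u = 0" "riem M x v v = 1"
    using *(2) u unfolding orthonormal_list_def by (auto simp: All_less_Suc)
  ultimately show ?thesis using u that by blast
qed

lemma finite_cov_inner_index:
  "finite {vs. set vs \<subseteq> set es \<and> length vs \<le> length es}"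
  by (rule finite_lists_length_le) simp

text \<open>The definition sums over lists of all admissible lengths; \<alpha> vanishes off length
  l, and the bound on l ensures that every list of length l is among the indices.\<close>

lemma cov_inner_degree:
  assumes "\<alpha> \<in> covectors V (int l)" "l \<le> length (onb M f x)"
  shows "cov_inner M f x \<alpha> \<beta> =
    (\<Sum>vs | set vs \<subseteq> set (onb M f x) \<and> length vs = l. \<alpha> vs * \<beta> vs / fact l)"
proof -
  have "cov_inner M f x \<alpha> \<beta> =
    (\<Sum>vs | set vs \<subseteq> set (onb M f x) \<and> length vs = l. \<alpha> vs * \<beta> vs / fact (length vs))"
    unfolding cov_inner_def
    by (rule sum.mono_neutral_right[OF finite_cov_inner_index])
       (use assms covectors_vanish[OF assms(1)] in auto)
  then show ?thesis by simp
qed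

lemma cov_inner_sym: "cov_inner M f x \<alpha> \<beta> = cov_inner M f x \<beta> \<alpha>"
  unfolding cov_inner_def by (simp add: mult.commute)

lemma cov_inner_lin:
  "cov_inner M f x (\<lambda>vs. a * \<alpha> vs + b * \<alpha>' vs) \<beta> = a * cov_inner M f x \<alpha> \<beta> + b * cov_inner M f x \<alpha>' \<beta>"
  by (simp add: cov_inner_def sum_distrib_left algebra_simps sum.distrib add_divide_distrib)

lemma cov_inner_scale: "cov_inner M f x (\<lambda>vs. a * \<alpha> vs) \<beta> = a * cov_inner M f x \<alpha> \<beta>"
  using cov_inner_lin[of M f x a \<alpha> 0 \<alpha> \<beta>] by simp

lemma cov_inner_0:
  assumes "\<alpha> \<in> covectors V 0"
  shows "cov_inner M f x \<alpha> \<beta> = \<alpha> [] * \<beta> []"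
proof -
  have "{vs. set vs \<subseteq> set (onb M f x) \<and> length vs = 0} = {[]}" by auto
  then show ?thesis using cov_inner_degree[of \<alpha> V 0 M f x \<beta>] assms by simp
qed

lemma cov_inner_1_1:
  assumes "\<alpha> \<in> covectors V 1" "onb M f x = [u]"
  shows "cov_inner M f x \<alpha> \<beta> = \<alpha> [u] * \<beta> [u]"
proof -
  have "{vs. set vs \<subseteq> set (onb M f x) \<and> length vs = 1} = {[u]}"
    using assms by (auto simp: length_Suc_conv)
  then show ?thesis using cov_inner_degree[of \<alpha> V 1 M f x \<beta>] assms by simp
qed

lemma cov_inner_2_1:
  assumes "\<alpha> \<in> covectors V 1" "onb M f x = [u, v]" "u \<noteq> v"
  shows "cov_inner M f x \<alpha> \<beta> = \<alpha> [u] * \<beta> [u] + \<alpha> [v] * \<beta> [v]"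
proof -
  have "{vs. set vs \<subseteq> set (onb M f x) \<and> length vs = 1} = {[u], [v]}"
    using assms by (auto simp: length_Suc_conv)
  then show ?thesis using cov_inner_degree[of \<alpha> V 1 M f x \<beta>] assms by simp
qed

text \<open>The two ordered pairs contribute equally, and the factor 1/2! removes the
  duplication.\<close>

lemma cov_inner_2_2:
  assumes \<alpha>: "\<alpha> \<in> covectors UNIV 2" and \<beta>: "\<beta> \<in> covectors UNIV 2"
    and es: "onb M f x = [u, v]" "u \<noteq> v"
  shows "cov_inner M f x \<alpha> \<beta> = \<alpha> [u, v] * \<beta> [u, v]"
proof -
  have "{vs. set vs \<subseteq> set (onb M f x) \<and> length vs = 2} = {[u, u], [u, v], [v, u], [v, v]}"
    using es by (auto simp: length_Suc_conv numeral_2_eq_2)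
  moreover have "\<alpha> [u, u] = 0" "\<alpha> [v, v] = 0"
    using covectors_2D(3)[OF \<alpha>] by blast+
  moreover have "\<alpha> [v, u] = - \<alpha> [u, v]" "\<beta> [v, u] = - \<beta> [u, v]"
    using covectors_2_antisym[OF \<alpha>, of u v] covectors_2_antisym[OF \<beta>, of u v] by simp_all
  ultimately show ?thesis using cov_inner_degree[of \<alpha> UNIV 2 M f x \<beta>] \<alpha> es by simp
qed

section \<open>The Hodge star on a single tangent space\<close>

locale cell_point =
  fixes M :: "('a::t2_space, 'z) mesh_surface_scheme" and f :: "'a set" and x :: 'a
  assumes x: "x \<in> f" and metric: "inner_product_on_plane (riem M x)"
    and sub: "subspace (tangent M f x)" and dim: "dim (tangent M f x) = cdim M f"
    and cdim: "cdim M f = 1 \<or> cdim M f = 2"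
    and vol: "vol M f x \<in> covectors (tangent M f x) (int (cdim M f))"
    and vol_unit: "cov_inner M f x (vol M f x) (vol M f x) = 1"
begin

abbreviation "T \<equiv> tangent M f x"
abbreviation "d \<equiv> cdim M f"
abbreviation "v \<equiv> vol M f x"

lemma basis_1:
  assumes "d = 1"
  obtains u where "onb M f x = [u]" "T = span {u}" "riem M x u u = 1" "v [u] * v [u] = 1"
proof -
  obtain u where u: "onb M f x = [u]" "T = span {u}" "riem M x u u = 1"
    using onb_1[OF metric sub] dim assms by auto
  then have "v [u] * v [u] = 1"
    using vol_unit cov_inner_1_1[of v T M f x u v] vol assms by simp
  with u that show ?thesis by blast
qed

text \<open>The basis chosen by \<open>onb\<close> may have either orientation, so v [u, w] is 1 or
  -1; this sign is carried through the formulas below.\<close>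

lemma basis_2:
  assumes "d = 2"
  obtains u w where "onb M f x = [u, w]" "u \<noteq> w" "T = UNIV" "\<And>z. \<exists>p q. z = p *\<^sub>R u + q *\<^sub>R w"
    "v [u, w] * v [u, w] = 1" "v [w, u] = - v [u, w]" "v [u, u] = 0" "v [w, w] = 0"
proof -
  obtain u w where u: "onb M f x = [u, w]" "u \<noteq> w" "T = UNIV" "\<And>z. \<exists>p q. z = p *\<^sub>R u + q *\<^sub>R w"
    using onb_2[OF metric sub] dim assms by metis
  have vc: "v \<in> covectors UNIV 2" using vol assms u(3) by simp
  have "v [u, w] * v [u, w] = 1"
    using vol_unit cov_inner_2_2[OF vc vc u(1,2)] by simp
  moreover have "v [w, u] = - v [u, w]" using covectors_2_antisym[OF vc, of u w] by simp
  moreover have "v [u, u] = 0" "v [w, w] = 0" using covectors_2D(3)[OF vc] by blast+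
  ultimately show ?thesis using u that by blast
qed

lemma covectors_1_eqI:
  assumes "\<alpha> \<in> covectors V 1" "\<beta> \<in> covectors V 1" "\<And>u. u \<in> V \<Longrightarrow> \<alpha> [u] = \<beta> [u]"
  shows "\<alpha> = \<beta>"
proof
  fix vs
  show "\<alpha> vs = \<beta> vs"
  proof (cases "int (length vs) = 1 \<and> set vs \<subseteq> V")
    case True
    then obtain u where "vs = [u]" "u \<in> V" by (auto simp: length_Suc_conv)
    then show ?thesis using assms(3) by simp
  next
    case False
    then show ?thesis using covectors_vanish[OF assms(1) False] covectors_vanish[OF assms(2) False] by simp
  qed
qed

text \<open>Top-degree covectors form a line, and v is a unit vector on it.\<close>

lemma top_degree:
  assumes "\<alpha> \<in> covectors T (int d)"
  shows "\<alpha> = (\<lambda>vs. cov_inner M f x \<alpha> v * v vs)"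
proof -
  consider "d = 1" | "d = 2" using cdim by blast
  then show ?thesis
  proof cases
    case 1
    then obtain u where u: "onb M f x = [u]" "T = span {u}" "v [u] * v [u] = 1"
      using basis_1 by metis
    have a1: "\<alpha> \<in> covectors T 1" and v1: "v \<in> covectors T 1" using assms vol 1 by simp_all
    have b1: "(\<lambda>vs. cov_inner M f x \<alpha> v * v vs) \<in> covectors T 1"
      using covectors_lin[OF v1 v1, of "cov_inner M f x \<alpha> v" 0] by simp
    have uT: "u \<in> T" using u(2) by (simp add: span_base)
    show ?thesis
    proof (rule covectors_1_eqI[OF a1 b1])
      fix z assume "z \<in> T"
      then obtain c where c: "z = c *\<^sub>R u" using u(2) by (auto simp: span_singleton)
      have "\<alpha> [z] = c * \<alpha> [u]" "v [z] = c * v [u]"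
        using covectors_1D[OF a1 uT uT, of c 0] covectors_1D[OF v1 uT uT, of c 0] c by simp_all
      then show "\<alpha> [z] = cov_inner M f x \<alpha> v * v [z]"
        using cov_inner_1_1[OF a1 u(1), of v] u(3) by (simp add: algebra_simps)
    qed
  next
    case 2
    then obtain u w where u: "onb M f x = [u, w]" "u \<noteq> w" "T = UNIV" "\<And>z. \<exists>p q. z = p *\<^sub>R u + q *\<^sub>R w"
      "v [u, w] * v [u, w] = 1" using basis_2 by metis
    have a2: "\<alpha> \<in> covectors UNIV 2" and v2: "v \<in> covectors UNIV 2" using assms vol 2 u(3) by simp_all
    have ci: "cov_inner M f x \<alpha> v = \<alpha> [u, w] * v [u, w]" by (rule cov_inner_2_2[OF a2 v2 u(1,2)])
    show ?thesis
    proof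
      fix vs
      show "\<alpha> vs = cov_inner M f x \<alpha> v * v vs"
      proof (cases "length vs = 2")
        case True
        then obtain a b where vs: "vs = [a, b]" by (auto simp: length_Suc_conv numeral_2_eq_2)
        obtain p q r s where "a = p *\<^sub>R u + q *\<^sub>R w" "b = r *\<^sub>R u + s *\<^sub>R w" using u(4) by metis
        then have "\<alpha> vs = (p * s - q * r) * \<alpha> [u, w]" "v vs = (p * s - q * r) * v [u, w]"
          using covectors_2_expand[OF a2, of u w] covectors_2_expand[OF v2, of u w] vs by simp_all
        moreover have "(p * s - q * r) * \<alpha> [u, w] = (p * s - q * r) * \<alpha> [u, w] * (v [u, w] * v [u, w])"
          using u(5) by simp
        ultimately show ?thesis using ci by (simp only: mult_ac)
      next
        case False
        then show ?thesis using covectors_vanish[OF a2, of vs] covectors_vanish[OF v2, of vs] by simp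
      qed
    qed
  qed
qed

text \<open>The property inside the \<open>THE\<close> of \<open>hodge\<close>, made a relation so
  that linearity, uniqueness, existence, surjectivity and injectivity can be proved before the star
  is known to denote.\<close>

definition star_rel :: "nat \<Rightarrow> covector \<Rightarrow> covector \<Rightarrow> bool" where
  "star_rel k \<alpha> \<beta> \<longleftrightarrow> \<beta> \<in> covectors T (int d - int k) \<and>
     (\<forall>\<mu>\<in>covectors T (int d - int k). (\<lambda>vs. cov_inner M f x \<beta> \<mu> * v vs) = cov_wedge \<alpha> \<mu>)"

lemma vol_nonzero: "\<exists>vs. v vs \<noteq> 0"
proof (rule ccontr)
  assume "\<nexists>vs. v vs \<noteq> 0"
  then have "v = 0" by (simp add: fun_eq_iff)
  then show False using vol_unit by (simp add: cov_inner_def)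
qed

text \<open>The degree d - k is 0 or 1, so the norm is a sum of at most two squares that determine
  \<alpha>.\<close>

lemma cov_inner_definite:
  assumes "\<alpha> \<in> covectors T (int d - int k)" "1 \<le> k" "k \<le> d" "cov_inner M f x \<alpha> \<alpha> = 0"
  shows "\<alpha> = 0"
proof -
  consider "d = k" | "d = 2" "k = 1" using cdim assms by linarith
  then show ?thesis
  proof cases
    case 1
    then have "\<alpha> \<in> covectors T 0" using assms by simp
    then show ?thesis using cov_inner_0[of \<alpha> T M f x \<alpha>] assms(4) covectors_0D[of \<alpha> T]
      by (auto simp: const_cov_def fun_eq_iff)
  next
    case 2
    then obtain u w where u: "onb M f x = [u, w]" "u \<noteq> w" "T = UNIV" "\<And>z. \<exists>p q. z = p *\<^sub>R u + q *\<^sub>R w"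
      using basis_2 by metis
    have a: "\<alpha> \<in> covectors UNIV 1" using assms 2 u by simp
    have "\<alpha> [u] * \<alpha> [u] + \<alpha> [w] * \<alpha> [w] = 0"
      using cov_inner_2_1[OF a u(1,2), of \<alpha>] assms(4) by simp
    then have z: "\<alpha> [u] = 0" "\<alpha> [w] = 0" by (simp_all add: sum_squares_eq_zero_iff)
    show ?thesis
    proof (rule covectors_1_eqI[OF a covectors_zero])
      fix y
      obtain p q where "y = p *\<^sub>R u + q *\<^sub>R w" using u(4) by blast
      then show "\<alpha> [y] = 0 [y]" using covectors_1D[OF a, of u w p q] z by simp
    qed
  qed
qed

lemma cov_inner_nonneg:
  "cov_inner M f x \<alpha> \<alpha> \<ge> 0"
  unfolding cov_inner_def by (intro sum_nonneg divide_nonneg_pos) auto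

lemma star_rel_lin:
  assumes "star_rel k \<alpha> \<beta>" "star_rel k \<alpha>' \<beta>'"
  shows "star_rel k (\<lambda>vs. a * \<alpha> vs + b * \<alpha>' vs) (\<lambda>vs. a * \<beta> vs + b * \<beta>' vs)"
proof -
  have "(\<lambda>vs. cov_inner M f x (\<lambda>vs. a * \<beta> vs + b * \<beta>' vs) \<mu> * v vs) =
      cov_wedge (\<lambda>vs. a * \<alpha> vs + b * \<alpha>' vs) \<mu>" if "\<mu> \<in> covectors T (int d - int k)" for \<mu>
  proof
    fix vs
    have "cov_wedge \<alpha> \<mu> vs = cov_inner M f x \<beta> \<mu> * v vs" "cov_wedge \<alpha>' \<mu> vs = cov_inner M f x \<beta>' \<mu> * v vs"
      using assms that unfolding star_rel_def by metis+
    then show "cov_inner M f x (\<lambda>vs. a * \<beta> vs + b * \<beta>' vs) \<mu> * v vs =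
        cov_wedge (\<lambda>vs. a * \<alpha> vs + b * \<alpha>' vs) \<mu> vs"
      by (simp add: cov_inner_lin cov_wedge_lin algebra_simps)
  qed
  then show ?thesis using assms covectors_lin unfolding star_rel_def by blast
qed

text \<open>The difference of two solutions is a star of 0; testing it against itself, at a list
  where v does not vanish, gives norm 0.\<close>

lemma star_rel_unique:
  assumes "star_rel k \<alpha> \<beta>" "star_rel k \<alpha> \<beta>'" "1 \<le> k" "k \<le> d"
  shows "\<beta> = \<beta>'"
proof -
  define \<delta> where "\<delta> = (\<lambda>vs. 1 * \<beta> vs + (-1) * \<beta>' vs)"
  have "star_rel k (\<lambda>vs. 1 * \<alpha> vs + (-1) * \<alpha> vs) \<delta>"
    unfolding \<delta>_def by (rule star_rel_lin[OF assms(1,2)])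
  then have \<delta>: "\<delta> \<in> covectors T (int d - int k)"
      "(\<lambda>vs. cov_inner M f x \<delta> \<delta> * v vs) = cov_wedge (\<lambda>vs. 0) \<delta>"
    unfolding star_rel_def by simp_all
  obtain vs where "v vs \<noteq> 0" using vol_nonzero by blast
  moreover have "cov_inner M f x \<delta> \<delta> * v vs = 0"
    using fun_cong[OF \<delta>(2), of vs] by (simp add: cov_wedge_def)
  ultimately have "cov_inner M f x \<delta> \<delta> = 0" by simp
  then have "\<delta> = 0" using cov_inner_definite[OF \<delta>(1) assms(3,4)] by blast
  then show ?thesis unfolding \<delta>_def by (simp add: fun_eq_iff)
qed

text \<open>Only the split with empty second part survives, and in degree 2 its two permutations
  contribute equally.\<close>

lemma cov_wedge_top:
  assumes "\<alpha> \<in> covectors T (int d)"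
  shows "cov_wedge \<alpha> (const_cov m) vs = m * \<alpha> vs"
proof (cases "int (length vs) = int d \<and> set vs \<subseteq> T")
  case False
  then show ?thesis
    using cov_wedge_vanish[OF assms const_cov_in, of vs m] covectors_vanish[OF assms False] by simp
next
  case True
  then consider u where "d = 1" "vs = [u]" | u w where "d = 2" "vs = [u, w]"
    using cdim by (auto simp: length_Suc_conv numeral_2_eq_2)
  then show ?thesis
  proof cases
    case 1
    then show ?thesis using covectors_vanish[OF assms, of "[]"] by (simp add: cov_wedge_1 const_cov_def)
  next
    case 2
    have "\<alpha> [w, u] = - \<alpha> [u, w]"
      using covectors_2_antisym[of \<alpha> T u w] assms 2 True sub by simp
    then show ?thesis using 2 covectors_vanish[OF assms, of "[]"]
      by (simp add: cov_wedge_2 const_cov_def)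
  qed
qed

lemma star_rel_top:
  assumes "\<alpha> \<in> covectors T (int d)"
  shows "star_rel d \<alpha> (const_cov (cov_inner M f x \<alpha> v))"
proof -
  have "(\<lambda>vs. cov_inner M f x (const_cov (cov_inner M f x \<alpha> v)) \<mu> * v vs) = cov_wedge \<alpha> \<mu>"
    if "\<mu> \<in> covectors T 0" for \<mu>
  proof
    fix vs
    have "cov_wedge \<alpha> \<mu> vs = \<mu> [] * \<alpha> vs"
      using cov_wedge_top[OF assms, of "\<mu> []" vs] covectors_0D[OF that] by simp
    also have "\<dots> = \<mu> [] * (cov_inner M f x \<alpha> v * v vs)"
      using fun_cong[OF top_degree[OF assms], of vs] by simp
    also have "\<dots> = cov_inner M f x (const_cov (cov_inner M f x \<alpha> v)) \<mu> * v vs"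
      using cov_inner_0[OF const_cov_in, of M f x "cov_inner M f x \<alpha> v" \<mu>] by (simp add: const_cov_def)
    finally show "cov_inner M f x (const_cov (cov_inner M f x \<alpha> v)) \<mu> * v vs = cov_wedge \<alpha> \<mu> vs" ..
  qed
  then show ?thesis unfolding star_rel_def by simp
qed

text \<open>The star is a quarter turn in the orthonormal basis; the factor v [u, w] reverses its
  direction when the basis is negatively oriented.\<close>

lemma star_rel_middle:
  assumes d: "d = 2" and onb: "onb M f x = [u, w]" "u \<noteq> w"
    and \<alpha>: "\<alpha> \<in> covectors UNIV 1" and \<beta>: "\<beta> \<in> covectors UNIV 1"
    and eq: "\<beta> [u] = - v [u, w] * \<alpha> [w]" "\<beta> [w] = v [u, w] * \<alpha> [u]"
  shows "star_rel 1 \<alpha> \<beta>"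
proof -
  have u: "T = UNIV" "\<And>z. \<exists>p q. z = p *\<^sub>R u + q *\<^sub>R w" "v [u, w] * v [u, w] = 1"
    using basis_2[OF d] onb by (metis list.inject)+
  have vc: "v \<in> covectors UNIV 2" using vol d u(1) by simp
  have "(\<lambda>vs. cov_inner M f x \<beta> \<mu> * v vs) = cov_wedge \<alpha> \<mu>" if \<mu>: "\<mu> \<in> covectors UNIV 1" for \<mu>
  proof
    fix vs
    show "cov_inner M f x \<beta> \<mu> * v vs = cov_wedge \<alpha> \<mu> vs"
    proof (cases "length vs = 2")
      case False
      then show ?thesis using cov_wedge_vanish[OF \<alpha> \<mu>, of vs] covectors_vanish[OF vc, of vs] by simp
    next
      case True
      then obtain a b where vs: "vs = [a, b]" by (auto simp: length_Suc_conv numeral_2_eq_2)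
      obtain p q r s where ab: "a = p *\<^sub>R u + q *\<^sub>R w" "b = r *\<^sub>R u + s *\<^sub>R w" using u(2) by metis
      have lin: "\<alpha> [a] = p * \<alpha> [u] + q * \<alpha> [w]" "\<alpha> [b] = r * \<alpha> [u] + s * \<alpha> [w]"
        "\<mu> [a] = p * \<mu> [u] + q * \<mu> [w]" "\<mu> [b] = r * \<mu> [u] + s * \<mu> [w]"
        unfolding ab using covectors_1D[OF \<alpha>, of u w] covectors_1D[OF \<mu>, of u w] by simp_all
      have "\<alpha> [] = 0" "\<mu> [] = 0"
        using covectors_vanish[OF \<alpha>, of "[]"] covectors_vanish[OF \<mu>, of "[]"] by simp_all
      then have "cov_wedge \<alpha> \<mu> vs = \<alpha> [a] * \<mu> [b] - \<alpha> [b] * \<mu> [a]"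
        by (simp add: vs cov_wedge_2)
      also have "\<dots> = (p * s - q * r) * (\<alpha> [u] * \<mu> [w] - \<alpha> [w] * \<mu> [u])"
        unfolding lin by (simp add: algebra_simps)
      \<comment> \<open>Inserts the square of the orientation sign: one factor goes to \<beta>, the
        other to the volume covector.\<close>
      also have "\<dots> = (v [u, w] * v [u, w]) * ((p * s - q * r) * (\<alpha> [u] * \<mu> [w] - \<alpha> [w] * \<mu> [u]))"
        using u(3) by simp
      also have "\<dots> = (\<beta> [u] * \<mu> [u] + \<beta> [w] * \<mu> [w]) * ((p * s - q * r) * v [u, w])"
        unfolding eq by (simp add: algebra_simps)
      also have "\<dots> = cov_inner M f x \<beta> \<mu> * v vs"
        using covectors_2_expand[OF vc, of u w p q r s] cov_inner_2_1[OF \<beta> onb, of \<mu>] vs ab by simp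
      finally show ?thesis ..
    qed
  qed
  then show ?thesis using \<beta> d u(1) unfolding star_rel_def by simp
qed

lemma star_rel_exists:
  assumes "\<alpha> \<in> covectors T (int k)" "1 \<le> k" "k \<le> d"
  shows "\<exists>\<beta>. star_rel k \<alpha> \<beta>"
proof -
  consider "d = k" | "d = 2" "k = 1" using cdim assms by linarith
  then show ?thesis
  proof cases
    case 1
    then show ?thesis using star_rel_top[of \<alpha>] assms by auto
  next
    case 2
    then obtain u w where u: "onb M f x = [u, w]" "u \<noteq> w" "T = UNIV"
      "v [u, w] * v [u, w] = 1" "v [w, u] = - v [u, w]" "v [u, u] = 0" "v [w, w] = 0" using basis_2 by metis
    have vc: "v \<in> covectors UNIV 2" using vol 2 u(3) by simp
    \<comment> \<open>Contraction of the volume covector with \<alpha> [u] u + \<alpha> [w] w, the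
      vector dual to \<alpha> under the metric.\<close>
    define \<beta> where "\<beta> vs = (if length vs = 1 then \<alpha> [u] * v [u, hd vs] + \<alpha> [w] * v [w, hd vs] else 0)" for vs
    have "\<beta> \<in> covectors UNIV 1"
      by (rule covectors_1I) (auto simp: \<beta>_def covectors_2D(2)[OF vc] algebra_simps)
    moreover have "\<alpha> \<in> covectors UNIV 1" using assms 2 u by simp
    ultimately show ?thesis using star_rel_middle[OF 2(1) u(1,2), of \<alpha> \<beta>] 2 u by (auto simp: \<beta>_def)
  qed
qed

text \<open>Inverts the quarter turn. The formula for \<alpha> is recorded because it is free of a
  basis: applied to extensions of \<beta> and of the volume form, it produces an extension of
  \<alpha>.\<close>

lemma star_rel_middle_surj:
  assumes "\<beta> \<in> covectors UNIV 1" "d = 2"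
  shows "\<exists>\<alpha>\<in>covectors UNIV 1. star_rel 1 \<alpha> \<beta> \<and> (\<forall>z. \<alpha> [z] = cov_inner M f x \<beta> (\<lambda>vs. v (z # vs)))"
proof -
  obtain u w where u: "onb M f x = [u, w]" "u \<noteq> w" "T = UNIV"
    "v [u, w] * v [u, w] = 1" "v [w, u] = - v [u, w]" "v [u, u] = 0" "v [w, w] = 0"
    using basis_2[OF assms(2)] by metis
  have vc: "v \<in> covectors UNIV 2" using vol assms u(3) by simp
  define \<alpha> where "\<alpha> vs = (if length vs = 1 then cov_inner M f x \<beta> (\<lambda>us. v (hd vs # us)) else 0)" for vs
  have ci: "cov_inner M f x \<beta> \<mu> = \<beta> [u] * \<mu> [u] + \<beta> [w] * \<mu> [w]" for \<mu>
    by (rule cov_inner_2_1[OF assms(1) u(1,2)])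
  have "\<alpha> \<in> covectors UNIV 1"
    by (rule covectors_1I) (auto simp: \<alpha>_def ci covectors_2D(1)[OF vc] algebra_simps)
  moreover have "star_rel 1 \<alpha> \<beta>"
  proof (rule star_rel_middle[OF assms(2) u(1,2) \<open>\<alpha> \<in> covectors UNIV 1\<close> assms(1)])
    have "\<alpha> [w] = - v [u, w] * \<beta> [u]" "\<alpha> [u] = v [u, w] * \<beta> [w]"
      using u by (simp_all add: \<alpha>_def ci)
    then show "\<beta> [u] = - v [u, w] * \<alpha> [w]" "\<beta> [w] = v [u, w] * \<alpha> [u]"
      using u(4) by (simp_all flip: mult.assoc)
  qed
  ultimately show ?thesis by (auto simp: \<alpha>_def)
qed

lemma star_rel_surj:
  assumes "\<beta> \<in> covectors T (int d - int k)" "1 \<le> k" "k \<le> d"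
  shows "\<exists>\<alpha>\<in>covectors T (int k). star_rel k \<alpha> \<beta>"
proof -
  consider "d = k" | "d = 2" "k = 1" using cdim assms by linarith
  then show ?thesis
  proof cases
    case 1
    define \<alpha> where "\<alpha> vs = \<beta> [] * v vs" for vs
    have \<alpha>: "\<alpha> \<in> covectors T (int d)"
      using covectors_lin[OF vol vol, of "\<beta> []" 0] by (simp add: \<alpha>_def[abs_def])
    have "cov_inner M f x \<alpha> v = \<beta> []" using vol_unit by (simp add: \<alpha>_def[abs_def] cov_inner_scale)
    moreover have "\<beta> \<in> covectors T 0" using assms 1 by simp
    then have "\<beta> = const_cov (\<beta> [])" by (rule covectors_0D)
    ultimately show ?thesis using star_rel_top[OF \<alpha>] \<alpha> 1 by (metis)
  next
    case 2
    then have "T = UNIV" using basis_2 by metis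
    then show ?thesis using star_rel_middle_surj[of \<beta>] assms 2 by auto
  qed
qed

text \<open>The relation fixes all wedge products of \<alpha>, and these determine \<alpha>: in top
  degree wedge with the constant 1, in the middle degree with contractions of the volume
  covector.\<close>

lemma star_rel_inj:
  assumes "\<alpha> \<in> covectors T (int k)" "\<alpha>' \<in> covectors T (int k)" "star_rel k \<alpha> \<beta>" "star_rel k \<alpha>' \<beta>"
    "1 \<le> k" "k \<le> d"
  shows "\<alpha> = \<alpha>'"
proof -
  have W: "cov_wedge \<alpha> \<mu> = cov_wedge \<alpha>' \<mu>" if "\<mu> \<in> covectors T (int d - int k)" for \<mu>
    using assms(3,4) that unfolding star_rel_def by metis
  consider "d = k" | "d = 2" "k = 1" using cdim assms by linarith
  then show ?thesis
  proof cases
    case 1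
    then have "cov_wedge \<alpha> (const_cov 1) = cov_wedge \<alpha>' (const_cov 1)" using W by simp
    then show ?thesis using cov_wedge_top[of \<alpha> 1] cov_wedge_top[of \<alpha>' 1] assms(1,2) 1
      by (simp add: fun_eq_iff)
  next
    case 2
    then obtain u w where u: "T = UNIV" "\<And>z. \<exists>p q. z = p *\<^sub>R u + q *\<^sub>R w" "v [u, w] * v [u, w] = 1"
      "v [w, u] = - v [u, w]" "v [u, u] = 0" "v [w, w] = 0" using basis_2 by metis
    have vc: "v \<in> covectors UNIV 2" using vol 2 u(1) by simp
    have a: "\<alpha> \<in> covectors UNIV 1" "\<alpha>' \<in> covectors UNIV 1" using assms 2 u by simp_all
    have eq: "\<alpha> [z] = \<alpha>' [z]" if z: "z \<in> {u, w}" for z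
    proof -
      \<comment> \<open>At [u, w] the product with this contraction is \<alpha> [z] times the
        nonzero number v [u, w].\<close>
      define \<mu> where "\<mu> vs = (if length vs = 1 then v [z, hd vs] else 0)" for vs
      have "\<mu> \<in> covectors UNIV 1"
        by (rule covectors_1I) (auto simp: \<mu>_def covectors_2D(2)[OF vc])
      then have "cov_wedge \<alpha> \<mu> [u, w] = cov_wedge \<alpha>' \<mu> [u, w]" using W 2 u by simp
      moreover have "\<alpha> [] = 0" "\<alpha>' [] = 0"
        using covectors_vanish[OF a(1), of "[]"] covectors_vanish[OF a(2), of "[]"] by simp_all
      moreover have "v [u, w] \<noteq> 0" using u(3) by auto
      ultimately show ?thesis using z u(4-6) by (auto simp: cov_wedge_2 \<mu>_def)
    qed
    show ?thesis
    proof (rule covectors_1_eqI[OF a])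
      fix y
      obtain p q where y: "y = p *\<^sub>R u + q *\<^sub>R w" using u(2) by blast
      then show "\<alpha> [y] = \<alpha>' [y]"
        using covectors_1D[OF a(1), of u w p q] covectors_1D[OF a(2), of u w p q] eq by simp
    qed
  qed
qed

lemma hodge_star_rel:
  assumes "\<omega> x \<in> covectors T (int k)" "1 \<le> k" "k \<le> d"
  shows "star_rel k (\<omega> x) (hodge M f k \<omega> x)"
proof -
  obtain \<beta> where \<beta>: "star_rel k (\<omega> x) \<beta>" using star_rel_exists assms by blast
  have "hodge M f k \<omega> x = (THE \<beta>. star_rel k (\<omega> x) \<beta>)"
    using x by (simp add: hodge_def star_rel_def)
  also have "\<dots> = \<beta>"
    using \<beta> star_rel_unique assms(2,3) by blast
  finally show ?thesis using \<beta> by simp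
qed

end

section \<open>The Hodge star on a cell\<close>

lemma form_lin_apply [simp]: "(a *\<^sub>F \<omega> + b *\<^sub>F \<omega>') x vs = a * \<omega> x vs + b * \<omega>' x vs"
  by (simp add: form_scale_def)

lemma form_lin_at: "(a *\<^sub>F \<omega> + b *\<^sub>F \<omega>') x = (\<lambda>vs. a * \<omega> x vs + b * \<omega>' x vs)"
  by (simp add: form_scale_def fun_eq_iff)

lemma forms_lin:
  assumes "\<omega> \<in> forms M f l" "\<omega>' \<in> forms M f l"
  shows "a *\<^sub>F \<omega> + b *\<^sub>F \<omega>' \<in> forms M f l"
  using assms unfolding forms_def form_lin_at
  by (auto intro!: covectors_lin simp: fun_eq_iff)

locale cell =
  fixes M :: "('a::t2_space, 'z) mesh_surface_scheme" and f :: "'a set"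
  assumes pt: "x \<in> f \<Longrightarrow> cell_point M f x"
begin

abbreviation "dd \<equiv> cdim M f"

lemma forms_at: "\<omega> \<in> forms M f l \<Longrightarrow> x \<in> f \<Longrightarrow> \<omega> x \<in> covectors (tangent M f x) l"
  by (simp add: forms_def)

lemma forms_eqI:
  assumes "\<omega> \<in> forms M f l" "\<omega>' \<in> forms M f l'" "\<And>x. x \<in> f \<Longrightarrow> \<omega> x = \<omega>' x"
  shows "\<omega> = \<omega>'"
proof
  fix x show "\<omega> x = \<omega>' x" using assms by (cases "x \<in> f") (simp_all add: forms_def)
qed

lemma hodge_rel:
  assumes "\<omega> \<in> forms M f (int k)" "x \<in> f" "1 \<le> k" "k \<le> dd"
  shows "cell_point.star_rel M f x k (\<omega> x) (hodge M f k \<omega> x)"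
  using cell_point.hodge_star_rel[of M f x \<omega> k] pt[OF assms(2)] forms_at[OF assms(1,2)] assms(3,4) by blast

lemma hodge_forms:
  assumes "\<omega> \<in> forms M f (int k)" "1 \<le> k" "k \<le> dd"
  shows "hodge M f k \<omega> \<in> forms M f (int dd - int k)"
  using hodge_rel[OF assms(1) _ assms(2,3)] cell_point.star_rel_def[OF pt]
  by (auto simp: forms_def hodge_def)

lemma hodge_lin:
  assumes "\<omega> \<in> forms M f (int k)" "\<omega>' \<in> forms M f (int k)" "1 \<le> k" "k \<le> dd"
  shows "hodge M f k (a *\<^sub>F \<omega> + b *\<^sub>F \<omega>') = a *\<^sub>F hodge M f k \<omega> + b *\<^sub>F hodge M f k \<omega>'"
proof (rule forms_eqI)
  show "hodge M f k (a *\<^sub>F \<omega> + b *\<^sub>F \<omega>') \<in> forms M f (int dd - int k)"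
    by (intro hodge_forms forms_lin assms)
  show "a *\<^sub>F hodge M f k \<omega> + b *\<^sub>F hodge M f k \<omega>' \<in> forms M f (int dd - int k)"
    by (intro hodge_forms forms_lin assms)
  fix x assume x: "x \<in> f"
  interpret cell_point M f x using pt[OF x] .
  show "hodge M f k (a *\<^sub>F \<omega> + b *\<^sub>F \<omega>') x = (a *\<^sub>F hodge M f k \<omega> + b *\<^sub>F hodge M f k \<omega>') x"
    using star_rel_lin[OF hodge_rel[OF assms(1) x assms(3,4)] hodge_rel[OF assms(2) x assms(3,4)], of a b]
      hodge_rel[OF forms_lin[OF assms(1,2), of a b] x assms(3,4)] star_rel_unique assms(3,4)
    unfolding form_lin_at by blast
qed

lemma hodge_inj:
  assumes "\<omega> \<in> forms M f (int k)" "\<omega>' \<in> forms M f (int k)" "1 \<le> k" "k \<le> dd"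
    "hodge M f k \<omega> = hodge M f k \<omega>'"
  shows "\<omega> = \<omega>'"
proof (rule forms_eqI[OF assms(1,2)])
  fix x assume x: "x \<in> f"
  interpret cell_point M f x using pt[OF x] .
  show "\<omega> x = \<omega>' x"
    using star_rel_inj[OF forms_at[OF assms(1) x] forms_at[OF assms(2) x] _ _ assms(3,4)]
      hodge_rel[OF assms(1) x assms(3,4)] hodge_rel[OF assms(2) x assms(3,4)] assms(5) by metis
qed

text \<open>Chosen point by point, since \<open>forms\<close> demands no regularity.\<close>

lemma hodge_surj:
  assumes "\<mu> \<in> forms M f (int dd - int k)" "1 \<le> k" "k \<le> dd"
  shows "\<exists>\<omega>\<in>forms M f (int k). hodge M f k \<omega> = \<mu>"
proof -
  have "\<forall>x\<in>f. \<exists>\<alpha>. \<alpha> \<in> covectors (tangent M f x) (int k) \<and> cell_point.star_rel M f x k \<alpha> (\<mu> x)"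
    using cell_point.star_rel_surj[OF pt forms_at[OF assms(1)] assms(2,3)] by blast
  then obtain A where A: "\<And>x. x \<in> f \<Longrightarrow> A x \<in> covectors (tangent M f x) (int k)"
      "\<And>x. x \<in> f \<Longrightarrow> cell_point.star_rel M f x k (A x) (\<mu> x)"
    by metis
  define \<omega> where "\<omega> x = (if x \<in> f then A x else 0)" for x
  have \<omega>: "\<omega> \<in> forms M f (int k)" using A(1) by (auto simp: forms_def \<omega>_def)
  have "hodge M f k \<omega> = \<mu>"
  proof (rule forms_eqI[OF hodge_forms[OF \<omega> assms(2,3)] assms(1)])
    fix x assume x: "x \<in> f"
    interpret cell_point M f x using pt[OF x] .
    show "hodge M f k \<omega> x = \<mu> x"
      using star_rel_unique[OF hodge_rel[OF \<omega> x assms(2,3)] _ assms(2,3)] A(2)[OF x] x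
      by (simp add: \<omega>_def)
  qed
  with \<omega> show ?thesis by blast
qed

lemma hodge_inv_hodge:
  assumes "\<omega> \<in> forms M f (int k)" "1 \<le> k" "k \<le> dd"
  shows "hodge_inv M f k (hodge M f k \<omega>) = \<omega>"
  unfolding hodge_inv_def
  by (rule the_equality) (use assms hodge_inj in auto)

lemma wedge_density:
  assumes "\<omega> \<in> forms M f (int k)" "\<mu> \<in> forms M f (int dd - int k)" "1 \<le> k" "k \<le> dd" "x \<in> f"
  shows "cov_inner M f x (wedge \<omega> \<mu> x) (vol M f x) = cov_inner M f x (hodge M f k \<omega> x) (\<mu> x)"
proof -
  interpret cell_point M f x using pt[OF assms(5)] .
  have "wedge \<omega> \<mu> x = (\<lambda>vs. cov_inner M f x (hodge M f k \<omega> x) (\<mu> x) * v vs)"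
    using hodge_rel[OF assms(1,5,3,4)] forms_at[OF assms(2,5)] unfolding star_rel_def wedge_def by simp
  then show ?thesis using vol_unit by (simp add: cov_inner_scale)
qed

end

section \<open>Continuously differentiable functions\<close>

text \<open>Frees the definition from \<open>frechet_derivative\<close>: any family of derivatives
  with continuous directional values will do, which makes the product and quotient rules
  available.\<close>

lemma Ck_on_1_iff:
  assumes "open S"
  shows "Ck_on 1 f S \<longleftrightarrow>
    (\<exists>f'. (\<forall>y\<in>S. (f has_derivative f' y) (at y)) \<and> (\<forall>v. continuous_on S (\<lambda>y. f' y v)))"
proof
  assume *: "Ck_on 1 f S"
  then have "(f has_derivative frechet_derivative f (at y)) (at y)" if "y \<in> S" for y
    using that assms by (simp add: differentiable_on_eq_differentiable_at frechet_derivative_works)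
  then show "\<exists>f'. (\<forall>y\<in>S. (f has_derivative f' y) (at y)) \<and> (\<forall>v. continuous_on S (\<lambda>y. f' y v))"
    using * by (intro exI[of _ "\<lambda>y. frechet_derivative f (at y)"]) simp
next
  assume "\<exists>f'. (\<forall>y\<in>S. (f has_derivative f' y) (at y)) \<and> (\<forall>v. continuous_on S (\<lambda>y. f' y v))"
  then obtain f' where f': "\<And>y. y \<in> S \<Longrightarrow> (f has_derivative f' y) (at y)" "\<And>v. continuous_on S (\<lambda>y. f' y v)"
    by blast
  have "continuous_on S (\<lambda>y. frechet_derivative f (at y) v)" for v
    using f'(2)[of v] by (rule continuous_on_eq) (simp add: frechet_derivative_at[OF f'(1)])
  moreover have "f differentiable_on S"
    using f'(1) by (auto simp: differentiable_on_def differentiable_def intro: has_derivative_at_withinI)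
  ultimately show "Ck_on 1 f S" by simp
qed

lemma Ck_on_1_continuous: "Ck_on 1 f S \<Longrightarrow> continuous_on S f"
  by (simp add: differentiable_imp_continuous_on)

lemma Ck_on_1_const: "open S \<Longrightarrow> Ck_on 1 (\<lambda>y. c) S"
  by (subst Ck_on_1_iff) (auto intro!: exI[of _ "\<lambda>y v. 0"])

lemma Ck_on_1_mult:
  fixes f g :: "real^2 \<Rightarrow> real"
  assumes "open S" "Ck_on 1 f S" "Ck_on 1 g S"
  shows "Ck_on 1 (\<lambda>y. f y * g y) S"
proof -
  obtain f' g' where
    "\<forall>y\<in>S. (f has_derivative f' y) (at y)" "\<forall>v. continuous_on S (\<lambda>y. f' y v)"
    "\<forall>y\<in>S. (g has_derivative g' y) (at y)" "\<forall>v. continuous_on S (\<lambda>y. g' y v)"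
    using assms by (auto simp only: Ck_on_1_iff)
  then show ?thesis
    using assms Ck_on_1_continuous[of f S] Ck_on_1_continuous[of g S]
    unfolding Ck_on_1_iff[OF assms(1), of "\<lambda>y. f y * g y"]
    by (intro exI[of _ "\<lambda>y v. f y * g' y v + f' y v * g y"])
       (auto intro!: has_derivative_mult continuous_intros)
qed

lemma Ck_on_1_add:
  fixes f g :: "real^2 \<Rightarrow> real"
  assumes "open S" "Ck_on 1 f S" "Ck_on 1 g S"
  shows "Ck_on 1 (\<lambda>y. f y + g y) S"
proof -
  obtain f' g' where
    "\<forall>y\<in>S. (f has_derivative f' y) (at y)" "\<forall>v. continuous_on S (\<lambda>y. f' y v)"
    "\<forall>y\<in>S. (g has_derivative g' y) (at y)" "\<forall>v. continuous_on S (\<lambda>y. g' y v)"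
    using assms by (auto simp only: Ck_on_1_iff)
  then show ?thesis
    unfolding Ck_on_1_iff[OF assms(1), of "\<lambda>y. f y + g y"]
    by (intro exI[of _ "\<lambda>y v. f' y v + g' y v"])
       (auto intro!: has_derivative_add continuous_intros)
qed

lemma Ck_on_1_lin:
  fixes f g :: "real^2 \<Rightarrow> real"
  assumes "open S" "Ck_on 1 f S" "Ck_on 1 g S"
  shows "Ck_on 1 (\<lambda>y. a * f y + b * g y) S"
  by (intro Ck_on_1_add Ck_on_1_mult Ck_on_1_const assms)

lemma Ck_on_1_diff:
  fixes f g :: "real^2 \<Rightarrow> real"
  assumes "open S" "Ck_on 1 f S" "Ck_on 1 g S"
  shows "Ck_on 1 (\<lambda>y. f y - g y) S"
  using Ck_on_1_lin[OF assms, of 1 "-1"] by simp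

lemma Ck_on_1_divide:
  fixes f g :: "real^2 \<Rightarrow> real"
  assumes "open S" "Ck_on 1 f S" "Ck_on 1 g S" "\<And>y. y \<in> S \<Longrightarrow> g y \<noteq> 0"
  shows "Ck_on 1 (\<lambda>y. f y / g y) S"
proof -
  obtain f' g' where
    "\<forall>y\<in>S. (f has_derivative f' y) (at y)" "\<forall>v. continuous_on S (\<lambda>y. f' y v)"
    "\<forall>y\<in>S. (g has_derivative g' y) (at y)" "\<forall>v. continuous_on S (\<lambda>y. g' y v)"
    using assms by (auto simp only: Ck_on_1_iff)
  then show ?thesis
    using assms Ck_on_1_continuous[of f S] Ck_on_1_continuous[of g S]
    unfolding Ck_on_1_iff[OF assms(1), of "\<lambda>y. f y / g y"]
    by (intro exI[of _ "\<lambda>y v. (f' y v * g y - f y * g' y v) / (g y * g y)"])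
       (auto intro!: has_derivative_divide' continuous_intros)
qed

lemma Ck_on_1_cong:
  assumes "open S" "Ck_on 1 f S" "\<And>y. y \<in> S \<Longrightarrow> f y = g y"
  shows "Ck_on 1 g S"
proof -
  obtain f' where f': "\<forall>y\<in>S. (f has_derivative f' y) (at y)" "\<forall>v. continuous_on S (\<lambda>y. f' y v)"
    using assms by (auto simp only: Ck_on_1_iff)
  then have "\<forall>y\<in>S. (g has_derivative f' y) (at y)"
    using has_derivative_transform_within_open[OF _ assms(1)] assms(3) by blast
  with f'(2) show ?thesis using Ck_on_1_iff[OF assms(1)] by blast
qed

lemma smooth_on_Ck: "smooth_on f S \<Longrightarrow> Ck_on k f S"
  by (simp add: smooth_on_def)

lemma smooth_on_derivative:
  assumes "smooth_on f S" "open S" "y \<in> S"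
  shows "(f has_derivative frechet_derivative f (at y)) (at y)"
proof -
  have "f differentiable_on S" using smooth_on_Ck[OF assms(1), of 1] by simp
  then show ?thesis
    using assms by (simp add: differentiable_on_eq_differentiable_at frechet_derivative_works)
qed

lemma smooth_on_derivative_continuous:
  assumes "smooth_on f S"
  shows "continuous_on S (\<lambda>y. frechet_derivative f (at y) v)"
  using smooth_on_Ck[OF assms, of 1] by simp

section \<open>Charts\<close>

lemma is_chartD:
  assumes "is_chart X c"
  shows "fst c \<subseteq> X" "open (snd c ` fst c)" "continuous_on (fst c) (snd c)"
    "continuous_on (snd c ` fst c) (chart_inv c)"
    "x \<in> fst c \<Longrightarrow> chart_inv c (snd c x) = x"
    "y \<in> snd c ` fst c \<Longrightarrow> snd c (chart_inv c y) = y"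
    "y \<in> snd c ` fst c \<Longrightarrow> chart_inv c y \<in> fst c"
    "\<exists>U. open U \<and> fst c = X \<inter> U"
proof -
  have h: "homeomorphism (fst c) (snd c ` fst c) (snd c) (chart_inv c)"
    and o: "openin (top_of_set X) (fst c)" and i: "open (snd c ` fst c)"
    using assms by (simp_all add: is_chart_def)
  show "fst c \<subseteq> X" using o openin_imp_subset by blast
  show "open (snd c ` fst c)" by fact
  show "continuous_on (fst c) (snd c)" "continuous_on (snd c ` fst c) (chart_inv c)"
    "x \<in> fst c \<Longrightarrow> chart_inv c (snd c x) = x"
    "y \<in> snd c ` fst c \<Longrightarrow> snd c (chart_inv c y) = y"
    "y \<in> snd c ` fst c \<Longrightarrow> chart_inv c y \<in> fst c"
    using h by (auto simp: homeomorphism_def)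
  show "\<exists>U. open U \<and> fst c = X \<inter> U" using o by (auto simp: openin_open)
qed

lemma chart_image_Int:
  assumes "is_chart X c"
  shows "snd c ` (fst c \<inter> A) = {y \<in> snd c ` fst c. chart_inv c y \<in> A}"
  using is_chartD(5)[OF assms] by force

lemma chart_image_open:
  assumes "is_chart X c" "is_chart X c'"
  shows "open (snd c ` (fst c \<inter> fst c'))"
proof -
  obtain U where U: "open U" "fst c' = X \<inter> U" using is_chartD(8)[OF assms(2)] by blast
  have "snd c ` (fst c \<inter> fst c') = snd c ` fst c \<inter> chart_inv c -` U"
    unfolding chart_image_Int[OF assms(1)] U(2) using is_chartD(1,7)[OF assms(1)] by blast
  also have "open \<dots>"
    using is_chartD(2,4)[OF assms(1)] U(1) by (intro continuous_open_preimage)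
  finally show ?thesis .
qed

text \<open>Chart domains are relatively open in X, so continuity at x within the part of F in the
  chart is continuity within F. The chart may vary with the point, as slice charts of a cell
  do.\<close>

lemma continuous_on_charts:
  assumes "F \<subseteq> X"
    and "\<And>x. x \<in> F \<Longrightarrow> \<exists>c. is_chart X c \<and> x \<in> fst c \<and> continuous_on (snd c ` (fst c \<inter> F)) (\<lambda>y. u (chart_inv c y))"
  shows "continuous_on F u"
  unfolding continuous_on_eq_continuous_within
proof
  fix x assume x: "x \<in> F"
  then obtain c where c: "is_chart X c" "x \<in> fst c"
    "continuous_on (snd c ` (fst c \<inter> F)) (\<lambda>y. u (chart_inv c y))"
    using assms(2) by blast
  have "continuous_on (fst c \<inter> F) (\<lambda>z. u (chart_inv c (snd c z)))"
    by (rule continuous_on_compose2[OF c(3)])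
       (use is_chartD(3)[OF c(1)] in \<open>auto intro: continuous_on_subset\<close>)
  then have "continuous_on (fst c \<inter> F) u"
    by (rule continuous_on_eq) (simp add: is_chartD(5)[OF c(1)])
  then have "continuous (at x within (fst c \<inter> F)) u"
    using x c(2) by (simp add: continuous_on_eq_continuous_within)
  moreover obtain U where U: "open U" "fst c = X \<inter> U" using is_chartD(8)[OF c(1)] by blast
  have "at x within F = at x within (fst c \<inter> F)"
    by (rule at_within_nhd[of x U]) (use U c(2) assms(1) in auto)
  ultimately show "continuous (at x within F) u" by simp
qed

lemma transition_eq:
  assumes "is_chart X c" "x \<in> fst c"
  shows "transition c c' (snd c x) = snd c' x"
  using is_chartD(5)[OF assms] by (simp add: transition_def)

text \<open>Chain rule; the composite agrees with the direct transition on the image of the overlap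
  of the first two charts, an open set around the point.\<close>

lemma transition_chain:
  assumes c: "is_chart X c" "is_chart X c'" "is_chart X c''" "x \<in> fst c" "x \<in> fst c'" "x \<in> fst c''"
    and D: "(transition c c' has_derivative D) (at (snd c x))"
      "(transition c' c'' has_derivative D') (at (snd c' x))"
  shows "(transition c c'' has_derivative (\<lambda>w. D' (D w))) (at (snd c x))"
proof (rule has_derivative_transform_within_open)
  show "((\<lambda>y. transition c' c'' (transition c c' y)) has_derivative (\<lambda>w. D' (D w))) (at (snd c x))"
    using has_derivative_compose[OF D(1)] D(2) transition_eq[OF c(1,4), of c'] by simp
  show "open (snd c ` (fst c \<inter> fst c'))" by (rule chart_image_open[OF c(1,2)])
  show "snd c x \<in> snd c ` (fst c \<inter> fst c')" using c by blast
  fix y assume "y \<in> snd c ` (fst c \<inter> fst c')"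
  then obtain z where z: "z \<in> fst c" "z \<in> fst c'" "y = snd c z" by blast
  then show "transition c' c'' (transition c c' y) = transition c c'' y"
    using transition_eq[OF c(1) z(1)] transition_eq[OF c(2) z(2)] by simp
qed

lemma transition_self:
  assumes "is_chart X c" "x \<in> fst c"
  shows "(transition c c has_derivative (\<lambda>w. w)) (at (snd c x))"
  by (rule has_derivative_transform_within_open[OF has_derivative_ident, of "snd c ` fst c"])
     (use assms is_chartD(2,6)[OF assms(1)] in \<open>auto simp: transition_def\<close>)

locale rsurface =
  fixes M :: "('a::t2_space, 'z) surface_scheme"
  assumes crs: "compact_riemannian_surface M"
begin

lemma atlas_smooth: "c \<in> atlas M \<Longrightarrow> smooth_chart M c"
  using crs by (simp add: compact_riemannian_surface_def)

lemma smooth_is_chart: "smooth_chart M c \<Longrightarrow> is_chart (points M) c"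
  by (simp add: smooth_chart_def)

lemma chart_at_in:
  assumes "x \<in> points M"
  shows "chart_at M x \<in> atlas M" "x \<in> fst (chart_at M x)"
proof -
  have "\<exists>c. c \<in> atlas M \<and> x \<in> fst c" using crs assms unfolding compact_riemannian_surface_def by blast
  then have "chart_at M x \<in> atlas M \<and> x \<in> fst (chart_at M x)" unfolding chart_at_def by (rule someI_ex)
  then show "chart_at M x \<in> atlas M" "x \<in> fst (chart_at M x)" by auto
qed

lemma metric: "x \<in> points M \<Longrightarrow> inner_product_on_plane (riem M x)"
  using crs by (simp add: compact_riemannian_surface_def)

lemma smooth_chart_points: "smooth_chart M c \<Longrightarrow> x \<in> fst c \<Longrightarrow> x \<in> points M"
  using is_chartD(1)[OF smooth_is_chart] by blast

lemma transition_deriv: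
  assumes "smooth_chart M c" "c0 \<in> atlas M" "x \<in> fst c" "x \<in> fst c0"
  shows "(transition c c0 has_derivative frechet_derivative (transition c c0) (at (snd c x))) (at (snd c x))"
    and "(transition c0 c has_derivative frechet_derivative (transition c0 c) (at (snd c0 x))) (at (snd c0 x))"
proof -
  have sm: "smooth_on (transition c c0) (snd c ` (fst c \<inter> fst c0))"
    "smooth_on (transition c0 c) (snd c0 ` (fst c \<inter> fst c0))"
    using assms(1,2) by (auto simp: smooth_chart_def smooth_compatible_def)
  have op: "open (snd c ` (fst c \<inter> fst c0))" "open (snd c0 ` (fst c \<inter> fst c0))"
    using chart_image_open[of "points M" c c0] chart_image_open[of "points M" c0 c]
      smooth_is_chart[OF assms(1)] smooth_is_chart[OF atlas_smooth[OF assms(2)]]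
    by (simp_all add: Int_commute)
  show "(transition c c0 has_derivative frechet_derivative (transition c c0) (at (snd c x))) (at (snd c x))"
    "(transition c0 c has_derivative frechet_derivative (transition c0 c) (at (snd c0 x))) (at (snd c0 x))"
    using smooth_on_derivative[OF sm(1) op(1)] smooth_on_derivative[OF sm(2) op(2)] assms(3,4) by blast+
qed

lemma dchart_deriv:
  assumes "smooth_chart M c" "x \<in> fst c"
  shows "(transition c (chart_at M x) has_derivative dchart_inv M c x) (at (snd c x))"
    and "(transition (chart_at M x) c has_derivative dchart M c x) (at (snd (chart_at M x) x))"
  using transition_deriv[OF assms(1) chart_at_in(1) assms(2) chart_at_in(2)] smooth_chart_points[OF assms]
  by (simp_all add: dchart_def dchart_inv_def)

lemma dchart_linear:
  assumes "smooth_chart M c" "x \<in> fst c"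
  shows "linear (dchart M c x)" "linear (dchart_inv M c x)"
  using dchart_deriv[OF assms] has_derivative_linear by blast+

text \<open>Both composites are derivatives of the transition of a chart to itself, and derivatives
  are unique.\<close>

lemma dchart_inverse:
  assumes "smooth_chart M c" "x \<in> fst c"
  shows "dchart M c x (dchart_inv M c x w) = w" "dchart_inv M c x (dchart M c x w) = w"
proof -
  have x: "x \<in> points M" using smooth_chart_points[OF assms] .
  have a: "is_chart (points M) (chart_at M x)" "x \<in> fst (chart_at M x)"
    using chart_at_in[OF x] atlas_smooth smooth_is_chart by blast+
  have c: "is_chart (points M) c" using assms smooth_is_chart by blast
  note D = dchart_deriv[OF assms]
  have "(\<lambda>w. dchart M c x (dchart_inv M c x w)) = (\<lambda>w. w)"
    using transition_chain[OF c a(1) c assms(2) a(2) assms(2) D] transition_self[OF c assms(2)]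
      has_derivative_unique by blast
  then show "dchart M c x (dchart_inv M c x w) = w" by metis
  have "(\<lambda>w. dchart_inv M c x (dchart M c x w)) = (\<lambda>w. w)"
    using transition_chain[OF a(1) c a(1) a(2) assms(2) a(2) D(2,1)] transition_self[OF a]
      has_derivative_unique by blast
  then show "dchart_inv M c x (dchart M c x w) = w" by metis
qed

text \<open>\<open>C1_forms\<close> speaks of atlas charts, \<open>slice_chart\<close> of any chart
  compatible with them; this translates tangent vectors between the two.\<close>

lemma dchart_inv_change:
  assumes "smooth_chart M c" "x \<in> fst c" "c0 \<in> atlas M" "x \<in> fst c0"
  shows "dchart_inv M c x w = dchart_inv M c0 x (frechet_derivative (transition c c0) (at (snd c x)) w)"
proof -
  have x: "x \<in> points M" using smooth_chart_points[OF assms(1,2)] .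
  have a: "is_chart (points M) (chart_at M x)" "x \<in> fst (chart_at M x)"
    using chart_at_in[OF x] atlas_smooth smooth_is_chart by blast+
  have c: "is_chart (points M) c" "is_chart (points M) c0" using assms smooth_is_chart atlas_smooth by blast+
  have "dchart_inv M c x = (\<lambda>w. dchart_inv M c0 x (frechet_derivative (transition c c0) (at (snd c x)) w))"
    using transition_chain[OF c a(1) assms(2,4) a(2) transition_deriv(1)[OF assms(1,3,2,4)]
        dchart_deriv(1)[OF atlas_smooth[OF assms(3)] assms(4)]]
      dchart_deriv(1)[OF assms(1,2)] has_derivative_unique by blast
  then show ?thesis by metis
qed

section \<open>Tangent spaces\<close>

text \<open>The component z of the velocity w orthogonal to W pairs to 0 with the curve near 0, so z
  is orthogonal to w and hence to itself.\<close>

lemma subspace_has_vector_derivative: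
  fixes \<psi> :: "real \<Rightarrow> real^2"
  assumes "subspace W" "\<forall>\<^sub>F t in nhds 0. \<psi> t \<in> W" "(\<psi> has_vector_derivative w) (at 0)"
  shows "w \<in> W"
proof -
  obtain y z where yz: "y \<in> span W" "\<And>u. u \<in> span W \<Longrightarrow> orthogonal z u" "w = y + z"
    using orthogonal_subspace_decomp_exists[of W w] by blast
  have "((\<lambda>t. z \<bullet> \<psi> t) has_real_derivative z \<bullet> w) (at 0)"
    using bounded_linear.has_vector_derivative[OF bounded_linear_inner_right assms(3), of z]
    by (simp add: has_real_derivative_iff_has_vector_derivative)
  moreover have "\<forall>\<^sub>F t in nhds 0. z \<bullet> \<psi> t = 0"
    using assms(2) by eventually_elim (use yz(2) in \<open>simp add: span_base orthogonal_def\<close>)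
  ultimately have "((\<lambda>t. 0) has_real_derivative z \<bullet> w) (at (0::real))"
    using DERIV_cong_ev[of 0 0 "\<lambda>t. z \<bullet> \<psi> t" "\<lambda>t. 0"] by blast
  then have "z \<bullet> w = 0" using DERIV_unique[OF _ DERIV_const] by blast
  then have "z = 0" using yz by (simp add: orthogonal_def inner_add_right)
  then show ?thesis using yz assms(1) by (simp add: span_eq_iff[THEN iffD2])
qed

text \<open>Read in a slice chart, a curve in f runs in the coordinate subspace, and so does its
  velocity; conversely the straight lines of that subspace through the point are curves in
  f.\<close>

lemma tangent_slice:
  assumes c: "slice_chart M d f c" and x: "x \<in> fst c" "x \<in> f"
  shows "tangent M f x = dchart_inv M c x ` span (set (take d std_basis))"
proof -
  let ?W = "span (set (take d std_basis))"
  let ?a = "chart_at M x"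
  have sc: "smooth_chart M c" and sl: "snd c ` (fst c \<inter> f) = snd c ` fst c \<inter> ?W"
    using c by (auto simp: slice_chart_def)
  have xp: "x \<in> points M" using smooth_chart_points[OF sc x(1)] .
  have a: "is_chart (points M) ?a" "x \<in> fst ?a"
    using chart_at_in[OF xp] atlas_smooth smooth_is_chart by blast+
  have ic: "is_chart (points M) c" using sc smooth_is_chart by blast
  have "v \<in> dchart_inv M c x ` ?W" if hv: "v \<in> tangent M f x" for v
  proof -
    obtain \<gamma> where g: "\<gamma> 0 = x" "\<forall>\<^sub>F t in nhds (0::real). \<gamma> t \<in> f \<inter> fst ?a"
      "((snd ?a \<circ> \<gamma>) has_vector_derivative v) (at 0)"
      using hv unfolding tangent_def by blast
    let ?\<psi> = "\<lambda>t. transition ?a c ((snd ?a \<circ> \<gamma>) t)"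
    have "((snd ?a \<circ> \<gamma>) has_derivative (\<lambda>h. h *\<^sub>R v)) (at 0)"
      using g(3) by (simp add: has_vector_derivative_def)
    from has_derivative_compose[OF this, of "transition ?a c" "dchart M c x"]
    have "(?\<psi> has_derivative (\<lambda>h. dchart M c x (h *\<^sub>R v))) (at 0)"
      using dchart_deriv(2)[OF sc x(1)] g(1) by simp
    then have d: "(?\<psi> has_vector_derivative dchart M c x v) (at 0)"
      using dchart_linear(1)[OF sc x(1)] by (simp add: has_vector_derivative_def linear_scale)
    have "isCont (snd ?a \<circ> \<gamma>) 0" using g(3) has_vector_derivative_continuous by blast
    then have "((snd ?a \<circ> \<gamma>) \<longlongrightarrow> snd ?a x) (nhds 0)"
      using g(1) tendsto_at_iff_tendsto_nhds[of "snd ?a \<circ> \<gamma>" 0] by (simp add: isCont_def)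
    then have "\<forall>\<^sub>F t in nhds 0. (snd ?a \<circ> \<gamma>) t \<in> snd ?a ` (fst ?a \<inter> fst c)"
      by (rule topological_tendstoD) (use chart_image_open[OF a(1) ic] a x in auto)
    then have "\<forall>\<^sub>F t in nhds 0. ?\<psi> t \<in> ?W"
      using g(2)
    proof eventually_elim
      fix t assume t: "(snd ?a \<circ> \<gamma>) t \<in> snd ?a ` (fst ?a \<inter> fst c)" "\<gamma> t \<in> f \<inter> fst ?a"
      have "chart_inv ?a ((snd ?a \<circ> \<gamma>) t) = \<gamma> t" using is_chartD(5)[OF a(1)] t(2) by simp
      then have "\<gamma> t \<in> fst c" using t(1) unfolding chart_image_Int[OF a(1)] by simp
      moreover have "?\<psi> t = snd c (\<gamma> t)" using transition_eq[OF a(1)] t(2) by simp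
      ultimately show "?\<psi> t \<in> ?W" using sl t(2) by (metis IntD1 IntD2 IntI imageI)
    qed
    from subspace_has_vector_derivative[OF subspace_span this d] have "dchart M c x v \<in> ?W" .
    then show ?thesis using dchart_inverse(2)[OF sc x(1), of v] by (metis imageI)
  qed
  moreover have "dchart_inv M c x w \<in> tangent M f x" if w: "w \<in> ?W" for w
  proof -
    let ?\<phi> = "\<lambda>t::real. snd c x + t *\<^sub>R w"
    let ?\<gamma> = "\<lambda>t. chart_inv c (?\<phi> t)"
    have d: "(?\<phi> has_derivative (\<lambda>h. h *\<^sub>R w)) (at 0)"
      by (auto intro!: derivative_eq_intros)
    from has_derivative_compose[OF d, of "transition c ?a" "dchart_inv M c x"]
    have "((\<lambda>t. transition c ?a (?\<phi> t)) has_derivative (\<lambda>h. dchart_inv M c x (h *\<^sub>R w))) (at 0)"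
      using dchart_deriv(1)[OF sc x(1)] by simp
    then have "((snd ?a \<circ> ?\<gamma>) has_vector_derivative dchart_inv M c x w) (at 0)"
      using dchart_linear(2)[OF sc x(1)]
      by (simp add: has_vector_derivative_def linear_scale transition_def o_def)
    moreover have "isCont ?\<phi> 0" by (intro continuous_intros)
    then have "(?\<phi> \<longlongrightarrow> snd c x) (nhds 0)"
      using tendsto_at_iff_tendsto_nhds[of ?\<phi> 0] by (simp add: isCont_def)
    then have "\<forall>\<^sub>F t in nhds 0. ?\<phi> t \<in> snd c ` (fst c \<inter> fst ?a)"
      by (rule topological_tendstoD) (use chart_image_open[OF ic a(1)] a x in auto)
    then have "\<forall>\<^sub>F t in nhds 0. ?\<gamma> t \<in> f \<inter> fst ?a"
    proof eventually_elim
      fix t assume t: "?\<phi> t \<in> snd c ` (fst c \<inter> fst ?a)"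
      then have t1: "?\<phi> t \<in> snd c ` fst c" "?\<gamma> t \<in> fst ?a" unfolding chart_image_Int[OF ic] by simp_all
      have "snd c x \<in> ?W" using sl x by blast
      then have "?\<phi> t \<in> ?W" using w by (simp add: span_add span_scale)
      then have "?\<phi> t \<in> snd c ` (fst c \<inter> f)" using sl t1 by blast
      then show "?\<gamma> t \<in> f \<inter> fst ?a" using t1 unfolding chart_image_Int[OF ic] by simp
    qed
    moreover have "?\<gamma> 0 = x" using is_chartD(5)[OF ic x(1)] by simp
    ultimately show ?thesis unfolding tangent_def mem_Collect_eq by (intro exI[of _ ?\<gamma>] conjI)
  qed
  ultimately show ?thesis by blast
qed

end

lemma std_basis_independent: "independent (set (take d std_basis))"
  "d \<le> 2 \<Longrightarrow> card (set (take d std_basis)) = d"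
proof -
  have i: "independent (set std_basis)"
    by (rule independent_mono[OF independent_Basis]) (auto simp: std_basis_def Basis_vec_def)
  show "independent (set (take d std_basis))"
    by (rule independent_mono[OF i]) (rule set_take_subset)
  have "distinct std_basis" by (simp add: std_basis_def axis_eq_axis)
  then show "d \<le> 2 \<Longrightarrow> card (set (take d std_basis)) = d"
    by (simp add: distinct_card std_basis_def)
qed

lemma vec2_expand: "w = (w $ 1) *\<^sub>R axis 1 1 + (w $ 2) *\<^sub>R axis 2 (1::real)" for w :: "real^2"
  by (simp add: vec_eq_iff forall_2 axis_def)

lemma span_std_basis: "span (set (take 2 std_basis)) = UNIV"
proof -
  have "w \<in> span (set (take 2 std_basis))" for w
  proof -
    have "(w $ 1) *\<^sub>R axis 1 1 + (w $ 2) *\<^sub>R axis 2 1 \<in> span (set (take 2 std_basis))"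
      by (intro span_add span_scale span_base) (simp_all add: std_basis_def)
    then show ?thesis using vec2_expand[of w] by simp
  qed
  then show ?thesis by blast
qed

section \<open>Dimensions of tangent spaces\<close>

context rsurface begin

lemma tangent_dim:
  assumes "submanifold M d f" "x \<in> f"
  shows "subspace (tangent M f x)" "dim (tangent M f x) = d"
proof -
  obtain c where c: "slice_chart M d f c" "x \<in> fst c" "d \<le> 2"
    using assms by (auto simp: submanifold_def)
  have sc: "smooth_chart M c" using c by (simp add: slice_chart_def)
  note lin = dchart_linear(2)[OF sc c(2)]
  note T = tangent_slice[OF c(1,2) assms(2)]
  show "subspace (tangent M f x)" unfolding T by (rule linear_subspace_image[OF lin subspace_span])
  have inj: "inj (dchart_inv M c x)" by (metis dchart_inverse(1)[OF sc c(2)] injI)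
  have "dim (tangent M f x) = dim (span (set (take d std_basis)))"
    unfolding T by (rule dim_image_eq[OF lin inj_on_subset[OF inj subset_UNIV]])
  also have "\<dots> = d"
    using dim_span_eq_card_independent[OF std_basis_independent(1)[of d]] std_basis_independent(2)[OF c(3)] by simp
  finally show "dim (tangent M f x) = d" .
qed

lemma tangent_2: "submanifold M 2 f \<Longrightarrow> x \<in> f \<Longrightarrow> tangent M f x = UNIV"
  using tangent_dim[of 2 f x] dim_eq_full[of "tangent M f x"] by (simp add: span_eq_iff[THEN iffD2])

text \<open>Lets the whole surface play the role of a 2-cell, so that global forms take values in
  covectors on all of the model plane.\<close>

lemma points_submanifold: "submanifold M 2 (points M)"
  unfolding submanifold_def
proof (intro conjI ballI)
  fix x assume x: "x \<in> points M"
  have "slice_chart M 2 (points M) (chart_at M x)"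
    using atlas_smooth[OF chart_at_in(1)[OF x]] is_chartD(1)[OF smooth_is_chart[OF atlas_smooth[OF chart_at_in(1)[OF x]]]]
    unfolding slice_chart_def span_std_basis by (simp add: Int_absorb2)
  then show "\<exists>c. slice_chart M 2 (points M) c \<and> x \<in> fst c" using chart_at_in(2)[OF x] by blast
qed auto

lemma tangent_points: "x \<in> points M \<Longrightarrow> tangent M (points M) x = UNIV"
  using tangent_2[OF points_submanifold] .

end

section \<open>Inner products of covectors in coordinates\<close>

text \<open>The inner product of two covectors through the inverse of the 2 by 2 Gram matrix of a
  frame. Unlike the sum over \<open>onb\<close>, a pointwise choice without continuity, it involves
  only components in the frame, which for a coordinate frame are of class C1.\<close>

definition gram_quot :: "real \<Rightarrow> real \<Rightarrow> real \<Rightarrow> real \<Rightarrow> real \<Rightarrow> real \<Rightarrow> real \<Rightarrow> real" where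
  "gram_quot g11 g12 g22 a1 a2 b1 b2 =
    (g22 * (a1 * b1) - g12 * (a1 * b2 + a2 * b1) + g11 * (a2 * b2)) / (g11 * g22 - g12 * g12)"

text \<open>The Gram determinant is the square of the determinant p s - q r of the frame in the
  orthonormal basis.\<close>

lemma gram_quot_orthonormal:
  assumes "p * s - q * r \<noteq> 0"
  shows "(p * p + q * q) * (r * r + s * s) - (p * r + q * s) * (p * r + q * s) \<noteq> 0"
    and "gram_quot (p * p + q * q) (p * r + q * s) (r * r + s * s)
      (p * a1 + q * a2) (r * a1 + s * a2) (p * b1 + q * b2) (r * b1 + s * b2) = a1 * b1 + a2 * b2"
proof -
  have eq: "(p * p + q * q) * (r * r + s * s) - (p * r + q * s) * (p * r + q * s) =
      (p * s - q * r) * (p * s - q * r)"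
    by (simp add: algebra_simps)
  then show ne: "(p * p + q * q) * (r * r + s * s) - (p * r + q * s) * (p * r + q * s) \<noteq> 0"
    using assms by simp
  show "gram_quot (p * p + q * q) (p * r + q * s) (r * r + s * s)
      (p * a1 + q * a2) (r * a1 + s * a2) (p * b1 + q * b2) (r * b1 + s * b2) = a1 * b1 + a2 * b2"
    unfolding gram_quot_def divide_eq_eq using ne by (simp only: if_False) (simp, algebra)
qed

lemma Ck_on_1_gram_quot:
  assumes "open S" "Ck_on 1 g11 S" "Ck_on 1 g12 S" "Ck_on 1 g22 S"
    "Ck_on 1 a1 S" "Ck_on 1 a2 S" "Ck_on 1 b1 S" "Ck_on 1 b2 S"
    "\<And>y. y \<in> S \<Longrightarrow> g11 y * g22 y - g12 y * g12 y \<noteq> 0"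
  shows "Ck_on 1 (\<lambda>y. gram_quot (g11 y) (g12 y) (g22 y) (a1 y) (a2 y) (b1 y) (b2 y)) S"
  unfolding gram_quot_def
  by (intro Ck_on_1_divide Ck_on_1_add Ck_on_1_diff Ck_on_1_mult assms)

context rsurface begin

lemma basis_points:
  assumes "x \<in> points M"
  obtains u w where "onb M (points M) x = [u, w]" "u \<noteq> w" "\<forall>z. \<exists>p q. z = p *\<^sub>R u + q *\<^sub>R w"
    "riem M x u u = 1" "riem M x u w = 0" "riem M x w u = 0" "riem M x w w = 1"
proof (rule onb_2[OF metric[OF assms] tangent_dim[OF points_submanifold assms]])
  fix u w
  assume *: "onb M (points M) x = [u, w]" "u \<noteq> w" "tangent M (points M) x = UNIV" "\<And>z. \<exists>p q. z = p *\<^sub>R u + q *\<^sub>R w"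
    "riem M x u u = 1" "riem M x u w = 0" "riem M x w u = 0" "riem M x w w = 1"
  show thesis by (rule that[OF *(1,2) _ *(5-8)]) (use *(4) in blast)
qed

lemma cov_inner_gram:
  assumes x: "x \<in> points M" and \<alpha>: "\<alpha> \<in> covectors UNIV 1" and \<beta>: "\<beta> \<in> covectors UNIV 1"
    and b: "\<And>z. \<exists>p q. z = p *\<^sub>R b1 + q *\<^sub>R b2"
  shows "cov_inner M (points M) x \<alpha> \<beta> =
      gram_quot (riem M x b1 b1) (riem M x b1 b2) (riem M x b2 b2) (\<alpha> [b1]) (\<alpha> [b2]) (\<beta> [b1]) (\<beta> [b2])"
    and "riem M x b1 b1 * riem M x b2 b2 - riem M x b1 b2 * riem M x b1 b2 \<noteq> 0"
proof -
  obtain u w where u: "onb M (points M) x = [u, w]" "u \<noteq> w" "\<forall>z. \<exists>p q. z = p *\<^sub>R u + q *\<^sub>R w"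
    "riem M x u u = 1" "riem M x u w = 0" "riem M x w u = 0" "riem M x w w = 1"
    using basis_points[OF x] .
  note g = inner_product_on_planeD[OF metric[OF x]]
  have gg: "riem M x (p *\<^sub>R u + q *\<^sub>R w) (r *\<^sub>R u + s *\<^sub>R w) = p * r + q * s" for p q r s
    by (simp add: g(1,2) u)
  obtain p q r s where pq: "b1 = p *\<^sub>R u + q *\<^sub>R w" "b2 = r *\<^sub>R u + s *\<^sub>R w" using u(3) by metis
  obtain k l m n where kl: "u = k *\<^sub>R b1 + l *\<^sub>R b2" "w = m *\<^sub>R b1 + n *\<^sub>R b2" using b by metis
  have b1: "riem M x b1 u = p" "riem M x b1 w = q" and b2: "riem M x b2 u = r" "riem M x b2 w = s"
    unfolding pq by (simp_all add: g(2) u)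
  have "riem M x (k *\<^sub>R b1 + l *\<^sub>R b2) u = 1" "riem M x (k *\<^sub>R b1 + l *\<^sub>R b2) w = 0"
    "riem M x (m *\<^sub>R b1 + n *\<^sub>R b2) u = 0" "riem M x (m *\<^sub>R b1 + n *\<^sub>R b2) w = 1"
    using u(4-7) kl by metis+
  then have "k * p + l * r = 1" "k * q + l * s = 0" "m * p + n * r = 0" "m * q + n * s = 1"
    by (simp_all add: g(2) b1 b2)
  \<comment> \<open>The two coefficient matrices are inverse to each other, so their determinants
    multiply to 1.\<close>
  then have "(k * n - l * m) * (p * s - q * r) = 1" by algebra
  then have ne: "p * s - q * r \<noteq> 0" by auto
  have "cov_inner M (points M) x \<alpha> \<beta> = \<alpha> [u] * \<beta> [u] + \<alpha> [w] * \<beta> [w]"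
    by (rule cov_inner_2_1[OF \<alpha> u(1,2)])
  moreover have "\<alpha> [b1] = p * \<alpha> [u] + q * \<alpha> [w]" "\<alpha> [b2] = r * \<alpha> [u] + s * \<alpha> [w]"
    "\<beta> [b1] = p * \<beta> [u] + q * \<beta> [w]" "\<beta> [b2] = r * \<beta> [u] + s * \<beta> [w]"
    unfolding pq using covectors_1D[OF \<alpha>, of u w] covectors_1D[OF \<beta>, of u w] by simp_all
  moreover have gr: "riem M x b1 b1 = p * p + q * q" "riem M x b1 b2 = p * r + q * s"
    "riem M x b2 b2 = r * r + s * s"
    unfolding pq gg by simp_all
  ultimately show "cov_inner M (points M) x \<alpha> \<beta> =
      gram_quot (riem M x b1 b1) (riem M x b1 b2) (riem M x b2 b2) (\<alpha> [b1]) (\<alpha> [b2]) (\<beta> [b1]) (\<beta> [b2])"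
    using gram_quot_orthonormal(2)[OF ne] by simp
  show "riem M x b1 b1 * riem M x b2 b2 - riem M x b1 b2 * riem M x b1 b2 \<noteq> 0"
    using gram_quot_orthonormal(1)[OF ne] unfolding gr .
qed

text \<open>The coordinate vector fields of the chart, in the fixed model of the tangent space at
  each point.\<close>

definition frame :: "'a chart \<Rightarrow> 2 \<Rightarrow> real^2 \<Rightarrow> real^2" where
  "frame c i y = dchart_inv M c (chart_inv c y) (axis i 1)"

definition metric_coeff :: "'a chart \<Rightarrow> 2 \<Rightarrow> 2 \<Rightarrow> real^2 \<Rightarrow> real" where
  "metric_coeff c i j y = riem M (chart_inv c y) (frame c i y) (frame c j y)"

lemma frame_spans:
  assumes "c \<in> atlas M" "y \<in> snd c ` fst c"
  shows "\<exists>p q. z = p *\<^sub>R frame c 1 y + q *\<^sub>R frame c 2 y"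
proof -
  let ?x = "chart_inv c y"
  have sc: "smooth_chart M c" "?x \<in> fst c"
    using atlas_smooth[OF assms(1)] is_chartD(7)[OF smooth_is_chart] assms(2) by blast+
  define w where "w = dchart M c ?x z"
  have "z = dchart_inv M c ?x w" using dchart_inverse(2)[OF sc] by (simp add: w_def)
  also have "\<dots> = dchart_inv M c ?x ((w $ 1) *\<^sub>R axis 1 1 + (w $ 2) *\<^sub>R axis 2 1)"
    using vec2_expand[of w] by simp
  also have "\<dots> = (w $ 1) *\<^sub>R frame c 1 y + (w $ 2) *\<^sub>R frame c 2 y"
    using dchart_linear(2)[OF sc] by (simp add: linear_add linear_scale frame_def)
  finally show ?thesis by blast
qed

lemma metric_coeff_Ck: "c \<in> atlas M \<Longrightarrow> Ck_on 1 (metric_coeff c i j) (snd c ` fst c)"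
  using crs smooth_on_Ck unfolding compact_riemannian_surface_def metric_coeff_def[abs_def] frame_def by blast

lemma chart_inv_points: "c \<in> atlas M \<Longrightarrow> y \<in> snd c ` fst c \<Longrightarrow> chart_inv c y \<in> points M"
  using is_chartD(1,7)[OF smooth_is_chart[OF atlas_smooth]] by blast

lemma atlas_open: "c \<in> atlas M \<Longrightarrow> open (snd c ` fst c)"
  using is_chartD(2)[OF smooth_is_chart[OF atlas_smooth]] .

lemma cov_inner_chart:
  assumes "c \<in> atlas M" "y \<in> snd c ` fst c" "\<alpha> \<in> covectors UNIV 1" "\<beta> \<in> covectors UNIV 1"
  shows "cov_inner M (points M) (chart_inv c y) \<alpha> \<beta> =
      gram_quot (metric_coeff c 1 1 y) (metric_coeff c 1 2 y) (metric_coeff c 2 2 y)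
        (\<alpha> [frame c 1 y]) (\<alpha> [frame c 2 y]) (\<beta> [frame c 1 y]) (\<beta> [frame c 2 y])"
    and "metric_coeff c 1 1 y * metric_coeff c 2 2 y - metric_coeff c 1 2 y * metric_coeff c 1 2 y \<noteq> 0"
  using cov_inner_gram[OF chart_inv_points[OF assms(1,2)] assms(3,4) frame_spans[OF assms(1,2)]]
  unfolding metric_coeff_def by blast+

section \<open>Forms of class \<open>C\<^sup>1\<close>\<close>

lemma C1_formsD:
  assumes "\<eta> \<in> C1_forms M l"
  shows "\<eta> \<in> forms M (points M) l" "x \<in> points M \<Longrightarrow> \<eta> x \<in> covectors UNIV l"
    "c \<in> atlas M \<Longrightarrow> Ck_on 1 (\<lambda>y. pull M c \<eta> y ws) (snd c ` fst c)"
  using assms tangent_points by (auto simp: C1_forms_def forms_def)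

lemma C1_formsI:
  assumes "\<And>x. x \<in> points M \<Longrightarrow> \<eta> x \<in> covectors UNIV l" "\<And>x. x \<notin> points M \<Longrightarrow> \<eta> x = 0"
    and "\<And>c ws. c \<in> atlas M \<Longrightarrow> Ck_on 1 (\<lambda>y. pull M c \<eta> y ws) (snd c ` fst c)"
  shows "\<eta> \<in> C1_forms M l"
  using assms tangent_points by (auto simp: C1_forms_def forms_def)

lemma C1_forms_lin:
  assumes "\<eta> \<in> C1_forms M l" "\<eta>' \<in> C1_forms M l"
  shows "a *\<^sub>F \<eta> + b *\<^sub>F \<eta>' \<in> C1_forms M l"
proof -
  have "pull M c (a *\<^sub>F \<eta> + b *\<^sub>F \<eta>') y ws = a * pull M c \<eta> y ws + b * pull M c \<eta>' y ws" for c y ws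
    by (simp add: pull_def form_scale_def)
  then show ?thesis
    using assms forms_lin[of \<eta> M "points M" l \<eta>' a b] Ck_on_1_lin[OF atlas_open]
    unfolding C1_forms_def by auto
qed

lemma restrict_form_lin:
  "restrict_form M f (a *\<^sub>F \<eta> + b *\<^sub>F \<eta>') = a *\<^sub>F restrict_form M f \<eta> + b *\<^sub>F restrict_form M f \<eta>'"
  by (simp add: restrict_form_def form_scale_def fun_eq_iff)

lemma C1_closed_forms_lin:
  assumes "\<omega> \<in> C1_closed_forms M f l" "\<omega>' \<in> C1_closed_forms M f l"
  shows "a *\<^sub>F \<omega> + b *\<^sub>F \<omega>' \<in> C1_closed_forms M f l"
proof -
  obtain \<eta> \<eta>' where "\<eta> \<in> C1_forms M l" "\<omega> = restrict_form M f \<eta>" "\<eta>' \<in> C1_forms M l" "\<omega>' = restrict_form M f \<eta>'"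
    using assms by (auto simp: C1_closed_forms_def)
  then show ?thesis using C1_forms_lin[of \<eta> l \<eta>' a b]
    unfolding C1_closed_forms_def by (auto simp flip: restrict_form_lin)
qed

lemma covectors_restrict:
  assumes "\<alpha> \<in> covectors UNIV l" "subspace V"
  shows "(\<lambda>vs. if set vs \<subseteq> V then \<alpha> vs else 0) \<in> covectors V l"
proof (rule covectorsI)
  show "(if set vs \<subseteq> V then \<alpha> vs else 0) = 0" if "\<not> (int (length vs) = l \<and> set vs \<subseteq> V)" for vs
    using covectors_vanish[OF assms(1)] that by auto
  show "(if set vs \<subseteq> V then \<alpha> vs else 0) = 0" if "i < j" "j < length vs" "vs ! i = vs ! j" for vs i j
    using covectors_alternating[OF assms(1) that] by simp
  show "(if set (vs[i := a *\<^sub>R u + b *\<^sub>R w]) \<subseteq> V then \<alpha> (vs[i := a *\<^sub>R u + b *\<^sub>R w]) else 0) =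
      a * (if set (vs[i := u]) \<subseteq> V then \<alpha> (vs[i := u]) else 0) +
      b * (if set (vs[i := w]) \<subseteq> V then \<alpha> (vs[i := w]) else 0)"
    if "int (length vs) = l" "set vs \<subseteq> V" "i < length vs" "u \<in> V" "w \<in> V" for vs i u w a b
  proof -
    have "a *\<^sub>R u + b *\<^sub>R w \<in> V" using that assms(2) by (simp add: subspace_add subspace_scale)
    then have "set (vs[i := z]) \<subseteq> V" if "z \<in> {u, w, a *\<^sub>R u + b *\<^sub>R w}" for z
      using set_update_subset_insert[of vs i z] \<open>set vs \<subseteq> V\<close> \<open>u \<in> V\<close> \<open>w \<in> V\<close> that by blast
    then show ?thesis using covectors_multilinear[OF assms(1) that(1) _ that(3), of u w a b] by simp
  qed
qed

lemma C1_closed_forms_forms: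
  assumes "submanifold M d f"
  shows "C1_closed_forms M f l \<subseteq> forms M f l"
proof
  fix \<omega> assume "\<omega> \<in> C1_closed_forms M f l"
  then obtain \<eta> where \<eta>: "\<eta> \<in> C1_forms M l" "\<omega> = restrict_form M f \<eta>" by (auto simp: C1_closed_forms_def)
  have "\<omega> x \<in> covectors (tangent M f x) l" if x: "x \<in> f" for x
  proof -
    have "\<omega> x = (\<lambda>vs. if set vs \<subseteq> tangent M f x then \<eta> x vs else 0)"
      unfolding \<eta>(2) restrict_form_def using x by simp
    then show ?thesis
      using covectors_restrict[OF C1_formsD(2)[OF \<eta>(1)] tangent_dim(1)[OF assms x]] x assms
      by (auto simp: submanifold_def)
  qed
  then show "\<omega> \<in> forms M f l" unfolding \<eta>(2) by (auto simp: forms_def restrict_form_def fun_eq_iff)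
qed

lemma restrict_form_2:
  assumes "submanifold M 2 f" "x \<in> f"
  shows "restrict_form M f \<eta> x = \<eta> x"
  using tangent_2[OF assms] assms(2) by (simp add: restrict_form_def fun_eq_iff)

lemma continuous_on_points:
  assumes "\<And>c. c \<in> atlas M \<Longrightarrow> continuous_on (snd c ` fst c) (\<lambda>y. u (chart_inv c y))"
  shows "continuous_on (points M) u"
proof (rule continuous_on_charts[OF subset_refl])
  fix x assume x: "x \<in> points M"
  have c: "chart_at M x \<in> atlas M" "x \<in> fst (chart_at M x)" using chart_at_in[OF x] .
  moreover have ic: "is_chart (points M) (chart_at M x)" using c atlas_smooth smooth_is_chart by blast
  moreover have "fst (chart_at M x) \<inter> points M = fst (chart_at M x)" using is_chartD(1)[OF ic] by blast
  ultimately show "\<exists>c. is_chart (points M) c \<and> x \<in> fst c \<and>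
      continuous_on (snd c ` (fst c \<inter> points M)) (\<lambda>y. u (chart_inv c y))"
    using assms by metis
qed

lemma bounded_on_points:
  fixes u :: "'a \<Rightarrow> real"
  assumes "continuous_on (points M) u"
  obtains K where "\<And>x. x \<in> points M \<Longrightarrow> \<bar>u x\<bar> \<le> K"
proof -
  have "compact (points M)" using crs by (simp add: compact_riemannian_surface_def)
  then have "bounded (u ` points M)" using assms compact_continuous_image compact_imp_bounded by blast
  then show ?thesis using that by (auto simp: bounded_iff)
qed

lemma C1_forms_0_continuous:
  assumes "\<eta> \<in> C1_forms M 0"
  shows "continuous_on (points M) (\<lambda>x. \<eta> x [])"
  by (rule continuous_on_points)
     (use Ck_on_1_continuous[OF C1_formsD(3)[OF assms], of _ "[]"] in \<open>simp add: pull_def\<close>)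

text \<open>In each chart the Gram quotient is a C1 expression in the components, its denominator
  being a determinant without zeros.\<close>

lemma C1_forms_1_inner_continuous:
  assumes "\<eta> \<in> C1_forms M 1" "\<eta>' \<in> C1_forms M 1"
  shows "continuous_on (points M) (\<lambda>x. cov_inner M (points M) x (\<eta> x) (\<eta>' x))"
proof (rule continuous_on_points)
  fix c assume c: "c \<in> atlas M"
  let ?S = "snd c ` fst c"
  have C: "Ck_on 1 (\<lambda>y. \<theta> (chart_inv c y) [frame c i y]) ?S" if "\<theta> \<in> C1_forms M 1" for \<theta> i
    using C1_formsD(3)[OF that c, of "[axis i 1]"] by (simp add: pull_def frame_def)
  have cv: "\<eta> (chart_inv c y) \<in> covectors UNIV 1" "\<eta>' (chart_inv c y) \<in> covectors UNIV 1" if "y \<in> ?S" for y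
    using C1_formsD(2)[OF assms(1)] C1_formsD(2)[OF assms(2)] chart_inv_points[OF c that] by blast+
  have "Ck_on 1 (\<lambda>y. gram_quot (metric_coeff c 1 1 y) (metric_coeff c 1 2 y) (metric_coeff c 2 2 y)
      (\<eta> (chart_inv c y) [frame c 1 y]) (\<eta> (chart_inv c y) [frame c 2 y])
      (\<eta>' (chart_inv c y) [frame c 1 y]) (\<eta>' (chart_inv c y) [frame c 2 y])) ?S"
    by (intro Ck_on_1_gram_quot atlas_open[OF c] metric_coeff_Ck[OF c] C assms)
       (use cov_inner_chart(2)[OF c _ cv] in blast)
  then have "continuous_on ?S (\<lambda>y. gram_quot (metric_coeff c 1 1 y) (metric_coeff c 1 2 y) (metric_coeff c 2 2 y)
      (\<eta> (chart_inv c y) [frame c 1 y]) (\<eta> (chart_inv c y) [frame c 2 y])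
      (\<eta>' (chart_inv c y) [frame c 1 y]) (\<eta>' (chart_inv c y) [frame c 2 y]))"
    by (rule Ck_on_1_continuous)
  then show "continuous_on ?S (\<lambda>y. cov_inner M (points M) (chart_inv c y) (\<eta> (chart_inv c y)) (\<eta>' (chart_inv c y)))"
    by (rule continuous_on_eq) (use cov_inner_chart(1)[OF c _ cv] in simp)
qed

lemma onb_2_points:
  assumes "submanifold M 2 f" "x \<in> f"
  shows "onb M f x = onb M (points M) x"
proof -
  have "x \<in> points M" using assms by (auto simp: submanifold_def)
  from tangent_points[OF this] show ?thesis unfolding onb_def tangent_2[OF assms] by simp
qed

lemma cov_inner_2_points:
  assumes "submanifold M 2 f" "x \<in> f"
  shows "cov_inner M f x \<alpha> \<beta> = cov_inner M (points M) x \<alpha> \<beta>"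
  unfolding cov_inner_def onb_2_points[OF assms] ..

text \<open>If \<open>\<theta>\<close> is the volume form, this contraction is \<open>\<star>\<^sup>-\<^sup>1\<eta>\<close>.\<close>

lemma C1_contraction:
  assumes \<eta>: "\<eta> \<in> C1_forms M 1" and \<theta>: "\<theta> \<in> C1_forms M 2"
  shows "(\<lambda>x vs. if x \<in> points M \<and> length vs = 1
      then cov_inner M (points M) x (\<eta> x) (\<lambda>us. \<theta> x (hd vs # us)) else 0) \<in> C1_forms M 1" (is "?\<Omega> \<in> _")
proof (rule C1_formsI)
  fix x assume x: "x \<in> points M"
  obtain u w where u: "onb M (points M) x = [u, w]" "u \<noteq> w" using basis_points[OF x] by metis
  note ci = cov_inner_2_1[OF C1_formsD(2)[OF \<eta> x] u]
  show "?\<Omega> x \<in> covectors UNIV 1"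
    by (rule covectors_1I) (auto simp: x ci covectors_2D(1)[OF C1_formsD(2)[OF \<theta> x]] algebra_simps)
next
  fix x assume "x \<notin> points M"
  then show "?\<Omega> x = 0" by (simp add: fun_eq_iff)
next
  fix c ws assume c: "c \<in> atlas M"
  let ?S = "snd c ` fst c"
  show "Ck_on 1 (\<lambda>y. pull M c ?\<Omega> y ws) ?S"
  proof (cases "length ws = 1")
    case False
    then show ?thesis using Ck_on_1_const[OF atlas_open[OF c]] by (simp add: pull_def)
  next
    case True
    then obtain w where ws: "ws = [w]" by (auto simp: length_Suc_conv)
    let ?w = "\<lambda>y. dchart_inv M c (chart_inv c y) w"
    have C: "Ck_on 1 (\<lambda>y. \<eta> (chart_inv c y) [frame c i y]) ?S"
      "Ck_on 1 (\<lambda>y. \<theta> (chart_inv c y) [?w y, frame c i y]) ?S" for i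
      using C1_formsD(3)[OF \<eta> c, of "[axis i 1]"] C1_formsD(3)[OF \<theta> c, of "[w, axis i 1]"]
      by (simp_all add: pull_def frame_def)
    have cv: "\<eta> (chart_inv c y) \<in> covectors UNIV 1" if "y \<in> ?S" for y
      using C1_formsD(2)[OF \<eta>] chart_inv_points[OF c that] by blast
    let ?Q = "\<lambda>y. gram_quot (metric_coeff c 1 1 y) (metric_coeff c 1 2 y) (metric_coeff c 2 2 y)
      (\<eta> (chart_inv c y) [frame c 1 y]) (\<eta> (chart_inv c y) [frame c 2 y])
      (\<theta> (chart_inv c y) [?w y, frame c 1 y]) (\<theta> (chart_inv c y) [?w y, frame c 2 y])"
    have "Ck_on 1 ?Q ?S"
      by (intro Ck_on_1_gram_quot atlas_open[OF c] metric_coeff_Ck[OF c] C)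
         (use cov_inner_chart(2)[OF c _ cv cv] in blast)
    moreover have "?Q y = pull M c ?\<Omega> y ws" if y: "y \<in> ?S" for y
    proof -
      let ?x = "chart_inv c y"
      have x: "?x \<in> points M" by (rule chart_inv_points[OF c y])
      obtain u v where u: "onb M (points M) ?x = [u, v]" "u \<noteq> v" using basis_points[OF x] by metis
      define \<mu> where "\<mu> us = (if length us = 1 then \<theta> ?x (?w y # us) else 0)" for us
      have \<mu>: "\<mu> \<in> covectors UNIV 1"
      proof (rule covectors_1I)
        show "\<mu> [a *\<^sub>R p + b *\<^sub>R q] = a * \<mu> [p] + b * \<mu> [q]" for a b p q
          by (simp add: \<mu>_def covectors_2D(2)[OF C1_formsD(2)[OF \<theta> x]])
      qed (auto simp: \<mu>_def)
      have "cov_inner M (points M) ?x (\<eta> ?x) (\<lambda>us. \<theta> ?x (?w y # us)) = cov_inner M (points M) ?x (\<eta> ?x) \<mu>"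
        by (simp add: cov_inner_2_1[OF C1_formsD(2)[OF \<eta> x] u] \<mu>_def)
      also have "\<dots> = ?Q y"
        using cov_inner_chart(1)[OF c y cv[OF y] \<mu>] by (simp add: \<mu>_def)
      finally show ?thesis using x by (simp add: pull_def ws)
    qed
    ultimately show ?thesis by (rule Ck_on_1_cong[OF atlas_open[OF c]])
  qed
qed

section \<open>Traces\<close>

text \<open>A fixed list of model vectors is no continuous object near x, as every point reads its
  tangent space in its own chart. Fixed coordinate vectors in the chart at x are used instead: the
  components of the difference along them are continuous and vanish on f. The two degrees may differ
  because the \<open>SOME\<close> in \<open>trace_form\<close> does not prescribe one.\<close>

lemma C1_forms_eq_on_closure:
  assumes "\<eta> \<in> C1_forms M l" "\<eta>' \<in> C1_forms M l'" "f \<subseteq> points M" "x \<in> points M" "x \<in> closure f"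
    and eq: "\<And>z. z \<in> f \<Longrightarrow> \<eta> z = \<eta>' z"
  shows "\<eta> x = \<eta>' x"
proof
  fix vs
  let ?c = "chart_at M x"
  have c: "?c \<in> atlas M" "x \<in> fst ?c" using chart_at_in[OF assms(4)] .
  have sc: "smooth_chart M ?c" and ic: "is_chart (points M) ?c"
    using c atlas_smooth smooth_is_chart by blast+
  define ws where "ws = map (dchart M ?c x) vs"
  define h where "h z = pull M ?c \<eta> (snd ?c z) ws - pull M ?c \<eta>' (snd ?c z) ws" for z
  have hz: "h z = \<eta> z (map (dchart_inv M ?c z) ws) - \<eta>' z (map (dchart_inv M ?c z) ws)" if "z \<in> fst ?c" for z
    using is_chartD(5)[OF ic that] by (simp add: h_def pull_def)
  have "continuous_on (snd ?c ` fst ?c) (\<lambda>y. pull M ?c \<eta> y ws - pull M ?c \<eta>' y ws)"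
    by (intro continuous_on_diff Ck_on_1_continuous C1_formsD(3)[OF assms(1) c(1)] C1_formsD(3)[OF assms(2) c(1)])
  from continuous_on_compose2[OF this is_chartD(3)[OF ic] subset_refl]
  have "continuous_on (fst ?c) h" by (simp add: h_def[abs_def])
  moreover have "open (- {0::real})" by (simp add: open_Compl)
  ultimately obtain A where A: "open A" "A \<inter> fst ?c = h -` (- {0}) \<inter> fst ?c"
    unfolding continuous_on_open_invariant by blast
  obtain U where U: "open U" "fst ?c = points M \<inter> U" using is_chartD(8)[OF ic] by blast
  have "h x = 0"
  proof (rule ccontr)
    assume "h x \<noteq> 0"
    then have "x \<in> A \<inter> U" using A(2) c(2) U by blast
    moreover have "open (A \<inter> U)" using A U by blast
    ultimately obtain z where "z \<in> f" "z \<in> A \<inter> U"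
      using assms(5) by (metis IntE disjoint_iff open_Int_closure_eq_empty)
    then have "z \<in> fst ?c" "h z \<noteq> 0" using A(2) U(2) assms(3) by blast+
    then show False using hz eq[OF \<open>z \<in> f\<close>] by simp
  qed
  moreover have "map (dchart_inv M ?c x) ws = vs"
    by (simp add: ws_def o_def dchart_inverse(2)[OF sc c(2)])
  ultimately show "\<eta> x vs = \<eta>' x vs" using hz[OF c(2)] by simp
qed

text \<open>On a 2-cell the restriction loses no tangent direction, so the chosen extension agrees
  with \<eta> on f and then on its closure.\<close>

lemma trace_form_restrict:
  assumes f: "submanifold M 2 f" and f': "f' \<subseteq> points M" "f' \<subseteq> closure f" and \<eta>: "\<eta> \<in> C1_forms M l"
  shows "trace_form M f f' (restrict_form M f \<eta>) = restrict_form M f' \<eta>"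
proof -
  let ?P = "\<lambda>\<eta>'. (\<exists>l. \<eta>' \<in> C1_forms M l) \<and> restrict_form M f \<eta>' = restrict_form M f \<eta>"
  have "?P (SOME \<eta>'. ?P \<eta>')" by (rule someI_ex[of ?P]) (use \<eta> in blast)
  then obtain \<eta>' l' where e: "(SOME \<eta>'. ?P \<eta>') = \<eta>'" "\<eta>' \<in> C1_forms M l'" "restrict_form M f \<eta>' = restrict_form M f \<eta>"
    by blast
  have "\<eta>' z = \<eta> z" if "z \<in> f" for z
    using e(3) restrict_form_2[OF f that] by metis
  then have "\<eta>' x = \<eta> x" if "x \<in> f'" for x
    using C1_forms_eq_on_closure[OF e(2) \<eta>, of f x] f f' that by (auto simp: submanifold_def)
  then show ?thesis unfolding trace_form_def e(1) by (auto simp: restrict_form_def fun_eq_iff)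
qed

lemma trace_form_C1_closed:
  assumes "submanifold M 2 f" "f' \<subseteq> points M" "f' \<subseteq> closure f" "\<omega> \<in> C1_closed_forms M f l"
  shows "trace_form M f f' \<omega> \<in> C1_closed_forms M f' l"
  using assms trace_form_restrict[OF assms(1-3)] by (auto simp: C1_closed_forms_def)

lemma trace_form_lin:
  assumes "submanifold M 2 f" "f' \<subseteq> points M" "f' \<subseteq> closure f"
    "\<omega> \<in> C1_closed_forms M f l" "\<omega>' \<in> C1_closed_forms M f l"
  shows "trace_form M f f' (a *\<^sub>F \<omega> + b *\<^sub>F \<omega>') = a *\<^sub>F trace_form M f f' \<omega> + b *\<^sub>F trace_form M f f' \<omega>'"
proof -
  obtain \<eta> \<eta>' where e: "\<eta> \<in> C1_forms M l" "\<omega> = restrict_form M f \<eta>" "\<eta>' \<in> C1_forms M l" "\<omega>' = restrict_form M f \<eta>'"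
    using assms(4,5) by (auto simp: C1_closed_forms_def)
  show ?thesis unfolding e(2,4) restrict_form_lin[symmetric]
    unfolding trace_form_restrict[OF assms(1-3) e(1)] trace_form_restrict[OF assms(1-3) e(3)]
      trace_form_restrict[OF assms(1-3) C1_forms_lin[OF e(1,3)]]
    by (rule restrict_form_lin)
qed

section \<open>The exterior derivative of functions\<close>

text \<open>\<open>deriv\<close> can be added safely only where the derivatives exist. The slice
  chart need not belong to the atlas, so existence is transported from the chart at x by the
  transition map.\<close>

lemma C1_closed_0_derivative:
  assumes f: "slice_chart M 2 f c" "x \<in> fst c" and \<omega>: "\<omega> \<in> C1_closed_forms M f 0"
  shows "\<exists>D. ((\<lambda>t. pull M c \<omega> (snd c x + t *\<^sub>R w) []) has_real_derivative D) (at 0)"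
proof -
  obtain \<eta> where \<eta>: "\<eta> \<in> C1_forms M 0" "\<omega> = restrict_form M f \<eta>" using \<omega> by (auto simp: C1_closed_forms_def)
  have sc: "smooth_chart M c" and sl: "snd c ` (fst c \<inter> f) = snd c ` fst c"
    using f(1) unfolding slice_chart_def span_std_basis by auto
  have x: "x \<in> points M" using smooth_chart_points[OF sc f(2)] .
  let ?a = "chart_at M x"
  have a: "?a \<in> atlas M" "x \<in> fst ?a" "is_chart (points M) ?a"
    using chart_at_in[OF x] atlas_smooth smooth_is_chart by blast+
  have ic: "is_chart (points M) c" using sc smooth_is_chart by blast
  let ?O = "snd c ` (fst c \<inter> fst ?a)"
  obtain P where P: "((\<lambda>y. pull M ?a \<eta> y []) has_derivative P) (at (snd ?a x))"
    using C1_formsD(3)[OF \<eta>(1) a(1), of "[]"] a(2) unfolding Ck_on_1_iff[OF atlas_open[OF a(1)]] by blast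
  have "((\<lambda>y. pull M ?a \<eta> (transition c ?a y) []) has_derivative (\<lambda>h. P (dchart_inv M c x h))) (at (snd c x))"
    using has_derivative_compose[OF dchart_deriv(1)[OF sc f(2)], of "\<lambda>y. pull M ?a \<eta> y []" P] P
      transition_eq[OF ic f(2)] by simp
  then have "((\<lambda>y. pull M c \<omega> y []) has_derivative (\<lambda>h. P (dchart_inv M c x h))) (at (snd c x))"
  proof (rule has_derivative_transform_within_open)
    show "open ?O" by (rule chart_image_open[OF ic a(3)])
    show "snd c x \<in> ?O" using f(2) a(2) by blast
    fix y assume "y \<in> ?O"
    then obtain z where z: "z \<in> fst c" "z \<in> fst ?a" "y = snd c z" by blast
    have "snd c z \<in> snd c ` (fst c \<inter> f)" using sl z by blast
    then have "z \<in> f" using is_chartD(5)[OF ic] z(1) unfolding chart_image_Int[OF ic] by simp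
    then show "pull M ?a \<eta> (transition c ?a y) [] = pull M c \<omega> y []"
      using z transition_eq[OF ic z(1)] is_chartD(5)[OF ic z(1)] is_chartD(5)[OF a(3) z(2)]
      by (simp add: pull_def \<eta>(2) restrict_form_def)
  qed
  moreover have "((\<lambda>t::real. snd c x + t *\<^sub>R w) has_derivative (\<lambda>t. t *\<^sub>R w)) (at 0)"
    by (auto intro!: derivative_eq_intros)
  ultimately have "((\<lambda>t. pull M c \<omega> (snd c x + t *\<^sub>R w) []) has_derivative
      (\<lambda>t. P (dchart_inv M c x (t *\<^sub>R w)))) (at 0)"
    using has_derivative_compose[of "\<lambda>t::real. snd c x + t *\<^sub>R w" "\<lambda>t. t *\<^sub>R w" 0 UNIV "\<lambda>y. pull M c \<omega> y []"] by simp
  then show ?thesis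
    by (meson differentiableI real_differentiable_def)
qed

lemma ext_deriv_lin:
  assumes f: "submanifold M 2 f" and \<omega>: "\<omega> \<in> C1_closed_forms M f 0" "\<omega>' \<in> C1_closed_forms M f 0"
  shows "ext_deriv M 2 f (a *\<^sub>F \<omega> + b *\<^sub>F \<omega>') = a *\<^sub>F ext_deriv M 2 f \<omega> + b *\<^sub>F ext_deriv M 2 f \<omega>'"
proof (intro ext)
  fix x vs
  show "ext_deriv M 2 f (a *\<^sub>F \<omega> + b *\<^sub>F \<omega>') x vs = (a *\<^sub>F ext_deriv M 2 f \<omega> + b *\<^sub>F ext_deriv M 2 f \<omega>') x vs"
  proof (cases "x \<in> f \<and> set vs \<subseteq> tangent M f x")
    case False
    then have "ext_deriv M 2 f \<theta> x vs = 0" for \<theta> by (simp only: ext_deriv_def if_False)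
    then show ?thesis by (simp add: form_scale_def)
  next
    case True
    define c where "c = (SOME c. slice_chart M 2 f c \<and> x \<in> fst c)"
    define ws where "ws = map (dchart M c x) vs"
    have c: "slice_chart M 2 f c" "x \<in> fst c"
      using someI_ex[of "\<lambda>c. slice_chart M 2 f c \<and> x \<in> fst c"] f True
      unfolding c_def submanifold_def by blast+
    have E: "ext_deriv M 2 f \<theta> x vs = (\<Sum>i<length vs. (-1) ^ i *
           deriv (\<lambda>t. pull M c \<theta> (snd c x + t *\<^sub>R (ws ! i)) (take i ws @ drop (Suc i) ws)) 0)" for \<theta>
      using True by (simp only: ext_deriv_def c_def[symmetric] ws_def[symmetric] simp_thms if_True Let_def)
    \<comment> \<open>Only a one-element list vs leaves the empty list after omitting a vector;
      every other summand is identically 0 for a function.\<close>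
    have z: "pull M c \<theta> y us = 0" if "\<theta> \<in> forms M f 0" "us \<noteq> []" for \<theta> y us
    proof (cases "chart_inv c y \<in> f")
      case True
      then have "\<theta> (chart_inv c y) \<in> covectors (tangent M f (chart_inv c y)) 0" using that by (simp add: forms_def)
      then show ?thesis using covectors_vanish that(2) by (simp add: pull_def)
    qed (use that in \<open>simp add: forms_def pull_def\<close>)
    have fo: "\<omega> \<in> forms M f 0" "\<omega>' \<in> forms M f 0" "a *\<^sub>F \<omega> + b *\<^sub>F \<omega>' \<in> forms M f 0"
      using C1_closed_forms_forms[OF f] \<omega> forms_lin by blast+
    have "deriv (\<lambda>t. pull M c (a *\<^sub>F \<omega> + b *\<^sub>F \<omega>') (snd c x + t *\<^sub>R (ws ! i)) (take i ws @ drop (Suc i) ws)) 0 =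
        a * deriv (\<lambda>t. pull M c \<omega> (snd c x + t *\<^sub>R (ws ! i)) (take i ws @ drop (Suc i) ws)) 0 +
        b * deriv (\<lambda>t. pull M c \<omega>' (snd c x + t *\<^sub>R (ws ! i)) (take i ws @ drop (Suc i) ws)) 0"
      if i: "i < length vs" for i
    proof (cases "take i ws @ drop (Suc i) ws = []")
      case False
      then show ?thesis using z[OF fo(1) False] z[OF fo(2) False] z[OF fo(3) False] by simp
    next
      case True
      obtain D D' where D: "((\<lambda>t. pull M c \<omega> (snd c x + t *\<^sub>R (ws ! i)) []) has_real_derivative D) (at 0)"
          "((\<lambda>t. pull M c \<omega>' (snd c x + t *\<^sub>R (ws ! i)) []) has_real_derivative D') (at 0)"
        using C1_closed_0_derivative[OF c] \<omega> by blast
      have "((\<lambda>t. a * pull M c \<omega> (snd c x + t *\<^sub>R (ws ! i)) [] + b * pull M c \<omega>' (snd c x + t *\<^sub>R (ws ! i)) [])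
          has_real_derivative a * D + b * D') (at 0)"
        by (intro DERIV_add DERIV_cmult D)
      then have "((\<lambda>t. pull M c (a *\<^sub>F \<omega> + b *\<^sub>F \<omega>') (snd c x + t *\<^sub>R (ws ! i)) [])
          has_real_derivative a * D + b * D') (at 0)"
        by (simp add: pull_def form_scale_def)
      then show ?thesis unfolding True using D by (simp add: DERIV_imp_deriv)
    qed
    then show ?thesis
      unfolding E form_lin_apply by (simp add: sum_distrib_left sum.distrib algebra_simps)
  qed
qed

text \<open>Continuity in charts outside the atlas, needed for the slice charts of edges. Near each
  point the coordinate vector w is rewritten in an atlas chart by the differential of the
  transition, which depends continuously on the point.\<close>

lemma pull_continuous_smooth_chart:
  assumes \<eta>: "\<eta> \<in> C1_forms M 1" and c: "smooth_chart M c"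
  shows "continuous_on (snd c ` fst c) (\<lambda>y. pull M c \<eta> y [w])"
proof -
  have ic: "is_chart (points M) c" using c smooth_is_chart by blast
  have "isCont (\<lambda>y. pull M c \<eta> y [w]) (snd c x)" if x: "x \<in> fst c" for x
  proof -
    let ?a = "chart_at M x"
    have xp: "x \<in> points M" using smooth_chart_points[OF c x] .
    have a: "?a \<in> atlas M" "x \<in> fst ?a" "is_chart (points M) ?a"
      using chart_at_in[OF xp] atlas_smooth smooth_is_chart by blast+
    let ?O = "snd c ` (fst c \<inter> fst ?a)"
    let ?t = "transition c ?a"
    let ?D = "\<lambda>y. frechet_derivative ?t (at y) w"
    have op: "open ?O" by (rule chart_image_open[OF ic a(3)])
    have sm: "smooth_on ?t ?O" using c a(1) by (auto simp: smooth_chart_def smooth_compatible_def)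
    have ct: "continuous_on ?O ?t" using smooth_on_Ck[OF sm, of 0] by simp
    have cD: "continuous_on ?O ?D" by (rule smooth_on_derivative_continuous[OF sm])
    have ca: "continuous_on ?O (\<lambda>y. pull M ?a \<eta> (?t y) [axis i 1])" for i
    proof (rule continuous_on_compose2[OF Ck_on_1_continuous[OF C1_formsD(3)[OF \<eta> a(1)]] ct])
      show "?t ` ?O \<subseteq> snd ?a ` fst ?a" using transition_eq[OF ic, of _ ?a] by auto
    qed
    have "continuous_on ?O (\<lambda>y. ?D y $ 1 * pull M ?a \<eta> (?t y) [axis 1 1] + ?D y $ 2 * pull M ?a \<eta> (?t y) [axis 2 1])"
      by (intro continuous_intros cD ca)
    then have "continuous_on ?O (\<lambda>y. pull M c \<eta> y [w])"
    proof (rule continuous_on_eq)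
      fix y assume "y \<in> ?O"
      then obtain z where z: "z \<in> fst c" "z \<in> fst ?a" "y = snd c z" by blast
      have ty: "?t y = snd ?a z" using transition_eq[OF ic z(1)] z(3) by simp
      have cv: "\<eta> z \<in> covectors UNIV 1" using C1_formsD(2)[OF \<eta>] smooth_chart_points[OF c z(1)] by blast
      have p: "pull M c \<eta> y [w] = \<eta> z [dchart_inv M c z w]"
        using is_chartD(5)[OF ic z(1)] z(3) by (simp add: pull_def)
      have q: "pull M ?a \<eta> (?t y) [v] = \<eta> z [dchart_inv M ?a z v]" for v
        using is_chartD(5)[OF a(3) z(2)] ty by (simp add: pull_def)
      have "dchart_inv M c z w = dchart_inv M ?a z (?D y)"
        using dchart_inv_change[OF c z(1) a(1) z(2)] z(3) by simp
      also have "\<dots> = dchart_inv M ?a z ((?D y $ 1) *\<^sub>R axis 1 1 + (?D y $ 2) *\<^sub>R axis 2 1)"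
        using vec2_expand[of "?D y"] by simp
      also have "\<dots> = (?D y $ 1) *\<^sub>R dchart_inv M ?a z (axis 1 1) + (?D y $ 2) *\<^sub>R dchart_inv M ?a z (axis 2 1)"
        using dchart_linear(2)[OF atlas_smooth[OF a(1)] z(2)] by (simp add: linear_add linear_scale)
      finally show "?D y $ 1 * pull M ?a \<eta> (?t y) [axis 1 1] + ?D y $ 2 * pull M ?a \<eta> (?t y) [axis 2 1] = pull M c \<eta> y [w]"
        unfolding p q using covectors_1D[OF cv, of "dchart_inv M ?a z (axis 1 1)" "dchart_inv M ?a z (axis 2 1)"] by simp
    qed
    then show ?thesis using op x a(2) continuous_on_eq_continuous_at by blast
  qed
  then show ?thesis by (auto simp: continuous_on_eq_continuous_at[OF is_chartD(2)[OF ic]])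
qed

end

section \<open>Cells of a mesh\<close>

locale rmesh =
  fixes M :: "('a::t2_space, 'z) mesh_surface_scheme"
  assumes crs': "compact_riemannian_surface M" and mesh: "mesh M"
begin

sublocale rsurface M by unfold_locales (rule crs')

lemma cellD:
  assumes "f \<in> cells M"
  shows "submanifold M (cdim M f) f" "oriented_by_vol M f" "emeasure (cell_measure M f) f < \<infinity>"
    "cdim M f = 2 \<Longrightarrow> vol M f \<in> C1_closed_forms M f 2" "f \<subseteq> points M" "cdim M f \<le> 2"
  using assms mesh unfolding mesh_def submanifold_def by blast+

lemma cell_cell:
  assumes "f \<in> cells M" "cdim M f = 1 \<or> cdim M f = 2"
  shows "cell M f"
proof
  fix x assume x: "x \<in> f"
  have v: "vol M f \<in> forms M f (int (cdim M f))" "cov_inner M f x (vol M f x) (vol M f x) = 1"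
    using cellD(2)[OF assms(1)] x unfolding oriented_by_vol_def by blast+
  show "x \<in> f" by fact
  show "inner_product_on_plane (riem M x)" using metric cellD(5)[OF assms(1)] x by blast
  show "subspace (tangent M f x)" "dim (tangent M f x) = cdim M f"
    using tangent_dim[OF cellD(1)[OF assms(1)] x] by auto
  show "cdim M f = 1 \<or> cdim M f = 2" by fact
  show "vol M f x \<in> covectors (tangent M f x) (int (cdim M f))" using v(1) x by (simp add: forms_def)
  show "cov_inner M f x (vol M f x) (vol M f x) = 1" by fact
qed

lemma faces_2:
  assumes "f \<in> cells M" "cdim M f = 2" "f' \<in> faces M 1 f"
  shows "f' \<in> cells M" "cdim M f' = 1" "f' \<subseteq> closure f" "f' \<subseteq> points M"
  using assms cellD(5) by (auto simp: faces_def cell_boundary_def)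

text \<open>The trace refers to an extension of \<omega> itself, while the polynomial spaces provide
  one of its star. Extending the star and the volume form separately beyond f and contracting them
  gives the required form.\<close>

lemma hodge_inv_C1_closed:
  assumes f: "f \<in> cells M" "cdim M f = 2" and \<omega>: "\<omega> \<in> forms M f 1"
    and h: "hodge M f 1 \<omega> \<in> C1_closed_forms M f 1"
  shows "\<omega> \<in> C1_closed_forms M f 1"
proof -
  interpret cell M f using cell_cell f by blast
  have sf: "submanifold M 2 f" using cellD(1)[OF f(1)] f(2) by simp
  obtain \<eta> \<theta> where e: "\<eta> \<in> C1_forms M 1" "hodge M f 1 \<omega> = restrict_form M f \<eta>"
    "\<theta> \<in> C1_forms M 2" "vol M f = restrict_form M f \<theta>"
    using h cellD(4)[OF f] by (auto simp: C1_closed_forms_def)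
  let ?\<Omega> = "\<lambda>x vs. if x \<in> points M \<and> length vs = 1
      then cov_inner M (points M) x (\<eta> x) (\<lambda>us. \<theta> x (hd vs # us)) else 0"
  have "\<omega> x = restrict_form M f ?\<Omega> x" if x: "x \<in> f" for x
  proof -
    interpret cell_point M f x using pt[OF x] .
    have U: "tangent M f x = UNIV" by (rule tangent_2[OF sf x])
    have hx: "hodge M f 1 \<omega> x = \<eta> x" and vx: "vol M f x = \<theta> x"
      unfolding e by (rule restrict_form_2[OF sf x])+
    have xp: "x \<in> points M" using cellD(5)[OF f(1)] x by blast
    have \<beta>: "hodge M f 1 \<omega> x \<in> covectors UNIV 1" unfolding hx using C1_formsD(2)[OF e(1) xp] .
    from star_rel_middle_surj[OF \<beta> f(2)] obtain \<alpha> where \<alpha>: "\<alpha> \<in> covectors UNIV 1"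
      "star_rel 1 \<alpha> (hodge M f 1 \<omega> x)"
      "\<And>z. \<alpha> [z] = cov_inner M f x (hodge M f 1 \<omega> x) (\<lambda>vs. vol M f x (z # vs))" by blast
    have "\<omega> x = \<alpha>"
      using star_rel_inj[of "\<omega> x" 1 \<alpha> "hodge M f 1 \<omega> x"] hodge_rel[of \<omega> 1 x] forms_at[OF \<omega> x] \<omega> \<alpha>(1,2) x f(2) U
      by simp
    also have "\<alpha> = ?\<Omega> x"
    proof
      fix vs
      show "\<alpha> vs = ?\<Omega> x vs"
      proof (cases "length vs = 1")
        case True
        then obtain z where "vs = [z]" by (auto simp: length_Suc_conv)
        then show ?thesis using \<alpha>(3)[of z] xp cov_inner_2_points[OF sf x] hx vx by simp
      next
        case False
        then show ?thesis using covectors_vanish[OF \<alpha>(1), of vs] by simp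
      qed
    qed
    finally show ?thesis using restrict_form_2[OF sf x] by metis
  qed
  moreover have "\<omega> x = restrict_form M f ?\<Omega> x" if "x \<notin> f" for x
    using that \<omega> by (simp add: forms_def restrict_form_def fun_eq_iff)
  ultimately have "\<omega> = restrict_form M f ?\<Omega>" by blast
  then show ?thesis using C1_contraction[OF e(1,3)] unfolding C1_closed_forms_def by (rule image_eqI)
qed

section \<open>Integrals over cells\<close>

text \<open>A class of integrands on cells of finite measure that is closed under products, as
  integrability alone is not.\<close>

definition cbounded :: "'a set \<Rightarrow> ('a \<Rightarrow> real) \<Rightarrow> bool" where
  "cbounded f u \<longleftrightarrow> continuous_on f u \<and> (\<exists>K. \<forall>x\<in>f. \<bar>u x\<bar> \<le> K)"

lemma cbounded_points: "continuous_on (points M) u \<Longrightarrow> f \<subseteq> points M \<Longrightarrow> cbounded f u"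
  unfolding cbounded_def using continuous_on_subset bounded_on_points by (metis subsetD)

lemma cbounded_cong: "cbounded f u \<Longrightarrow> (\<And>x. x \<in> f \<Longrightarrow> u x = v x) \<Longrightarrow> cbounded f v"
  unfolding cbounded_def using continuous_on_eq by (metis (no_types, lifting))

lemma cbounded_mult:
  assumes "cbounded f u" "cbounded f v"
  shows "cbounded f (\<lambda>x. u x * v x)"
proof -
  obtain K L where "\<forall>x\<in>f. \<bar>u x\<bar> \<le> K" "\<forall>x\<in>f. \<bar>v x\<bar> \<le> L" using assms by (auto simp: cbounded_def)
  then have "\<bar>u x * v x\<bar> \<le> \<bar>K\<bar> * \<bar>L\<bar>" if "x \<in> f" for x
    unfolding abs_mult using that by (intro mult_mono) fastforce+
  then show ?thesis using assms unfolding cbounded_def by (blast intro: continuous_on_mult)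
qed

lemma sets_cell_measure: "sets (cell_measure M f) = sets (restrict_space borel f)"
  and space_cell_measure: "space (cell_measure M f) = f"
proof -
  have sub: "sets (restrict_space borel f) \<subseteq> Pow f"
    using sets.space_closed[of "restrict_space borel f"] by (simp add: space_restrict_space)
  then show "space (cell_measure M f) = f" by (simp add: cell_measure_def)
  have "sigma_sets f (sets (restrict_space borel f)) = sets (restrict_space borel f)"
    using sets.sigma_sets_eq[of "restrict_space borel f"] by (simp add: space_restrict_space)
  then show "sets (cell_measure M f) = sets (restrict_space borel f)"
    using sub by (simp add: cell_measure_def sets_measure_of)
qed

lemma cbounded_integrable:
  assumes "f \<in> cells M" "cbounded f u"
  shows "integrable (cell_measure M f) u"
proof -
  have "finite_measure (cell_measure M f)"
    by (rule finite_measureI) (use cellD(3)[OF assms(1)] in \<open>simp add: space_cell_measure\<close>)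
  then interpret finite_measure "cell_measure M f" .
  obtain K where K: "\<forall>x\<in>f. \<bar>u x\<bar> \<le> K" using assms by (auto simp: cbounded_def)
  have "u \<in> borel_measurable (restrict_space borel f)"
    using assms(2) by (simp add: cbounded_def borel_measurable_continuous_on_restrict)
  then have "u \<in> borel_measurable (cell_measure M f)"
    using measurable_cong_sets[OF sets_cell_measure refl] by blast
  then show ?thesis
    by (intro integrable_const_bound[of _ K]) (use K in \<open>auto intro!: AE_I2 simp: space_cell_measure\<close>)
qed

lemma form_int_wedge:
  assumes "f \<in> cells M" "1 \<le> k" "k \<le> cdim M f"
    "\<omega> \<in> forms M f (int k)" "\<mu> \<in> forms M f (int (cdim M f) - int k)"
  shows "form_int M f (wedge \<omega> \<mu>) = (LINT x|cell_measure M f. cov_inner M f x (hodge M f k \<omega> x) (\<mu> x))"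
proof -
  interpret cell M f using cell_cell[OF assms(1)] cellD(6)[OF assms(1)] assms(2,3) by linarith
  show ?thesis unfolding form_int_def
    by (rule Bochner_Integration.integral_cong)
       (simp_all add: space_cell_measure wedge_density[OF assms(4,5,2,3)])
qed

lemma C1_closed_0_cbounded:
  assumes "f \<in> cells M" "\<omega> \<in> C1_closed_forms M f 0"
  shows "cbounded f (\<lambda>x. \<omega> x [])"
proof -
  obtain \<eta> where \<eta>: "\<eta> \<in> C1_forms M 0" "\<omega> = restrict_form M f \<eta>" using assms(2) by (auto simp: C1_closed_forms_def)
  show ?thesis
    by (rule cbounded_cong[OF cbounded_points[OF C1_forms_0_continuous[OF \<eta>(1)] cellD(5)[OF assms(1)]]])
       (simp add: \<eta>(2) restrict_form_def)
qed

lemma C1_closed_inner_cbounded: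
  assumes "f \<in> cells M" "cdim M f = 2" "l = 0 \<or> l = 1" "\<omega> \<in> C1_closed_forms M f l" "\<mu> \<in> C1_closed_forms M f l"
  shows "cbounded f (\<lambda>x. cov_inner M f x (\<omega> x) (\<mu> x))"
proof -
  have sf: "submanifold M 2 f" using cellD(1)[OF assms(1)] assms(2) by simp
  show ?thesis
  proof (cases "l = 0")
    case True
    have c: "cbounded f (\<lambda>x. \<omega> x [] * \<mu> x [])"
      using assms True by (intro cbounded_mult C1_closed_0_cbounded) auto
    show ?thesis
    proof (rule cbounded_cong[OF c])
      fix x assume "x \<in> f"
      then have "\<omega> x \<in> covectors (tangent M f x) 0"
        using C1_closed_forms_forms[OF sf] assms(4) True by (auto simp: forms_def)
      then show "\<omega> x [] * \<mu> x [] = cov_inner M f x (\<omega> x) (\<mu> x)" by (simp add: cov_inner_0)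
    qed
  next
    case False
    then have l: "l = 1" using assms(3) by simp
    obtain \<eta> \<eta>' where e: "\<eta> \<in> C1_forms M 1" "\<omega> = restrict_form M f \<eta>" "\<eta>' \<in> C1_forms M 1" "\<mu> = restrict_form M f \<eta>'"
      using assms(4,5) l by (auto simp: C1_closed_forms_def)
    show ?thesis
      by (rule cbounded_cong[OF cbounded_points[OF C1_forms_1_inner_continuous[OF e(1,3)] cellD(5)[OF assms(1)]]])
         (simp add: e(2,4) restrict_form_2[OF sf] cov_inner_2_points[OF sf])
  qed
qed

lemma hodge_top:
  assumes "f \<in> cells M" "cdim M f = k" "1 \<le> k" "\<omega> \<in> forms M f (int k)" "x \<in> f"
  shows "hodge M f k \<omega> x = const_cov (cov_inner M f x (\<omega> x) (vol M f x))"
proof -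
  interpret cell M f using cell_cell[OF assms(1)] cellD(6)[OF assms(1)] assms(2,3) by linarith
  interpret cell_point M f x using pt[OF assms(5)] .
  have "star_rel k (\<omega> x) (hodge M f k \<omega> x)" using hodge_rel assms by blast
  moreover have "star_rel k (\<omega> x) (const_cov (cov_inner M f x (\<omega> x) (vol M f x)))"
    using star_rel_top[of "\<omega> x"] assms by (simp add: forms_def)
  ultimately show ?thesis using star_rel_unique assms by blast
qed

text \<open>The volume form of an edge comes with no extension to the end points, so the bound is by
  Cauchy-Schwarz against the norm of a global extension of \<omega>. Continuity holds because the
  density is the quotient of the components of \<omega> and of the volume form along the coordinate
  tangent vector.\<close>

lemma edge_density_cbounded:
  assumes f: "f \<in> cells M" "cdim M f = 1" and \<omega>: "\<omega> \<in> C1_closed_forms M f 1"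
  shows "cbounded f (\<lambda>x. cov_inner M f x (\<omega> x) (vol M f x))" (is "cbounded f ?a")
proof -
  interpret cell M f using cell_cell f by blast
  have sf: "submanifold M 1 f" using cellD(1)[OF f(1)] f(2) by simp
  obtain \<eta> where \<eta>: "\<eta> \<in> C1_forms M 1" "\<omega> = restrict_form M f \<eta>" using \<omega> by (auto simp: C1_closed_forms_def)
  have vol: "vol M f x \<in> covectors (tangent M f x) 1" if "x \<in> f" for x
    using cellD(2)[OF f(1)] f(2) that by (simp add: oriented_by_vol_def forms_def)
  have \<omega>x: "\<omega> x \<in> covectors (tangent M f x) 1" if "x \<in> f" for x
    using C1_closed_forms_forms[OF sf] \<omega> that by (auto simp: forms_def)
  obtain K where K: "\<And>x. x \<in> points M \<Longrightarrow> \<bar>cov_inner M (points M) x (\<eta> x) (\<eta> x)\<bar> \<le> K"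
    using bounded_on_points[OF C1_forms_1_inner_continuous[OF \<eta>(1,1)]] by blast
  have "\<bar>?a x\<bar> \<le> sqrt K" if x: "x \<in> f" for x
  proof -
    interpret cp: cell_point M f x using pt[OF x] .
    have xp: "x \<in> points M" using cellD(5)[OF f(1)] x by blast
    obtain e where e: "onb M f x = [e]" "tangent M f x = span {e}" "riem M x e e = 1"
      "vol M f x [e] * vol M f x [e] = 1" using cp.basis_1[OF f(2)] by metis
    obtain u w where u: "onb M (points M) x = [u, w]" "u \<noteq> w" "\<forall>z. \<exists>p q. z = p *\<^sub>R u + q *\<^sub>R w"
      "riem M x u u = 1" "riem M x u w = 0" "riem M x w u = 0" "riem M x w w = 1"
      using basis_points[OF xp] .
    obtain p q where pq: "e = p *\<^sub>R u + q *\<^sub>R w" using u(3) by blast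
    have g: "p * p + q * q = 1"
    proof -
      have "riem M x e e = p * (p * 1 + q * 0) + q * (p * 0 + q * 1)"
        unfolding pq using u(4-7) by (simp add: inner_product_on_planeD(1,2)[OF cp.metric])
      then show ?thesis using e(3) by simp
    qed
    have cv: "\<eta> x \<in> covectors UNIV 1" using C1_formsD(2)[OF \<eta>(1) xp] .
    have oe: "\<omega> x [e] = \<eta> x [e]" using x e(2) by (simp add: \<eta>(2) restrict_form_def span_base)
    have "?a x * ?a x = (\<omega> x [e] * \<omega> x [e]) * (vol M f x [e] * vol M f x [e])"
      using cov_inner_1_1[OF \<omega>x[OF x] e(1)] by simp
    also have "\<dots> = \<eta> x [e] * \<eta> x [e]" using e(4) oe by simp
    also have "\<dots> = (p * \<eta> x [u] + q * \<eta> x [w]) * (p * \<eta> x [u] + q * \<eta> x [w])"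
      unfolding pq using covectors_1D[OF cv, of u w p q] by simp
    \<comment> \<open>Lagrange's identity; the subtracted square is dropped next.\<close>
    also have "\<dots> = (p * p + q * q) * (\<eta> x [u] * \<eta> x [u] + \<eta> x [w] * \<eta> x [w])
        - (p * \<eta> x [w] - q * \<eta> x [u]) * (p * \<eta> x [w] - q * \<eta> x [u])"
      by (simp add: algebra_simps)
    also have "\<dots> \<le> \<eta> x [u] * \<eta> x [u] + \<eta> x [w] * \<eta> x [w]" unfolding g by simp
    also have "\<dots> = cov_inner M (points M) x (\<eta> x) (\<eta> x)"
      by (rule cov_inner_2_1[OF cv u(1,2), symmetric])
    also have "\<dots> \<le> K" using K[OF xp] by simp
    finally have "(?a x)\<^sup>2 \<le> K" by (simp add: power2_eq_square)
    then show ?thesis by (metis real_sqrt_abs real_sqrt_le_iff)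
  qed
  moreover have "continuous_on f ?a"
  proof (rule continuous_on_charts[OF cellD(5)[OF f(1)]])
    fix x assume "x \<in> f"
    then obtain c where c: "slice_chart M 1 f c" "x \<in> fst c" using sf by (auto simp: submanifold_def)
    have sc: "smooth_chart M c" using c by (simp add: slice_chart_def)
    have ic: "is_chart (points M) c" using sc smooth_is_chart by blast
    let ?S = "snd c ` (fst c \<inter> f)"
    have tk: "take 1 std_basis = [axis 1 1]" by (simp add: std_basis_def)
    \<comment> \<open>On a line the quotient of two covectors is the same at every nonzero vector;
      at the unit vector e the volume is 1 or -1, so dividing by it is multiplying by it.\<close>
    have nz: "pull M c (vol M f) y [axis 1 1] \<noteq> 0 \<and>
        pull M c \<eta> y [axis 1 1] / pull M c (vol M f) y [axis 1 1] = ?a (chart_inv c y)" if y: "y \<in> ?S" for y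
    proof -
      let ?x = "chart_inv c y"
      have x: "?x \<in> f" "?x \<in> fst c" "y \<in> snd c ` fst c"
        using y is_chartD(7)[OF ic] unfolding chart_image_Int[OF ic] by auto
      interpret cp: cell_point M f ?x using pt[OF x(1)] .
      obtain e where e: "onb M f ?x = [e]" "tangent M f ?x = span {e}"
        "vol M f ?x [e] * vol M f ?x [e] = 1" using cp.basis_1[OF f(2)] by metis
      let ?t = "dchart_inv M c ?x (axis 1 1)"
      have T: "?t \<in> tangent M f ?x"
        unfolding tangent_slice[OF c(1) x(2,1)] tk by (intro imageI span_base) simp
      then obtain k where k: "?t = k *\<^sub>R e" using e(2) by (auto simp: span_singleton)
      have "?t \<noteq> 0"
      proof
        assume "?t = 0"
        then have "axis 1 1 = dchart M c ?x 0" using dchart_inverse(1)[OF sc x(2), of "axis 1 1"] by simp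
        then show False using dchart_linear(1)[OF sc x(2)] by (simp add: linear_0)
      qed
      then have k0: "k \<noteq> 0" using k by auto
      have eT: "e \<in> tangent M f ?x" using e(2) by (simp add: span_base)
      have lin: "\<omega> ?x [?t] = k * \<omega> ?x [e]" "vol M f ?x [?t] = k * vol M f ?x [e]"
        unfolding k using covectors_1D[OF \<omega>x[OF x(1)] eT eT, of k 0] covectors_1D[OF vol[OF x(1)] eT eT, of k 0]
        by simp_all
      have "pull M c \<eta> y [axis 1 1] = \<omega> ?x [?t]"
        using T x(1) by (simp add: pull_def \<eta>(2) restrict_form_def)
      moreover have "pull M c (vol M f) y [axis 1 1] = vol M f ?x [?t]" by (simp add: pull_def)
      moreover have "?a ?x = \<omega> ?x [e] * vol M f ?x [e]" by (rule cov_inner_1_1[OF \<omega>x[OF x(1)] e(1)])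
      moreover have ve: "vol M f ?x [e] \<noteq> 0" using e(3) by auto
      moreover have "\<omega> ?x [e] / vol M f ?x [e] = \<omega> ?x [e] * vol M f ?x [e]"
        using ve e(3) by (simp add: divide_eq_eq mult.assoc)
      ultimately show ?thesis using k0 lin by simp
    qed
    have "continuous_on ?S (\<lambda>y. pull M c \<eta> y [axis 1 1])"
      by (rule continuous_on_subset[OF pull_continuous_smooth_chart[OF \<eta>(1) sc]]) blast
    moreover have "continuous_on ?S (\<lambda>y. pull M c (vol M f) y [axis 1 1])"
      using cellD(2)[OF f(1)] c(1) f(2) tk unfolding oriented_by_vol_def by metis
    ultimately have "continuous_on ?S (\<lambda>y. pull M c \<eta> y [axis 1 1] / pull M c (vol M f) y [axis 1 1])"
      using nz by (intro continuous_on_divide) auto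
    then have "continuous_on ?S (\<lambda>y. ?a (chart_inv c y))"
      by (rule continuous_on_eq) (use nz in blast)
    then show "\<exists>c. is_chart (points M) c \<and> x \<in> fst c \<and> continuous_on (snd c ` (fst c \<inter> f)) (\<lambda>y. ?a (chart_inv c y))"
      using ic c(2) by blast
  qed
  ultimately show ?thesis unfolding cbounded_def by blast
qed

text \<open>The relative orientation is constant on components, and the components of a cell are open in it.\<close>

lemma rel_orient_cbounded:
  assumes f': "f' \<in> cells M"
  shows "cbounded f' (rel_orient M f f')"
proof -
  have "continuous_on f' (rel_orient M f f')"
  proof (rule continuous_on_charts[OF cellD(5)[OF f']])
    fix x assume "x \<in> f'"
    then obtain c where c: "slice_chart M (cdim M f') f' c" "x \<in> fst c"
      using cellD(1)[OF f'] by (auto simp: submanifold_def)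
    have sc: "smooth_chart M c" using c by (simp add: slice_chart_def)
    have ic: "is_chart (points M) c" using sc smooth_is_chart by blast
    let ?W = "span (set (take (cdim M f') std_basis))"
    let ?S = "snd c ` (fst c \<inter> f')"
    have S: "?S = snd c ` fst c \<inter> ?W" using c(1) by (simp add: slice_chart_def)
    have "\<exists>\<delta>>0. \<forall>y'\<in>?S. dist y' y < \<delta> \<longrightarrow> rel_orient M f f' (chart_inv c y') = rel_orient M f f' (chart_inv c y)"
      if y: "y \<in> ?S" for y
    proof -
      obtain \<delta> where \<delta>: "\<delta> > 0" "ball y \<delta> \<subseteq> snd c ` fst c"
        using is_chartD(2)[OF ic] y S by (metis IntD1 openE)
      let ?N = "chart_inv c ` (ball y \<delta> \<inter> ?W)"
      have sub: "ball y \<delta> \<inter> ?W \<subseteq> ?S" using \<delta>(2) S by blast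
      \<comment> \<open>A ball cut with a subspace is convex, so its image is a connected
        neighbourhood in the cell and lies in a single component.\<close>
      have "connected (ball y \<delta> \<inter> ?W)"
        by (intro convex_connected convex_Int convex_ball subspace_imp_convex subspace_span)
      then have "connected ?N"
        using \<delta>(2) by (intro connected_continuous_image continuous_on_subset[OF is_chartD(4)[OF ic]]) auto
      moreover have "?N \<subseteq> f'" using sub unfolding chart_image_Int[OF ic] by blast
      ultimately have cc: "connected_component f' a b" if "a \<in> ?N" "b \<in> ?N" for a b
        using that unfolding connected_component_def by blast
      have "rel_orient M f f' (chart_inv c y') = rel_orient M f f' (chart_inv c y)"
        if y': "y' \<in> ?S" "dist y' y < \<delta>" for y'
      proof -
        have "y' \<in> ball y \<delta> \<inter> ?W" "y \<in> ball y \<delta> \<inter> ?W" using y y' S \<delta>(1) by (auto simp: dist_commute)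
        then have "connected_component f' (chart_inv c y') (chart_inv c y)" using cc by blast
        then have "connected_component_set f' (chart_inv c y') = connected_component_set f' (chart_inv c y)"
          using connected_component_eq[of "chart_inv c y" f' "chart_inv c y'"] by simp
        then show ?thesis by (simp add: rel_orient_def)
      qed
      then show ?thesis using \<delta>(1) by blast
    qed
    then have "continuous_on ?S (\<lambda>y. rel_orient M f f' (chart_inv c y))"
      unfolding continuous_on_iff by (metis dist_self)
    then show "\<exists>c. is_chart (points M) c \<and> x \<in> fst c \<and>
        continuous_on (snd c ` (fst c \<inter> f')) (\<lambda>y. rel_orient M f f' (chart_inv c y))"
      using ic c(2) by blast
  qed
  moreover have "\<bar>rel_orient M f f' x\<bar> \<le> 1" for x
    by (simp add: rel_orient_def)
  ultimately show ?thesis unfolding cbounded_def by blast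
qed

end

section \<open>The Riemannian measure charges open sets\<close>

text \<open>U contains a coordinate square around y. With half side e/2 in each of the two
  coordinates, the triangle inequality keeps it within the ball of radius e.\<close>

lemma lebesgue_slice_open_pos:
  fixes U :: "(real^2) set"
  assumes "open U" "y \<in> U"
  shows "emeasure (lebesgue_slice 2) U > 0"
proof -
  let ?P = "Pi\<^sub>M {..<2::nat} (\<lambda>_. lborel :: real measure)"
  let ?T = "\<lambda>t :: nat \<Rightarrow> real. \<Sum>i<2. t i *\<^sub>R (std_basis ! i)"
  obtain e where e: "e > 0" "ball y e \<subseteq> U" using assms openE by blast
  define A where "A = (\<lambda>i::nat. if i = 0 then {y $ 1 - e / 2<..<y $ 1 + e / 2} else {y $ 2 - e / 2<..<y $ 2 + e / 2})"
  interpret product_sigma_finite "\<lambda>_::nat. lborel :: real measure" by standard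
  have "(\<lambda>t. t i) \<in> borel_measurable ?P" if "i \<in> {..<2}" for i
    using measurable_component_singleton[OF that, of "\<lambda>_. lborel"] measurable_cong_sets[OF refl sets_lborel] by blast
  then have T: "?T \<in> measurable ?P borel"
    by (intro borel_measurable_sum borel_measurable_scaleR borel_measurable_const)
  have "?T t = t 0 *\<^sub>R axis 1 1 + t 1 *\<^sub>R axis 2 1" for t
    by (simp add: std_basis_def numeral_2_eq_2)
  then have Ty: "?T t - y = (t 0 - y $ 1) *\<^sub>R axis 1 1 + (t 1 - y $ 2) *\<^sub>R axis 2 1" for t
    using vec2_expand[of y] by (simp add: algebra_simps)
  have "?T t \<in> U" if t: "t \<in> Pi\<^sub>E {..<2} A" for t
  proof -
    have "t 0 \<in> A 0" "t 1 \<in> A 1" using t by (auto simp: PiE_iff)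
    then have "y $ 1 - e / 2 < t 0" "t 0 < y $ 1 + e / 2" "y $ 2 - e / 2 < t 1" "t 1 < y $ 2 + e / 2"
      by (simp_all add: A_def)
    then have "\<bar>t 0 - y $ 1\<bar> < e / 2" "\<bar>t 1 - y $ 2\<bar> < e / 2" by linarith+
    then have "norm (?T t - y) < e"
      unfolding Ty by (intro le_less_trans[OF norm_triangle_ineq]) (simp add: norm_axis_1)
    then show ?thesis using e(2) by (auto simp: dist_norm norm_minus_commute)
  qed
  then have sub: "Pi\<^sub>E {..<2} A \<subseteq> ?T -` U \<inter> space ?P"
    by (auto simp: space_PiM PiE_iff)
  have "emeasure ?P (Pi\<^sub>E {..<2} A) = (\<Prod>i<2. emeasure lborel (A i))"
    by (rule emeasure_PiM) (auto simp: A_def)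
  also have "\<dots> = ennreal e * ennreal e"
    using e(1) by (simp add: A_def numeral_2_eq_2)
  also have "\<dots> > 0" using e(1) by (simp add: ennreal_zero_less_mult_iff)
  finally have "emeasure ?P (Pi\<^sub>E {..<2} A) > 0" .
  also have "emeasure ?P (Pi\<^sub>E {..<2} A) \<le> emeasure ?P (?T -` U \<inter> space ?P)"
    by (rule emeasure_mono[OF sub]) (use T assms(1) in \<open>auto intro: measurable_sets\<close>)
  also have "\<dots> = emeasure (lebesgue_slice 2) U"
    unfolding lebesgue_slice_def using T assms(1) by (subst emeasure_distr) auto
  finally show ?thesis .
qed

lemma sets_lebesgue_slice [simp]: "sets (lebesgue_slice d) = sets borel"
  by (simp add: lebesgue_slice_def)

text \<open>The outer sum is an integral against counting measure, and a nonnegative series may be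
  taken out of an integral.\<close>

lemma suminf_swap_ennreal:
  fixes a :: "nat \<Rightarrow> nat \<Rightarrow> ennreal"
  shows "(\<Sum>i. \<Sum>j. a i j) = (\<Sum>j. \<Sum>i. a i j)"
proof -
  have "(\<Sum>i. \<Sum>j. a i j) = (\<integral>\<^sup>+i. (\<Sum>j. a i j) \<partial>count_space UNIV)"
    by (simp add: nn_integral_count_space_nat)
  also have "\<dots> = (\<Sum>j. \<integral>\<^sup>+i. a i j \<partial>count_space UNIV)"
    by (rule nn_integral_suminf) simp
  finally show ?thesis by (simp add: nn_integral_count_space_nat)
qed

context rmesh begin

text \<open>Pads the family of charts in \<open>cell_charts\<close>, so that it can be enumerated
  even when the cell is empty.\<close>

lemma empty_slice_chart: "slice_chart M d f ({}, \<lambda>_. 0)"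
proof -
  have "Ck_on k g {}" for k and g :: "real^2 \<Rightarrow> real^2"
    by (induction k arbitrary: g) (simp_all add: differentiable_on_def)
  then show ?thesis
    by (simp add: slice_chart_def smooth_chart_def is_chart_def smooth_compatible_def smooth_on_def
        homeomorphism_def)
qed

text \<open>Cells are second countable, being covered by finitely many charts; hence Lindelof.\<close>

lemma cell_charts:
  assumes f: "f \<in> cells M"
  shows "slice_chart M (cdim M f) f (cell_charts M f i)" "f \<subseteq> (\<Union>i. fst (cell_charts M f i))"
proof -
  let ?d = "cdim M f"
  have "\<forall>c\<in>atlas M. \<exists>U. open U \<and> fst c = points M \<inter> U"
    using is_chartD(8) smooth_is_chart atlas_smooth by blast
  then obtain U where U: "\<And>c. c \<in> atlas M \<Longrightarrow> open (U c)" "\<And>c. c \<in> atlas M \<Longrightarrow> fst c = points M \<inter> U c"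
    by metis
  have "compact (points M)" "points M \<subseteq> (\<Union>c\<in>atlas M. U c)"
    using crs' U(2) unfolding compact_riemannian_surface_def by blast+
  then obtain C where C: "C \<subseteq> atlas M" "finite C" "points M \<subseteq> (\<Union>c\<in>C. U c)"
    using compactE_image[of "points M" "atlas M" U] U(1) by metis
  have "\<exists>S. countable S \<and> (\<forall>s\<in>S. slice_chart M ?d f s) \<and> f \<inter> fst c \<subseteq> (\<Union>s\<in>S. fst s)" if c: "c \<in> C" for c
  proof -
    have ic: "is_chart (points M) c" using c C(1) smooth_is_chart atlas_smooth by blast
    let ?S = "{s. slice_chart M ?d f s}"
    \<comment> \<open>Lindelof is applied to these images, which are open in the plane, because no
      countability is assumed of the type \<open>'a\<close> itself.\<close>
    let ?V = "\<lambda>s. snd c ` (fst c \<inter> fst s)"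
    have "open V" if "V \<in> ?V ` ?S" for V
      using that chart_image_open[OF ic] smooth_is_chart by (auto simp: slice_chart_def)
    then obtain F where F: "F \<subseteq> ?V ` ?S" "countable F" "\<Union>F = \<Union>(?V ` ?S)"
      by (rule Lindelof)
    then obtain S where S: "S \<subseteq> ?S" "countable S" "F = ?V ` S"
      using countable_subset_image[of F ?V ?S] by blast
    have "f \<inter> fst c \<subseteq> (\<Union>s\<in>S. fst s)"
    proof
      fix x assume x: "x \<in> f \<inter> fst c"
      then obtain s where "slice_chart M ?d f s" "x \<in> fst s"
        using cellD(1)[OF f] by (auto simp: submanifold_def)
      then have "snd c x \<in> \<Union>(?V ` ?S)" using x by blast
      then have "snd c x \<in> (\<Union>s\<in>S. ?V s)" using F(3) S(3) by simp
      then obtain s where s: "s \<in> S" "snd c x \<in> ?V s" by (rule UN_E)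
      then have "x \<in> fst s" using is_chartD(5)[OF ic] x unfolding chart_image_Int[OF ic] by simp
      then show "x \<in> (\<Union>s\<in>S. fst s)" using s by blast
    qed
    then show ?thesis using S by blast
  qed
  then obtain S where S: "\<And>c. c \<in> C \<Longrightarrow> countable (S c)" "\<And>c s. c \<in> C \<Longrightarrow> s \<in> S c \<Longrightarrow> slice_chart M ?d f s"
    "\<And>c. c \<in> C \<Longrightarrow> f \<inter> fst c \<subseteq> (\<Union>s\<in>S c. fst s)" by metis
  define R where "R = insert ({}, \<lambda>_. 0) (\<Union>c\<in>C. S c)"
  have R: "countable R" "R \<noteq> {}" using S(1) C(2) by (auto simp: R_def countable_finite)
  have "slice_chart M ?d f s" if "s \<in> R" for s
    using that S(2) empty_slice_chart unfolding R_def by blast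
  moreover have "f \<subseteq> (\<Union>s\<in>R. fst s)"
  proof
    fix x assume x: "x \<in> f"
    then obtain c where c: "c \<in> C" "x \<in> U c" using C(3) cellD(5)[OF f] by blast
    then have "x \<in> f \<inter> fst c" using x U(2) C(1) cellD(5)[OF f] by blast
    then show "x \<in> (\<Union>s\<in>R. fst s)" using S(3)[OF c(1)] c(1) unfolding R_def by blast
  qed
  moreover have "(\<Union>s\<in>range (from_nat_into R). fst s) = (\<Union>i. fst (from_nat_into R i))" by blast
  ultimately have "(\<forall>i. slice_chart M ?d f (from_nat_into R i)) \<and> f \<subseteq> (\<Union>i. fst (from_nat_into R i))"
    using from_nat_into[OF R(2)] range_from_nat_into[OF R(2,1)] by simp
  then have "(\<forall>i. slice_chart M ?d f (cell_charts M f i)) \<and> f \<subseteq> (\<Union>i. fst (cell_charts M f i))"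
    unfolding cell_charts_def
    by (rule someI[of "\<lambda>c. (\<forall>i. slice_chart M ?d f (c i)) \<and> f \<subseteq> (\<Union>i. fst (c i))"])
  then show "slice_chart M ?d f (cell_charts M f i)" "f \<subseteq> (\<Union>i. fst (cell_charts M f i))" by blast+
qed

definition chart_density :: "'a set \<Rightarrow> nat \<Rightarrow> real^2 \<Rightarrow> ennreal" where
  "chart_density f i y = ennreal \<bar>pull M (cell_charts M f i) (vol M f) y (take (cdim M f) std_basis)\<bar>"

definition piece_image :: "'a set \<Rightarrow> nat \<Rightarrow> 'a set \<Rightarrow> (real^2) set" where
  "piece_image f i B = snd (cell_charts M f i) ` (B \<inter> cell_piece M f i)"

text \<open>The image of B is Borel as a preimage under the continuous inverse chart. The density is
  known to be continuous on the chart image of the cell only, hence the extra indicator in the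
  proof.\<close>

lemma piece_image_sets:
  assumes f: "f \<in> cells M" and B: "B \<in> sets (restrict_space borel f)"
  shows "piece_image f i B \<in> sets borel"
    and "(\<lambda>y. chart_density f i y * indicator (piece_image f i B) y) \<in> borel_measurable borel"
proof -
  let ?c = "cell_charts M f"
  let ?W = "span (set (take (cdim M f) std_basis))"
  let ?R = "snd (?c i) ` (fst (?c i) \<inter> f)"
  have sl: "slice_chart M (cdim M f) f (?c j)" for j by (rule cell_charts(1)[OF f])
  then have ic: "is_chart (points M) (?c j)" for j using smooth_is_chart by (auto simp: slice_chart_def)
  have "?R = snd (?c i) ` fst (?c i) \<inter> ?W" using sl[of i] by (simp add: slice_chart_def)
  then have R: "?R \<in> sets borel"
    using is_chartD(2)[OF ic] by (simp add: borel_open borel_closed closed_subspace)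
  have "\<forall>j. \<exists>U. open U \<and> fst (?c j) = points M \<inter> U" using is_chartD(8)[OF ic] by blast
  then obtain U where U: "\<And>j. open (U j)" "\<And>j. fst (?c j) = points M \<inter> U j" by metis
  obtain B' where B': "B' \<in> sets borel" "B = B' \<inter> f" using B by (auto simp: sets_restrict_space)
  let ?Q = "B' \<inter> U i - (\<Union>j<i. U j)"
  have Q: "?Q \<in> sets borel" by (intro sets.Diff sets.Int sets.finite_UN borel_open U(1) B'(1)) auto
  have "B \<inter> cell_piece M f i = (fst (?c i) \<inter> f) \<inter> ?Q"
    using cellD(5)[OF f] by (auto simp: cell_piece_def B'(2) U(2))
  then have "piece_image f i B = {y \<in> ?R. chart_inv (?c i) y \<in> ?Q}"
    unfolding piece_image_def using is_chartD(5)[OF ic] by force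
  also have "\<dots> = chart_inv (?c i) -` ?Q \<inter> space (restrict_space borel ?R)" 
    by (auto simp: space_restrict_space)
  also have "\<dots> \<in> sets (restrict_space borel ?R)"
  proof (rule measurable_sets[OF _ Q])
    show "chart_inv (?c i) \<in> borel_measurable (restrict_space borel ?R)"
      by (intro borel_measurable_continuous_on_restrict continuous_on_subset[OF is_chartD(4)[OF ic]]) blast
  qed
  finally show P: "piece_image f i B \<in> sets borel"
    using R by (auto simp: sets_restrict_space)
  have "continuous_on ?R (\<lambda>y. pull M (?c i) (vol M f) y (take (cdim M f) std_basis))"
    using cellD(2)[OF f] sl unfolding oriented_by_vol_def by blast
  from borel_measurable_continuous_on_indicator[OF R this]
  have "(\<lambda>y. ennreal \<bar>indicator ?R y *\<^sub>R pull M (?c i) (vol M f) y (take (cdim M f) std_basis)\<bar> * indicator (piece_image f i B) y)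
      \<in> borel_measurable borel"
    using P by measurable
  also have "(\<lambda>y. ennreal \<bar>indicator ?R y *\<^sub>R pull M (?c i) (vol M f) y (take (cdim M f) std_basis)\<bar> * indicator (piece_image f i B) y)
      = (\<lambda>y. chart_density f i y * indicator (piece_image f i B) y)"
  proof
    fix y
    have "y \<in> ?R" if "y \<in> piece_image f i B" using that by (auto simp: piece_image_def cell_piece_def)
    then show "ennreal \<bar>indicator ?R y *\<^sub>R pull M (?c i) (vol M f) y (take (cdim M f) std_basis)\<bar> * indicator (piece_image f i B) y
        = chart_density f i y * indicator (piece_image f i B) y"
      by (cases "y \<in> piece_image f i B") (simp_all add: chart_density_def)
  qed
  finally show "(\<lambda>y. chart_density f i y * indicator (piece_image f i B) y) \<in> borel_measurable borel" .
qed

text \<open>\<open>measure_of\<close> yields the given values only for a countably additive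
  function. Additivity holds piece by piece, since charts are injective and so keep disjoint sets
  disjoint; the two series are then interchanged.\<close>

lemma emeasure_cell_measure:
  assumes f: "f \<in> cells M" and B: "B \<in> sets (restrict_space borel f)"
  shows "emeasure (cell_measure M f) B =
    (\<Sum>i. \<integral>\<^sup>+ y. chart_density f i y * indicator (piece_image f i B) y \<partial>lebesgue_slice (cdim M f))"
proof -
  let ?L = "lebesgue_slice (cdim M f)"
  let ?m = "\<lambda>B. \<Sum>i. \<integral>\<^sup>+ y. chart_density f i y * indicator (piece_image f i B) y \<partial>?L"
  have cm: "cell_measure M f = measure_of f (sets (restrict_space borel f)) ?m"
    by (simp add: cell_measure_def chart_density_def piece_image_def)
  have "countably_additive (sets (restrict_space borel f)) ?m"
    unfolding countably_additive_def
  proof (intro allI impI)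
    fix A :: "nat \<Rightarrow> 'a set"
    assume A: "range A \<subseteq> sets (restrict_space borel f)" "disjoint_family A"
    have An: "A n \<in> sets (restrict_space borel f)" for n using A(1) by blast
    have mL: "(\<lambda>y. chart_density f i y * indicator (piece_image f i (A n)) y) \<in> borel_measurable ?L" for i n
      using piece_image_sets(2)[OF f An] measurable_cong_sets[OF sets_lebesgue_slice refl] by blast
    have ind: "(\<Sum>n. indicator (piece_image f i (A n)) y :: ennreal) = indicator (piece_image f i (\<Union>(range A))) y" for i y
    proof -
      have ic: "is_chart (points M) (cell_charts M f i)"
        using cell_charts(1)[OF f, of i] smooth_is_chart by (auto simp: slice_chart_def)
      have "inj_on (snd (cell_charts M f i)) (cell_piece M f i)"
        by (rule inj_on_inverseI[of _ "chart_inv (cell_charts M f i)"])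
           (simp add: cell_piece_def is_chartD(5)[OF ic])
      then have "piece_image f i (A m) \<inter> piece_image f i (A n) =
          snd (cell_charts M f i) ` ((A m \<inter> cell_piece M f i) \<inter> (A n \<inter> cell_piece M f i))" for m n
        unfolding piece_image_def by (intro inj_on_image_Int[symmetric]) auto
      moreover have "(A m \<inter> cell_piece M f i) \<inter> (A n \<inter> cell_piece M f i) = {}" if "m \<noteq> n" for m n
        using A(2) that unfolding disjoint_family_on_def by blast
      ultimately have "disjoint_family (\<lambda>n. piece_image f i (A n))"
        unfolding disjoint_family_on_def by simp
      then have "(\<Sum>n. indicator (piece_image f i (A n)) y :: ennreal) = indicator (\<Union>n. piece_image f i (A n)) y"
        by (rule suminf_indicator)
      also have "(\<Union>n. piece_image f i (A n)) = piece_image f i (\<Union>(range A))"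
        by (auto simp: piece_image_def)
      finally show ?thesis .
    qed
    have "(\<Sum>n. ?m (A n)) = (\<Sum>i. \<Sum>n. \<integral>\<^sup>+ y. chart_density f i y * indicator (piece_image f i (A n)) y \<partial>?L)"
      by (rule suminf_swap_ennreal)
    also have "\<dots> = (\<Sum>i. \<integral>\<^sup>+ y. (\<Sum>n. chart_density f i y * indicator (piece_image f i (A n)) y) \<partial>?L)"
      by (subst nn_integral_suminf[OF mL]) simp
    also have "\<dots> = ?m (\<Union>(range A))"
      by (simp add: ennreal_suminf_cmult ind)
    finally show "(\<Sum>n. ?m (A n)) = ?m (\<Union>(range A))" .
  qed
  moreover have "positive (sets (restrict_space borel f)) ?m"
    by (simp add: positive_def piece_image_def)
  moreover have "sets (cell_measure M f) = sets (restrict_space borel f)" by (rule sets_cell_measure)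
  moreover have "sets (restrict_space borel f) \<subseteq> Pow f"
    using sets.space_closed[of "restrict_space borel f"] by (simp add: space_restrict_space)
  ultimately show ?thesis
    using emeasure_measure_of[OF cm] B by simp
qed

text \<open>The volume form is 1 or -1 on an orthonormal basis, hence nonzero on every basis, in
  particular on the coordinate one.\<close>

lemma chart_density_nonzero:
  assumes f: "f \<in> cells M" "cdim M f = 2" and y: "y \<in> piece_image f i B"
  shows "chart_density f i y \<noteq> 0"
proof -
  let ?c = "cell_charts M f i"
  interpret cell M f using cell_cell f by blast
  obtain x where x: "x \<in> f" "x \<in> fst ?c" "y = snd ?c x"
    using y by (auto simp: piece_image_def cell_piece_def)
  have sc: "smooth_chart M ?c" using cell_charts(1)[OF f(1)] by (auto simp: slice_chart_def)
  have ci: "chart_inv ?c y = x" using is_chartD(5)[OF smooth_is_chart[OF sc] x(2)] x(3) by simp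
  interpret cp: cell_point M f x using pt[OF x(1)] .
  obtain u w where u: "onb M f x = [u, w]" "tangent M f x = UNIV" "vol M f x [u, w] * vol M f x [u, w] = 1"
    using cp.basis_2[OF f(2)] by metis
  have vc: "vol M f x \<in> covectors UNIV 2" using cp.vol u(2) f(2) by simp
  let ?b1 = "dchart_inv M ?c x (axis 1 1)" and ?b2 = "dchart_inv M ?c x (axis 2 1)"
  have ex: "\<exists>p q. z = p *\<^sub>R ?b1 + q *\<^sub>R ?b2" for z
  proof -
    define a where "a = dchart M ?c x z"
    have "z = dchart_inv M ?c x a" using dchart_inverse(2)[OF sc x(2)] by (simp add: a_def)
    also have "\<dots> = dchart_inv M ?c x ((a $ 1) *\<^sub>R axis 1 1 + (a $ 2) *\<^sub>R axis 2 1)"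
      using vec2_expand[of a] by simp
    also have "\<dots> = (a $ 1) *\<^sub>R ?b1 + (a $ 2) *\<^sub>R ?b2"
      using dchart_linear(2)[OF sc x(2)] by (simp add: linear_add linear_scale)
    finally show ?thesis by blast
  qed
  obtain p q r s where pq: "u = p *\<^sub>R ?b1 + q *\<^sub>R ?b2" "w = r *\<^sub>R ?b1 + s *\<^sub>R ?b2" using ex by metis
  have "vol M f x [u, w] = (p * s - q * r) * vol M f x [?b1, ?b2]"
    unfolding pq using covectors_2_expand[OF vc] by simp
  then have "vol M f x [?b1, ?b2] \<noteq> 0" using u(3) by auto
  then show ?thesis
    by (simp add: chart_density_def pull_def ci f(2) std_basis_def)
qed

text \<open>The set where u does not vanish is a null set and relatively open. If it were nonempty,
  its image in some chart would be a nonempty open subset of the plane, of positive measure and with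
  nonvanishing density.\<close>

lemma integral_zero_imp_zero:
  assumes f: "f \<in> cells M" "cdim M f = 2" and u: "cbounded f u" "\<And>x. x \<in> f \<Longrightarrow> u x \<ge> 0"
    and zero: "(LINT x|cell_measure M f. u x) = 0" and x: "x \<in> f"
  shows "u x = 0"
proof (rule ccontr)
  assume "u x \<noteq> 0"
  let ?N = "cell_measure M f"
  let ?c = "cell_charts M f"
  let ?V = "{z \<in> f. u z \<noteq> 0}"
  have xV: "x \<in> ?V" using x \<open>u x \<noteq> 0\<close> by simp
  have "u \<in> borel_measurable (restrict_space borel f)"
    using u(1) by (simp add: cbounded_def borel_measurable_continuous_on_restrict)
  then have "u -` (- {0}) \<inter> space (restrict_space borel f) \<in> sets (restrict_space borel f)"
    by (rule measurable_sets) simp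
  then have V: "?V \<in> sets (restrict_space borel f)"
    by (simp add: space_restrict_space vimage_def Int_def conj_commute)
  have "AE z in ?N. 0 \<le> u z"
    by (rule AE_I2) (use u(2) in \<open>simp add: space_cell_measure\<close>)
  then have "AE z in ?N. u z = 0"
    using integral_nonneg_eq_0_iff_AE[OF cbounded_integrable[OF f(1) u(1)]] zero by blast
  then have "emeasure ?N ?V = 0"
    using V by (subst (asm) AE_iff_measurable[of ?V]) (auto simp: space_cell_measure sets_cell_measure)
  then have S0: "(\<Sum>i. \<integral>\<^sup>+ y. chart_density f i y * indicator (piece_image f i ?V) y \<partial>lebesgue_slice 2) = 0"
    using emeasure_cell_measure[OF f(1) V] f(2) by simp
  have "\<exists>i. ?V \<inter> fst (?c i) \<noteq> {}" using cell_charts(2)[OF f(1)] xV by blast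
  \<comment> \<open>For the first chart that meets the set, the domains of earlier charts take
    nothing away from it, so its piece is all of its part in the chart and has an open
    image.\<close>
  define i where "i = (LEAST i. ?V \<inter> fst (?c i) \<noteq> {})"
  have i: "?V \<inter> fst (?c i) \<noteq> {}" "\<And>j. j < i \<Longrightarrow> ?V \<inter> fst (?c j) = {}"
    unfolding i_def using LeastI_ex[OF \<open>\<exists>i. ?V \<inter> fst (?c i) \<noteq> {}\<close>] not_less_Least by blast+
  then have Vi: "?V \<inter> cell_piece M f i = ?V \<inter> fst (?c i)"
    by (auto simp: cell_piece_def)
  have sc: "slice_chart M 2 f (?c i)" using cell_charts(1)[OF f(1), of i] f(2) by simp
  have ic: "is_chart (points M) (?c i)" using sc smooth_is_chart by (auto simp: slice_chart_def)
  have full: "snd (?c i) ` (fst (?c i) \<inter> f) = snd (?c i) ` fst (?c i)"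
    using sc unfolding slice_chart_def span_std_basis by simp
  let ?I = "piece_image f i ?V"
  have I: "?I = snd (?c i) ` fst (?c i) \<inter> (\<lambda>y. u (chart_inv (?c i) y)) -` (- {0})"
  proof -
    have "?I = {y \<in> snd (?c i) ` fst (?c i). chart_inv (?c i) y \<in> ?V}"
      unfolding piece_image_def Vi using chart_image_Int[OF ic, of ?V] by (simp add: Int_commute)
    also have "\<dots> = snd (?c i) ` fst (?c i) \<inter> (\<lambda>y. u (chart_inv (?c i) y)) -` (- {0})"
      using full unfolding chart_image_Int[OF ic] by blast
    finally show ?thesis .
  qed
  have "continuous_on (snd (?c i) ` fst (?c i)) (\<lambda>y. u (chart_inv (?c i) y))"
  proof (rule continuous_on_compose2[OF _ is_chartD(4)[OF ic]])
    show "continuous_on f u" using u(1) by (simp add: cbounded_def)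
    show "chart_inv (?c i) ` snd (?c i) ` fst (?c i) \<subseteq> f"
      using full unfolding chart_image_Int[OF ic] by blast
  qed
  then have "open ?I" unfolding I
    by (rule continuous_open_preimage[OF _ is_chartD(2)[OF ic]]) (simp add: open_Compl)
  moreover obtain y where "y \<in> ?I" using i(1) Vi unfolding piece_image_def by blast
  ultimately have pos: "emeasure (lebesgue_slice 2) ?I > 0" by (rule lebesgue_slice_open_pos)
  have "(\<integral>\<^sup>+ y. chart_density f i y * indicator ?I y \<partial>lebesgue_slice 2) = 0"
    using S0 sum_le_suminf[OF summableI, of "{i}" "\<lambda>i. \<integral>\<^sup>+ y. chart_density f i y * indicator (piece_image f i ?V) y \<partial>lebesgue_slice 2"]
    by simp
  moreover have "(\<lambda>y. chart_density f i y * indicator ?I y) \<in> borel_measurable (lebesgue_slice 2)"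
    using piece_image_sets(2)[OF f(1) V] measurable_cong_sets[OF sets_lebesgue_slice refl] by blast
  ultimately have "AE y in lebesgue_slice 2. chart_density f i y * indicator ?I y = 0"
    by (simp add: nn_integral_0_iff_AE)
  then have "AE y in lebesgue_slice 2. y \<notin> ?I"
    by eventually_elim (use chart_density_nonzero[OF f] in \<open>auto simp: indicator_def split: if_splits\<close>)
  then have "emeasure (lebesgue_slice 2) ?I = 0"
    using AE_iff_null_sets[of ?I "lebesgue_slice 2"] piece_image_sets(1)[OF f(1) V] by auto
  then show False using pos by simp
qed

end

section \<open>Finite-dimensional spaces of forms\<close>

lemma form_scale_zero [simp]: "0 *\<^sub>F \<omega> = 0" "a *\<^sub>F 0 = 0"
  by (simp_all add: form_scale_def fun_eq_iff)

lemma form_diff_lin: "\<omega> - \<omega>' = 1 *\<^sub>F \<omega> + (-1) *\<^sub>F \<omega>'"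
  by (simp add: form_scale_def fun_eq_iff)

lemma form_lin_zero: "0 *\<^sub>F \<omega> + 0 *\<^sub>F \<omega>' = 0"
  by simp

text \<open>Subspaces of forms, phrased for combinations of two terms, which is how linearity of the
  operators is stated here.\<close>

definition lin_closed :: "'a form set \<Rightarrow> bool" where
  "lin_closed S \<longleftrightarrow> 0 \<in> S \<and> (\<forall>p\<in>S. \<forall>q\<in>S. \<forall>a b. a *\<^sub>F p + b *\<^sub>F q \<in> S)"

lemma lin_closedD:
  "lin_closed S \<Longrightarrow> p \<in> S \<Longrightarrow> q \<in> S \<Longrightarrow> a *\<^sub>F p + b *\<^sub>F q \<in> S"
  "lin_closed S \<Longrightarrow> 0 \<in> S"
  "lin_closed S \<Longrightarrow> p \<in> S \<Longrightarrow> a *\<^sub>F p \<in> S"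
proof -
  show "lin_closed S \<Longrightarrow> p \<in> S \<Longrightarrow> q \<in> S \<Longrightarrow> a *\<^sub>F p + b *\<^sub>F q \<in> S" "lin_closed S \<Longrightarrow> 0 \<in> S"
    by (auto simp: lin_closed_def)
  assume "lin_closed S" "p \<in> S"
  then have "a *\<^sub>F p + 0 *\<^sub>F p \<in> S" by (simp only: lin_closed_def)
  then show "a *\<^sub>F p \<in> S" by simp
qed

lemma lin_closed_span: "lin_closed (form.span B)"
  unfolding lin_closed_def by (blast intro: form.span_zero form.span_add form.span_scale)

lemma subspace_lin_closed: "lin_closed S \<Longrightarrow> form.subspace S"
proof (rule form.subspaceI)
  assume S: "lin_closed S"
  show "0 \<in> S" by (rule lin_closedD(2)[OF S])
  show "p + q \<in> S" if "p \<in> S" "q \<in> S" for p q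
    using lin_closedD(1)[OF S that, of 1 1] by (simp only: form.scale_one)
  show "a *\<^sub>F p \<in> S" if "p \<in> S" for p a by (rule lin_closedD(3)[OF S that])
qed

text \<open>The Koszul map and the exterior derivative are known to be linear on suitable spaces of
  forms only, so linearity is assumed on S alone.\<close>

lemma lin_closed_sum:
  assumes S: "lin_closed S" and g: "\<And>p q a b. p \<in> S \<Longrightarrow> q \<in> S \<Longrightarrow> g (a *\<^sub>F p + b *\<^sub>F q) = a *\<^sub>F g p + b *\<^sub>F (g q :: 'b form)"
    and A: "finite A" "\<And>s. s \<in> A \<Longrightarrow> h s \<in> S"
  shows "(\<Sum>s\<in>A. c s *\<^sub>F h s) \<in> S" "g (\<Sum>s\<in>A. c s *\<^sub>F h s) = (\<Sum>s\<in>A. c s *\<^sub>F g (h s))"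
proof -
  have "(\<Sum>s\<in>A. c s *\<^sub>F h s) \<in> S \<and> g (\<Sum>s\<in>A. c s *\<^sub>F h s) = (\<Sum>s\<in>A. c s *\<^sub>F g (h s))"
    using A
  proof (induction A)
    case empty
    have "g 0 = 0" using g[of 0 0 0 0] lin_closedD(2)[OF S] by simp
    then show ?case using lin_closedD(2)[OF S] by (simp only: sum.empty simp_thms)
  next
    case (insert x A)
    then have IH: "(\<Sum>s\<in>A. c s *\<^sub>F h s) \<in> S" "g (\<Sum>s\<in>A. c s *\<^sub>F h s) = (\<Sum>s\<in>A. c s *\<^sub>F g (h s))" "h x \<in> S"
      by blast+
    show ?case
      using g[OF IH(3,1), of "c x" 1] lin_closedD(1)[OF S IH(3,1), of "c x" 1] IH(2)
      by (simp only: sum.insert[OF insert(1,2)] form.scale_one simp_thms)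
  qed
  then show "(\<Sum>s\<in>A. c s *\<^sub>F h s) \<in> S" "g (\<Sum>s\<in>A. c s *\<^sub>F h s) = (\<Sum>s\<in>A. c s *\<^sub>F g (h s))" by blast+
qed

text \<open>Gram-Schmidt on a spanning set: the induction hypothesis, used for the functional of x
  itself, projects x on the span of C, and the residual e corrects the representative found for
  \<Phi>. For this \<Phi> is generalised, while the conditions on \<open>b\<close> stay on the fixed
  larger space S.\<close>

lemma riesz_span:
  fixes b :: "'a form \<Rightarrow> 'a form \<Rightarrow> real"
  assumes S: "lin_closed S" and C: "finite C" "C \<subseteq> S"
    and lin: "\<And>p q s a c. p \<in> S \<Longrightarrow> q \<in> S \<Longrightarrow> s \<in> S \<Longrightarrow> b (a *\<^sub>F p + c *\<^sub>F q) s = a * b p s + c * b q s"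
    and sym: "\<And>p q. p \<in> S \<Longrightarrow> q \<in> S \<Longrightarrow> b p q = b q p"
    and pos: "\<And>p. p \<in> S \<Longrightarrow> b p p = 0 \<Longrightarrow> p = 0"
    and \<Phi>: "\<And>p q a c. p \<in> S \<Longrightarrow> q \<in> S \<Longrightarrow> \<Phi> (a *\<^sub>F p + c *\<^sub>F q) = a * \<Phi> p + c * \<Phi> q"
  shows "\<exists>h\<in>form.span C. \<forall>s\<in>form.span C. b h s = (\<Phi> s :: real)"
  using C \<Phi>
proof (induction C arbitrary: \<Phi>)
  case empty
  have Z: "0 \<in> S" by (rule lin_closedD(2)[OF S])
  \<comment> \<open>Combinations with zero coefficients are the form in which linearity gives the
    values at 0.\<close>
  have "b (0 *\<^sub>F 0 + 0 *\<^sub>F 0) 0 = 0"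
    unfolding lin[OF Z Z Z] by (simp only: mult_zero_left add_0)
  moreover have "\<Phi> (0 *\<^sub>F 0 + 0 *\<^sub>F 0) = 0"
    unfolding empty.prems(2)[OF Z Z] by (simp only: mult_zero_left add_0)
  ultimately have eq: "b 0 0 = \<Phi> 0" by (simp only: form_lin_zero)
  show ?case
  proof (rule bexI[of _ 0])
    show "\<forall>s\<in>form.span {}. b 0 s = \<Phi> s"
    proof
      fix s :: "'a form" assume "s \<in> form.span {}"
      then have "s = 0" by (simp only: form.span_empty singleton_iff)
      then show "b 0 s = \<Phi> s" using eq by (simp only:)
    qed
    show "0 \<in> form.span {}" by (rule form.span_zero)
  qed
next
  case (insert x C)
  have sS: "form.span C \<subseteq> S"
    using form.span_minimal[OF _ subspace_lin_closed[OF S]] insert.prems(1) by blast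
  have xS: "x \<in> S" using insert.prems(1) by blast
  have lin2: "b s (a *\<^sub>F p + c *\<^sub>F q) = a * b s p + c * b s q" if "p \<in> S" "q \<in> S" "s \<in> S" for p q s a c
    using lin[OF that] sym that lin_closedD(1)[OF S that(1,2)] by metis
  obtain q where q: "q \<in> form.span C" "\<And>s. s \<in> form.span C \<Longrightarrow> b q s = b x s"
    using insert.IH[of "b x"] insert.prems(1) lin2 xS by (metis insert_subset)
  obtain h0 where h0: "h0 \<in> form.span C" "\<And>s. s \<in> form.span C \<Longrightarrow> b h0 s = \<Phi> s"
    using insert.IH[of \<Phi>] insert.prems by (metis insert_subset)
  define e where "e = 1 *\<^sub>F x + (-1) *\<^sub>F q"
  have qS: "q \<in> S" and h0S: "h0 \<in> S" using q h0 sS by blast+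
  have eS: "e \<in> S" unfolding e_def by (rule lin_closedD(1)[OF S xS qS])
  have xe: "x = e + q" by (simp add: e_def form_scale_def fun_eq_iff)
  have eo: "b e s = 0" if "s \<in> form.span C" for s
  proof -
    have "b e s = 1 * b x s + (-1) * b q s" unfolding e_def by (rule lin[OF xS qS]) (use that sS in blast)
    then show ?thesis using q(2)[OF that] by simp
  qed
  show ?case
  proof (cases "b e e = 0")
    case True
    \<comment> \<open>By definiteness the residual vanishes, so x adds nothing to the span.\<close>
    then have "x \<in> form.span C" using pos[OF eS] xe q(1) by simp
    then show ?thesis using h0 by (metis form.span_redundant)
  next
    case False
    \<comment> \<open>Chosen so that the corrected h has the value \<Phi> e against e; as e is
      orthogonal to the span of C, the other values are unchanged.\<close>
    define c where "c = \<Phi> e / b e e"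
    define h where "h = 1 *\<^sub>F h0 + c *\<^sub>F e"
    have "b h s = \<Phi> s" if s: "s \<in> form.span (insert x C)" for s
    proof -
      obtain k where k: "s - k *\<^sub>F x \<in> form.span C" using s form.span_breakdown_eq by metis
      define t where "t = 1 *\<^sub>F (s - k *\<^sub>F x) + k *\<^sub>F q"
      have t: "t \<in> form.span C" unfolding t_def by (rule lin_closedD(1)[OF lin_closed_span k q(1)])
      have tS: "t \<in> S" using t sS by blast
      have st: "s = 1 *\<^sub>F t + k *\<^sub>F e"
        unfolding t_def e_def by (simp add: form_scale_def fun_eq_iff algebra_simps)
      have hS: "h \<in> S" unfolding h_def by (rule lin_closedD(1)[OF S h0S eS])
      have "b h t = 1 * b h0 t + c * b e t" unfolding h_def by (rule lin[OF h0S eS tS])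
      then have "b h t = \<Phi> t" using h0(2)[OF t] eo[OF t] by simp
      moreover have "b h e = 1 * b h0 e + c * b e e" unfolding h_def by (rule lin[OF h0S eS eS])
      then have "b h e = \<Phi> e" using eo[OF h0(1)] sym[OF h0S eS] False by (simp add: c_def)
      moreover have "b h s = 1 * b h t + k * b h e" unfolding st by (rule lin2[OF tS eS hS])
      moreover have "\<Phi> s = 1 * \<Phi> t + k * \<Phi> e" unfolding st by (rule insert.prems(2)[OF tS eS])
      ultimately show ?thesis by simp
    qed
    moreover have "h \<in> form.span (insert x C)"
    proof -
      have mono: "form.span C \<subseteq> form.span (insert x C)" by (rule form.span_mono) blast
      then have "e \<in> form.span (insert x C)"
        unfolding e_def using q(1) by (intro lin_closedD(1)[OF lin_closed_span]) (auto intro: form.span_base)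
      then show ?thesis unfolding h_def using h0(1) mono by (intro lin_closedD(1)[OF lin_closed_span]) auto
    qed
    ultimately show ?thesis by blast
  qed
qed

lemma riesz:
  fixes b :: "'a form \<Rightarrow> 'a form \<Rightarrow> real"
  assumes B: "finite B" "S = form.span B"
    and lin: "\<And>p q s a c. p \<in> S \<Longrightarrow> q \<in> S \<Longrightarrow> s \<in> S \<Longrightarrow> b (a *\<^sub>F p + c *\<^sub>F q) s = a * b p s + c * b q s"
    and sym: "\<And>p q. p \<in> S \<Longrightarrow> q \<in> S \<Longrightarrow> b p q = b q p"
    and pos: "\<And>p. p \<in> S \<Longrightarrow> b p p = 0 \<Longrightarrow> p = 0"
    and \<Phi>: "\<And>p q a c. p \<in> S \<Longrightarrow> q \<in> S \<Longrightarrow> \<Phi> (a *\<^sub>F p + c *\<^sub>F q) = a * \<Phi> p + c * \<Phi> q"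
  shows "\<exists>h\<in>S. \<forall>s\<in>S. b h s = (\<Phi> s :: real)"
proof -
  have S: "lin_closed S" unfolding B(2) by (rule lin_closed_span)
  have BS: "B \<subseteq> S" unfolding B(2) by (rule form.span_superset)
  show ?thesis using riesz_span[OF S B(1) BS lin sym pos \<Phi>] unfolding B(2)[symmetric] by blast
qed

context rmesh begin

section \<open>Inner products and integrals on cells\<close>

definition ip :: "'a set \<Rightarrow> 'a form \<Rightarrow> 'a form \<Rightarrow> real" where
  "ip f p q = (LINT x|cell_measure M f. cov_inner M f x (p x) (q x))"

lemma ip_sym: "ip f p q = ip f q p"
  unfolding ip_def by (subst cov_inner_sym) (rule refl)

lemma LINT_lin:
  assumes "f \<in> cells M" "cbounded f u" "cbounded f v"
  shows "(LINT x|cell_measure M f. a * u x + b * v x) = a * (LINT x|cell_measure M f. u x) + b * (LINT x|cell_measure M f. v x)"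
  using cbounded_integrable[OF assms(1,2)] cbounded_integrable[OF assms(1,3)] by simp

lemma ip_lin:
  assumes "f \<in> cells M" "cdim M f = 2" "l = 0 \<or> l = 1"
    "p \<in> C1_closed_forms M f l" "q \<in> C1_closed_forms M f l" "s \<in> C1_closed_forms M f l"
  shows "ip f (a *\<^sub>F p + b *\<^sub>F q) s = a * ip f p s + b * ip f q s"
  unfolding ip_def form_lin_at cov_inner_lin
  by (rule LINT_lin[OF assms(1)]) (intro C1_closed_inner_cbounded[OF assms(1-3)] assms)+

lemma ip_lin_right:
  assumes "f \<in> cells M" "cdim M f = 2" "l = 0 \<or> l = 1"
    "p \<in> C1_closed_forms M f l" "q \<in> C1_closed_forms M f l" "s \<in> C1_closed_forms M f l"
  shows "ip f s (a *\<^sub>F p + b *\<^sub>F q) = a * ip f s p + b * ip f s q"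
  using ip_lin[OF assms] ip_sym by metis

lemma ip_definite:
  assumes f: "f \<in> cells M" "cdim M f = 2" and l: "l = 0 \<or> l = 1"
    and p: "p \<in> C1_closed_forms M f l" and z: "ip f p p = 0"
  shows "p = 0"
proof -
  interpret cell M f using cell_cell f by blast
  have pf: "p \<in> forms M f l" using C1_closed_forms_forms[OF cellD(1)[OF f(1)]] p by blast
  have "p x = 0" if x: "x \<in> f" for x
  proof -
    interpret cp: cell_point M f x using pt[OF x] .
    have "cov_inner M f x (p x) (p x) = 0"
    proof (rule integral_zero_imp_zero[OF f C1_closed_inner_cbounded[OF f l p p] _ _ x])
      show "0 \<le> cov_inner M f z (p z) (p z)" if "z \<in> f" for z
        by (rule cell_point.cov_inner_nonneg[OF pt[OF that]])
      show "(LINT z|cell_measure M f. cov_inner M f z (p z) (p z)) = 0" using z by (simp only: ip_def)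
    qed
    \<comment> \<open>Writes the degree as 2 - k, the form in which definiteness at a point is
      stated.\<close>
    moreover have "\<exists>k::nat. l = int 2 - int k \<and> 1 \<le> k \<and> k \<le> 2"
      using l by (elim disjE) (auto intro: exI[of _ 2] exI[of _ 1])
    then obtain k :: nat where "l = int 2 - int k" "1 \<le> k" "k \<le> 2" by blast
    ultimately show ?thesis using cp.cov_inner_definite[of "p x" k] forms_at[OF pf x] f(2) by simp
  qed
  then show ?thesis using pf by (auto simp: forms_def fun_eq_iff)
qed

lemma C1_closed_lin_closed: "lin_closed (C1_closed_forms M f l)"
proof -
  have "Ck_on 1 (\<lambda>y. pull M c 0 y ws) (snd c ` fst c)" if "c \<in> atlas M" for c ws
    using Ck_on_1_const[OF atlas_open[OF that], of "0::real"] by (simp add: pull_def)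
  then have "0 \<in> C1_forms M l" by (intro C1_formsI) auto
  moreover have "restrict_form M f 0 = 0" by (simp add: restrict_form_def fun_eq_iff)
  ultimately have "0 \<in> C1_closed_forms M f l" unfolding C1_closed_forms_def by (metis image_eqI)
  then show ?thesis unfolding lin_closed_def using C1_closed_forms_lin by blast
qed

text \<open>Riesz yields the star of \<eta>, and the star is a bijection. Both the local derivative
  (k = 2) and the potential (k = 1) are instances.\<close>

lemma hodge_riesz:
  assumes f: "f \<in> cells M" "cdim M f = 2" and k: "k = 1 \<or> k = 2"
    and S: "finite B" "S = form.span B" "S \<subseteq> C1_closed_forms M f (2 - int k)"
    and \<Phi>: "\<And>p q a c. p \<in> S \<Longrightarrow> q \<in> S \<Longrightarrow> \<Phi> (a *\<^sub>F p + c *\<^sub>F q) = a * \<Phi> p + c * \<Phi> q"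
  shows "\<exists>!\<eta>. \<eta> \<in> hodge_inv_space M f k S \<and> (\<forall>\<mu>\<in>S. form_int M f (wedge \<eta> \<mu>) = \<Phi> \<mu>)"
proof -
  interpret cell M f using cell_cell f by blast
  have l: "2 - int k = 0 \<or> 2 - int k = 1" and k1: "1 \<le> k" "k \<le> cdim M f" using k f(2) by auto
  have Sf: "S \<subseteq> forms M f (int (cdim M f) - int k)"
    using S(3) C1_closed_forms_forms[OF cellD(1)[OF f(1)]] f(2) by fastforce
  have Sl: "lin_closed S" unfolding S(2) by (rule lin_closed_span)
  note lin = ip_lin[OF f l] and def = ip_definite[OF f l]
  have "\<exists>h\<in>S. \<forall>s\<in>S. ip f h s = \<Phi> s"
  proof (rule riesz[OF S(1,2)])
    show "ip f (a *\<^sub>F p + c *\<^sub>F q) s = a * ip f p s + c * ip f q s" if "p \<in> S" "q \<in> S" "s \<in> S" for p q s a c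
      by (rule lin) (use that S(3) in blast)+
    show "p = 0" if "p \<in> S" "ip f p p = 0" for p using def that S(3) by blast
  qed (use ip_sym \<Phi> in blast)+
  then obtain h where h: "h \<in> S" "\<And>s. s \<in> S \<Longrightarrow> ip f h s = \<Phi> s" by blast
  have fi: "form_int M f (wedge \<eta> \<mu>) = ip f (hodge M f k \<eta>) \<mu>" if "\<eta> \<in> forms M f (int k)" "\<mu> \<in> S" for \<eta> \<mu>
    unfolding ip_def using form_int_wedge[OF f(1) k1 that(1)] that(2) Sf by blast
  obtain \<eta> where \<eta>: "\<eta> \<in> forms M f (int k)" "hodge M f k \<eta> = h"
    using hodge_surj[OF _ k1] h(1) Sf by blast
  show ?thesis
  proof (rule ex1I[of _ \<eta>])
    show "\<eta> \<in> hodge_inv_space M f k S \<and> (\<forall>\<mu>\<in>S. form_int M f (wedge \<eta> \<mu>) = \<Phi> \<mu>)"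
      using \<eta> h fi by (simp add: hodge_inv_space_def)
  next
    fix \<eta>' assume *: "\<eta>' \<in> hodge_inv_space M f k S \<and> (\<forall>\<mu>\<in>S. form_int M f (wedge \<eta>' \<mu>) = \<Phi> \<mu>)"
    then have \<eta>': "\<eta>' \<in> forms M f (int k)" "hodge M f k \<eta>' \<in> S" by (auto simp: hodge_inv_space_def)
    define d where "d = 1 *\<^sub>F hodge M f k \<eta>' + (-1) *\<^sub>F h"
    have d: "d \<in> S" unfolding d_def by (rule lin_closedD(1)[OF Sl \<eta>'(2) h(1)])
    have SC: "p \<in> C1_closed_forms M f (2 - int k)" if "p \<in> S" for p using that S(3) by blast
    have "ip f d d = 1 * ip f (hodge M f k \<eta>') d + (-1) * ip f h d"
      using lin[OF SC[OF \<eta>'(2)] SC[OF h(1)] SC[OF d], of 1 "-1"] by (simp only: d_def[symmetric])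
    also have "\<dots> = 0" using fi[OF \<eta>'(1) d] * d h(2)[OF d] by auto
    finally have "d = 0" using def d S(3) by blast
    then have "hodge M f k \<eta>' = h" unfolding d_def by (simp add: form_scale_def fun_eq_iff)
    then show "\<eta>' = \<eta>" using hodge_inj[OF \<eta>'(1) \<eta>(1) k1] \<eta>(2) by simp
  qed
qed

text \<open>Contains both the edge components of discrete \<open>1\<close>-forms and the traces of their potentials.\<close>

definition edge_forms :: "'a set \<Rightarrow> 'a form set" where
  "edge_forms f' = {\<delta> \<in> forms M f' 1. cbounded f' (\<lambda>x. hodge M f' 1 \<delta> x [])}"

lemma edge_forms_C1_closed:
  assumes "f' \<in> cells M" "cdim M f' = 1" "\<omega> \<in> C1_closed_forms M f' 1"
  shows "\<omega> \<in> edge_forms f'"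
proof -
  have \<omega>: "\<omega> \<in> forms M f' 1" using C1_closed_forms_forms[OF cellD(1)[OF assms(1)]] assms(3) by blast
  have "hodge M f' 1 \<omega> x [] = cov_inner M f' x (\<omega> x) (vol M f' x)" if "x \<in> f'" for x
    using hodge_top[OF assms(1,2) _ _ that, of \<omega>] \<omega> by (simp add: const_cov_def)
  then have "cbounded f' (\<lambda>x. hodge M f' 1 \<omega> x [])"
    using cbounded_cong[OF edge_density_cbounded[OF assms]] by presburger
  with \<omega> show ?thesis by (simp add: edge_forms_def)
qed

lemma cbounded_lin:
  assumes "cbounded f u" "cbounded f v"
  shows "cbounded f (\<lambda>x. a * u x + b * v x)"
proof -
  obtain K L where KL: "\<forall>x\<in>f. \<bar>u x\<bar> \<le> K" "\<forall>x\<in>f. \<bar>v x\<bar> \<le> L" using assms by (auto simp: cbounded_def)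
  have "\<bar>a * u x + b * v x\<bar> \<le> \<bar>a\<bar> * K + \<bar>b\<bar> * L" if "x \<in> f" for x
  proof -
    have "\<bar>a * u x + b * v x\<bar> \<le> \<bar>a\<bar> * \<bar>u x\<bar> + \<bar>b\<bar> * \<bar>v x\<bar>"
      using abs_triangle_ineq[of "a * u x" "b * v x"] by (simp add: abs_mult)
    also have "\<dots> \<le> \<bar>a\<bar> * K + \<bar>b\<bar> * L"
      using KL that by (intro add_mono mult_left_mono) auto
    finally show ?thesis .
  qed
  moreover have "continuous_on f (\<lambda>x. a * u x + b * v x)"
    using assms unfolding cbounded_def by (intro continuous_intros) auto
  ultimately show ?thesis unfolding cbounded_def by blast
qed

lemma edge_hodge_lin:
  assumes "f' \<in> cells M" "cdim M f' = 1" "\<omega> \<in> forms M f' 1" "\<omega>' \<in> forms M f' 1"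
  shows "hodge M f' 1 (a *\<^sub>F \<omega> + b *\<^sub>F \<omega>') = a *\<^sub>F hodge M f' 1 \<omega> + b *\<^sub>F hodge M f' 1 \<omega>'"
proof -
  interpret cell M f' using cell_cell assms by blast
  show ?thesis using hodge_lin[of \<omega> 1 \<omega>'] assms by simp
qed

lemma edge_forms_lin:
  assumes "f' \<in> cells M" "cdim M f' = 1" "\<omega> \<in> edge_forms f'" "\<omega>' \<in> edge_forms f'"
  shows "a *\<^sub>F \<omega> + b *\<^sub>F \<omega>' \<in> edge_forms f'"
proof -
  have w: "\<omega> \<in> forms M f' 1" "\<omega>' \<in> forms M f' 1" using assms(3,4) by (auto simp: edge_forms_def)
  have "cbounded f' (\<lambda>x. a * hodge M f' 1 \<omega> x [] + b * hodge M f' 1 \<omega>' x [])"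
    by (rule cbounded_lin) (use assms(3,4) in \<open>auto simp: edge_forms_def\<close>)
  then have "cbounded f' (\<lambda>x. hodge M f' 1 (a *\<^sub>F \<omega> + b *\<^sub>F \<omega>') x [])"
    unfolding edge_hodge_lin[OF assms(1,2) w] form_lin_apply .
  then show ?thesis using forms_lin[OF w] unfolding edge_forms_def by blast
qed

text \<open>On an edge the star of a 1-form is a function, and the density of the wedge becomes a
  product of functions. The weight g stands for the relative orientation.\<close>

lemma edge_form_int:
  assumes f': "f' \<in> cells M" "cdim M f' = 1" and \<omega>: "\<omega> \<in> forms M f' 1" and \<mu>: "\<mu> \<in> forms M f' 0"
  shows "form_int M f' (wedge \<omega> \<mu>) = (LINT x|cell_measure M f'. hodge M f' 1 \<omega> x [] * \<mu> x [])"
    and "form_int M f' (\<lambda>x vs. g x * wedge \<omega> \<mu> x vs) =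
      (LINT x|cell_measure M f'. g x * (hodge M f' 1 \<omega> x [] * \<mu> x []))"
proof -
  interpret cell M f' using cell_cell f' by blast
  have d: "cov_inner M f' x (wedge \<omega> \<mu> x) (vol M f' x) = hodge M f' 1 \<omega> x [] * \<mu> x []" if x: "x \<in> f'" for x
  proof -
    have "cov_inner M f' x (wedge \<omega> \<mu> x) (vol M f' x) = cov_inner M f' x (hodge M f' 1 \<omega> x) (\<mu> x)"
      using wedge_density[of \<omega> 1 \<mu> x] assms x by simp
    also have "\<dots> = hodge M f' 1 \<omega> x [] * \<mu> x []"
      using cov_inner_0[of "hodge M f' 1 \<omega> x" "tangent M f' x"] forms_at[OF hodge_forms[of \<omega> 1] x] \<omega> f' by simp
    finally show ?thesis .
  qed
  show "form_int M f' (wedge \<omega> \<mu>) = (LINT x|cell_measure M f'. hodge M f' 1 \<omega> x [] * \<mu> x [])"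
    unfolding form_int_def by (rule Bochner_Integration.integral_cong) (simp_all add: space_cell_measure d)
  show "form_int M f' (\<lambda>x vs. g x * wedge \<omega> \<mu> x vs) =
      (LINT x|cell_measure M f'. g x * (hodge M f' 1 \<omega> x [] * \<mu> x []))"
    unfolding form_int_def by (rule Bochner_Integration.integral_cong)
      (simp_all add: space_cell_measure d cov_inner_scale)
qed

definition edge_ip :: "'a set \<Rightarrow> 'a form \<Rightarrow> 'a form \<Rightarrow> real" where
  "edge_ip f' \<delta> \<delta>' = form_int M f' (wedge \<delta> (hodge M f' 1 \<delta>'))"

lemma edge_ip:
  assumes f': "f' \<in> cells M" "cdim M f' = 1" and \<delta>: "\<delta> \<in> edge_forms f'" "\<delta>' \<in> edge_forms f'"
  shows "edge_ip f' \<delta> \<delta>' = (LINT x|cell_measure M f'. hodge M f' 1 \<delta> x [] * hodge M f' 1 \<delta>' x [])"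
proof -
  interpret cell M f' using cell_cell f' by blast
  show ?thesis unfolding edge_ip_def
    using edge_form_int(1)[OF f', of \<delta> "hodge M f' 1 \<delta>'"] hodge_forms[of \<delta>' 1] \<delta> f' by (simp add: edge_forms_def)
qed

lemma edge_ip_sym:
  assumes "f' \<in> cells M" "cdim M f' = 1" "\<delta> \<in> edge_forms f'" "\<delta>' \<in> edge_forms f'"
  shows "edge_ip f' \<delta> \<delta>' = edge_ip f' \<delta>' \<delta>"
  using edge_ip[OF assms(1,2)] assms(3,4) by (simp add: mult.commute)

lemma edge_ip_lin:
  assumes f': "f' \<in> cells M" "cdim M f' = 1"
    and "p \<in> edge_forms f'" "q \<in> edge_forms f'" "s \<in> edge_forms f'"
  shows "edge_ip f' (a *\<^sub>F p + b *\<^sub>F q) s = a * edge_ip f' p s + b * edge_ip f' q s"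
proof -
  have "edge_ip f' (a *\<^sub>F p + b *\<^sub>F q) s = (LINT x|cell_measure M f'.
      a * (hodge M f' 1 p x [] * hodge M f' 1 s x []) + b * (hodge M f' 1 q x [] * hodge M f' 1 s x []))"
    unfolding edge_ip[OF f' edge_forms_lin[OF f' assms(3,4)] assms(5)]
    using edge_hodge_lin[OF f', of p q] assms(3,4)
    by (simp add: edge_forms_def form_scale_def algebra_simps)
  also have "\<dots> = a * edge_ip f' p s + b * edge_ip f' q s"
    unfolding edge_ip[OF f' assms(3,5)] edge_ip[OF f' assms(4,5)]
    by (rule LINT_lin[OF f'(1)]) (use assms in \<open>auto simp: edge_forms_def intro!: cbounded_mult\<close>)
  finally show ?thesis .
qed

end

section \<open>The discrete complex on a surface\<close>

locale disc =
  fixes M :: "('a::t2_space, 'z) poly_mesh_scheme" and r :: int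
  assumes crs'': "compact_riemannian_surface M" and mesh': "mesh M"
    and poly: "poly_spaces M" and H: "hypothesis_H M" and r: "r \<ge> 0"
begin

sublocale rmesh M by unfold_locales (rule crs'', rule mesh')

lemma polyD:
  assumes "f \<in> cells M"
  shows "\<exists>B. finite B \<and> poly_forms M f s l = form.span B"
    "poly_forms M f s l \<subseteq> C1_closed_forms M f l"
    "p \<in> poly_forms M f s l \<Longrightarrow> cell_d M f p \<in> poly_forms M f (s - 1) (l + 1)"
    "p \<in> poly_forms M f s l \<Longrightarrow> koszul M f p \<in> poly_forms M f (s + 1) (l - 1)"
    "p \<in> poly_forms M f s l \<Longrightarrow> koszul M f (koszul M f p) = 0"
    "lin_closed (poly_forms M f s l)"
    "p \<in> poly_forms M f s l \<Longrightarrow> q \<in> poly_forms M f s l \<Longrightarrow>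
      koszul M f (a *\<^sub>F p + b *\<^sub>F q) = a *\<^sub>F koszul M f p + b *\<^sub>F koszul M f q"
proof -
  have P: "(\<exists>B. finite B \<and> poly_forms M f s l = form.span B) \<and>
     poly_forms M f s l \<subseteq> C1_closed_forms M f l \<and>
     cell_d M f ` poly_forms M f s l \<subseteq> poly_forms M f (s - 1) (l + 1) \<and>
     koszul M f ` poly_forms M f s l \<subseteq> poly_forms M f (s + 1) (l - 1) \<and>
     (\<forall>p\<in>poly_forms M f s l. \<forall>q\<in>poly_forms M f s l. koszul M f (p + q) = koszul M f p + koszul M f q) \<and>
     (\<forall>a. \<forall>p\<in>poly_forms M f s l. koszul M f (a *\<^sub>F p) = a *\<^sub>F koszul M f p) \<and>
     (\<forall>p\<in>poly_forms M f s l. koszul M f (koszul M f p) = 0)" for s l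
    using poly assms unfolding poly_spaces_def by blast
  show "\<exists>B. finite B \<and> poly_forms M f s l = form.span B"
    "poly_forms M f s l \<subseteq> C1_closed_forms M f l"
    "p \<in> poly_forms M f s l \<Longrightarrow> cell_d M f p \<in> poly_forms M f (s - 1) (l + 1)"
    "p \<in> poly_forms M f s l \<Longrightarrow> koszul M f p \<in> poly_forms M f (s + 1) (l - 1)"
    "p \<in> poly_forms M f s l \<Longrightarrow> koszul M f (koszul M f p) = 0"
    using P[of s l] by blast+
  show L: "lin_closed (poly_forms M f s l)" using P[of s l] lin_closed_span by metis
  show "koszul M f (a *\<^sub>F p + b *\<^sub>F q) = a *\<^sub>F koszul M f p + b *\<^sub>F koszul M f q"
    if "p \<in> poly_forms M f s l" "q \<in> poly_forms M f s l"
    using P[of s l] lin_closedD(3)[OF L that(1), of a] lin_closedD(3)[OF L that(2), of b] that by metis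
qed

lemma cell_d_lin:
  assumes "f \<in> cells M" "cdim M f = 2" "p \<in> C1_closed_forms M f 0" "q \<in> C1_closed_forms M f 0"
  shows "cell_d M f (a *\<^sub>F p + b *\<^sub>F q) = a *\<^sub>F cell_d M f p + b *\<^sub>F cell_d M f q"
  using ext_deriv_lin[OF _ assms(3,4)] cellD(1)[OF assms(1)] assms(2) by simp

text \<open>No list has negative length. This makes \<kappa> vanish on functions.\<close>

lemma negative_degree:
  assumes "f \<in> cells M" "p \<in> C1_closed_forms M f l" "l < 0"
  shows "p = 0"
proof -
  have "p \<in> forms M f l" using assms C1_closed_forms_forms[OF cellD(1)[OF assms(1)]] by blast
  then have p: "x \<in> f \<Longrightarrow> p x \<in> covectors (tangent M f x) l" "x \<notin> f \<Longrightarrow> p x = 0" for x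
    by (simp_all add: forms_def)
  have "p x vs = 0" for x vs
  proof (cases "x \<in> f")
    case True
    show ?thesis by (rule covectors_vanish[OF p(1)[OF True]]) (use assms(3) in linarith)
  qed (use p(2) in simp)
  then show ?thesis by (simp add: fun_eq_iff)
qed

section \<open>Consequences of the homotopy formula for polynomial forms\<close>

lemma homogeneous_decompositionD:
  assumes "homogeneous_decomposition M f G"
  shows "form.subspace (G s l)"
    "poly_forms M f n l = {\<Sum>s\<in>{0..n}. h s | h. \<forall>s. h s \<in> G s l}"
    "(\<And>s. h s \<in> G s l) \<Longrightarrow> (\<Sum>s\<in>{0..n}. h s) = 0 \<Longrightarrow> s \<in> {0..n} \<Longrightarrow> h s = 0"
proof -
  note * = assms[unfolded homogeneous_decomposition_def]
  note ** = *[THEN conjunct2, THEN conjunct2, THEN spec, THEN spec, of n l]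
  show "form.subspace (G s l)" by (rule *[THEN conjunct1, THEN spec, THEN spec])
  show "poly_forms M f n l = {\<Sum>s\<in>{0..n}. h s | h. \<forall>s. h s \<in> G s l}" by (rule **[THEN conjunct1])
  show "(\<And>s. h s \<in> G s l) \<Longrightarrow> (\<Sum>s\<in>{0..n}. h s) = 0 \<Longrightarrow> s \<in> {0..n} \<Longrightarrow> h s = 0"
    using **[THEN conjunct2, THEN spec, of h] by blast
qed

lemma H_sum_mem:
  assumes "homogeneous_decomposition M f G" "\<And>s. h s \<in> G s l"
  shows "(\<Sum>s\<in>{0..n}. h s) \<in> poly_forms M f n l"
  unfolding homogeneous_decompositionD(2)[OF assms(1)] using assms(2) by blast

lemma H_sum_exists:
  assumes "homogeneous_decomposition M f G" "p \<in> poly_forms M f n l"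
  shows "\<exists>h. p = (\<Sum>s\<in>{0..n}. h s) \<and> (\<forall>s. h s \<in> G s l)"
  using assms(2) unfolding homogeneous_decompositionD(2)[OF assms(1)] by blast

text \<open>In degree 1 the exception (0, 0) does not occur, so every eigenvalue of nonnegative
  index can be divided by.\<close>

lemma hypothesis_HD:
  assumes "f \<in> cells M" "cdim M f = 2"
  shows "\<exists>G (lam :: int \<Rightarrow> int \<Rightarrow> real). homogeneous_decomposition M f G \<and>
    (\<forall>s l. \<forall>p\<in>G s l. cell_d M f (koszul M f p) + koszul M f (cell_d M f p) = lam s l *\<^sub>F p) \<and>
    (\<forall>s\<ge>0. lam s 1 \<noteq> 0)"
proof -
  obtain G and lam :: "int \<Rightarrow> int \<Rightarrow> real" where G: "homogeneous_decomposition M f G"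
    "\<forall>s l. \<forall>p\<in>G s l. cell_d M f (koszul M f p) + koszul M f (cell_d M f p) = lam s l *\<^sub>F p"
    "cdim M f > 0 \<longrightarrow>
        (\<forall>l\<in>{0..int (cdim M f)}. \<forall>s\<ge>0. \<forall>s'\<ge>0. lam s l = lam s' l \<longrightarrow> s = s') \<and>
        (\<forall>l\<in>{0..int (cdim M f)}. \<forall>s\<ge>0. lam s l = 0 \<longleftrightarrow> (s, l) = (0, 0))"
    using H[unfolded hypothesis_H_def, THEN bspec, OF assms(1)] by (elim exE conjE) (rule that)
  have "\<forall>l\<in>{0..int (cdim M f)}. \<forall>s\<ge>0. lam s l = 0 \<longleftrightarrow> (s, l) = (0, 0)"
    using G(3) assms(2) by simp
  then have "\<forall>s\<ge>0. lam s 1 \<noteq> 0" using assms(2) by simp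
  with G(1,2) show ?thesis by blast
qed

lemma H_mem:
  assumes "homogeneous_decomposition M f H" "h \<in> H s l" "0 \<le> s" "s \<le> n"
  shows "h \<in> poly_forms M f n l"
proof -
  have sub: "0 \<in> H t l" for t
    by (rule form.subspace_0[OF homogeneous_decompositionD(1)[OF assms(1)]])
  have "(\<Sum>t\<in>{0..n}. if t = s then h else 0) \<in> poly_forms M f n l"
    by (rule H_sum_mem[OF assms(1)]) (use sub assms(2) in auto)
  moreover have "(\<Sum>t\<in>{0..n}. if t = s then h else 0) = h"
    using assms(3,4) by (subst sum.delta) auto
  ultimately show ?thesis by (simp only:)
qed

text \<open>
  With \<open>q = \<Sum> h\<^sub>s / \<lambda>\<^sub>s\<close> for the decomposition \<open>\<sigma> = \<Sum> h\<^sub>s\<close>, the homotopy formula gives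
  \<open>\<sigma> = d(\<kappa> q) + \<kappa>(d q)\<close>.
\<close>

lemma poly_1_split:
  assumes f: "f \<in> cells M" "cdim M f = 2" and \<sigma>: "\<sigma> \<in> poly_forms M f n 1"
  shows "\<exists>q\<in>poly_forms M f n 1. \<exists>q'\<in>poly_forms M f (n - 1) 2.
    \<sigma> = cell_d M f (koszul M f q) + koszul M f q'"
proof -
  obtain G and lam :: "int \<Rightarrow> int \<Rightarrow> real" where G: "homogeneous_decomposition M f G"
    "\<forall>s l. \<forall>p\<in>G s l. cell_d M f (koszul M f p) + koszul M f (cell_d M f p) = lam s l *\<^sub>F p"
    "\<forall>s\<ge>0. lam s 1 \<noteq> 0"
    using hypothesis_HD[OF f] by blast
  obtain h where h': "\<sigma> = (\<Sum>s\<in>{0..n}. h s)" "\<forall>s. h s \<in> G s 1"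
    using H_sum_exists[OF G(1) \<sigma>] by blast
  then have h: "\<sigma> = (\<Sum>s\<in>{0..n}. h s)" "\<And>s. h s \<in> G s 1" by blast+
  let ?c = "\<lambda>s. 1 / lam s 1"
  have hp: "h s \<in> poly_forms M f n 1" if "s \<in> {0..n}" for s
    using H_mem[OF G(1) h(2)] that by simp
  have kh: "koszul M f (h s) \<in> C1_closed_forms M f 0" if "s \<in> {0..n}" for s
    using polyD(4)[OF f(1) hp[OF that]] polyD(2)[OF f(1)] by force
  have dh: "cell_d M f (h s) \<in> poly_forms M f (n - 1) 2" if "s \<in> {0..n}" for s
    using polyD(3)[OF f(1) hp[OF that]] by simp
  define q where "q = (\<Sum>s\<in>{0..n}. ?c s *\<^sub>F h s)"
  define q' where "q' = (\<Sum>s\<in>{0..n}. ?c s *\<^sub>F cell_d M f (h s))"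
  have q: "q \<in> poly_forms M f n 1" "koszul M f q = (\<Sum>s\<in>{0..n}. ?c s *\<^sub>F koszul M f (h s))"
    unfolding q_def
    using lin_closed_sum[OF polyD(6)[OF f(1)], where g = "koszul M f" and h = h and c = ?c and A = "{0..n}"]
      polyD(7)[OF f(1)] hp by blast+
  have q': "q' \<in> poly_forms M f (n - 1) 2" "koszul M f q' = (\<Sum>s\<in>{0..n}. ?c s *\<^sub>F koszul M f (cell_d M f (h s)))"
    unfolding q'_def
    using lin_closed_sum[OF polyD(6)[OF f(1)], where g = "koszul M f" and h = "\<lambda>s. cell_d M f (h s)" and c = ?c and A = "{0..n}"]
      polyD(7)[OF f(1)] dh by blast+
  have dkq: "cell_d M f (koszul M f q) = (\<Sum>s\<in>{0..n}. ?c s *\<^sub>F cell_d M f (koszul M f (h s)))"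
    unfolding q(2)
    using lin_closed_sum(2)[OF C1_closed_lin_closed, where g = "cell_d M f" and h = "\<lambda>s. koszul M f (h s)" and c = ?c and A = "{0..n}"]
      cell_d_lin[OF f] kh by blast
  have "cell_d M f (koszul M f q) + koszul M f q' =
      (\<Sum>s\<in>{0..n}. ?c s *\<^sub>F cell_d M f (koszul M f (h s)) + ?c s *\<^sub>F koszul M f (cell_d M f (h s)))"
    unfolding dkq q'(2) by (rule sum.distrib[symmetric])
  also have "\<dots> = (\<Sum>s\<in>{0..n}. h s)"
  proof (rule sum.cong[OF refl])
    fix s assume "s \<in> {0..n}"
    then have "lam s 1 \<noteq> 0" using G(3) by simp
    have "?c s *\<^sub>F cell_d M f (koszul M f (h s)) + ?c s *\<^sub>F koszul M f (cell_d M f (h s)) =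
        ?c s *\<^sub>F (cell_d M f (koszul M f (h s)) + koszul M f (cell_d M f (h s)))"
      by (rule form.scale_right_distrib[symmetric])
    also have "\<dots> = ?c s *\<^sub>F (lam s 1 *\<^sub>F h s)" by (simp only: G(2)[THEN spec, THEN spec, THEN bspec, OF h(2)])
    also have "\<dots> = h s" using \<open>lam s 1 \<noteq> 0\<close> by (simp add: form_scale_def)
    finally show "?c s *\<^sub>F cell_d M f (koszul M f (h s)) + ?c s *\<^sub>F koszul M f (cell_d M f (h s)) = h s" .
  qed
  finally have "\<sigma> = cell_d M f (koszul M f q) + koszul M f q'" unfolding h(1) ..
  then show ?thesis using q(1) q'(1) by blast
qed

text \<open>On functions \<open>\<kappa>d\<close> is diagonalisable, so its square has the same kernel.\<close>

lemma koszul_d_square: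
  assumes f: "f \<in> cells M" "cdim M f = 2" and p: "p \<in> poly_forms M f n 0"
    and z: "koszul M f (cell_d M f (koszul M f (cell_d M f p))) = 0"
  shows "koszul M f (cell_d M f p) = 0"
proof -
  obtain G and lam :: "int \<Rightarrow> int \<Rightarrow> real" where G: "homogeneous_decomposition M f G"
    "\<forall>s l. \<forall>p\<in>G s l. cell_d M f (koszul M f p) + koszul M f (cell_d M f p) = lam s l *\<^sub>F p"
    using hypothesis_HD[OF f] by blast
  obtain m where m': "p = (\<Sum>s\<in>{0..n}. m s)" "\<forall>s. m s \<in> G s 0"
    using H_sum_exists[OF G(1) p] by blast
  then have m: "p = (\<Sum>s\<in>{0..n}. m s)" "\<And>s. m s \<in> G s 0" by blast+
  let ?L = "\<lambda>p. koszul M f (cell_d M f p)"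
  have mp: "m s \<in> poly_forms M f n 0" if "s \<in> {0..n}" for s
    using H_mem[OF G(1) m(2)] that by simp
  have d0: "cell_d M f 0 = 0"
    using cell_d_lin[OF f, of 0 0 0 0] lin_closedD(2)[OF C1_closed_lin_closed] by (simp only: form_lin_zero)
  \<comment> \<open>\<kappa> sends functions to forms of degree -1, so the homotopy formula reduces
    to its second term.\<close>
  have Lm: "?L (m s) = lam s 0 *\<^sub>F m s" if "s \<in> {0..n}" for s
  proof -
    have "koszul M f (m s) \<in> C1_closed_forms M f (-1)"
      using polyD(4)[OF f(1) mp[OF that]] polyD(2)[OF f(1)] by force
    then have "koszul M f (m s) = 0" using negative_degree[OF f(1)] by simp
    then show ?thesis using G(2)[THEN spec, THEN spec, THEN bspec, OF m(2)[of s]] d0 by (simp only: add_0)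
  qed
  have Llin: "?L (a *\<^sub>F p + b *\<^sub>F q) = a *\<^sub>F ?L p + b *\<^sub>F ?L q"
    if "p \<in> poly_forms M f n 0" "q \<in> poly_forms M f n 0" for p q a b
  proof -
    have "cell_d M f (a *\<^sub>F p + b *\<^sub>F q) = a *\<^sub>F cell_d M f p + b *\<^sub>F cell_d M f q"
      by (rule cell_d_lin[OF f]) (use that polyD(2)[OF f(1)] in blast)+
    then show ?thesis using polyD(7)[OF f(1) polyD(3)[OF f(1) that(1)] polyD(3)[OF f(1) that(2)]] by (simp only:)
  qed
  have Lsum: "?L (\<Sum>s\<in>{0..n}. c s *\<^sub>F m s) = (\<Sum>s\<in>{0..n}. (c s * lam s 0) *\<^sub>F m s)" for c
  proof -
    have "?L (\<Sum>s\<in>{0..n}. c s *\<^sub>F m s) = (\<Sum>s\<in>{0..n}. c s *\<^sub>F ?L (m s))"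
      by (rule lin_closed_sum(2)[OF polyD(6)[OF f(1)], where g = ?L and h = m and c = c and A = "{0..n}"])
         (use Llin mp in auto)
    also have "\<dots> = (\<Sum>s\<in>{0..n}. (c s * lam s 0) *\<^sub>F m s)"
      by (rule sum.cong[OF refl]) (simp only: Lm form.scale_scale)
    finally show ?thesis .
  qed
  have p1: "p = (\<Sum>s\<in>{0..n}. 1 *\<^sub>F m s)" using m(1) by (simp only: form.scale_one)
  have Lp: "?L p = (\<Sum>s\<in>{0..n}. (1 * lam s 0) *\<^sub>F m s)" unfolding p1 by (rule Lsum)
  have LLp: "?L (?L p) = (\<Sum>s\<in>{0..n}. (1 * lam s 0 * lam s 0) *\<^sub>F m s)" unfolding Lp by (rule Lsum)
  have "(1 * lam s 0 * lam s 0) *\<^sub>F m s = 0" if "s \<in> {0..n}" for s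
  proof (rule homogeneous_decompositionD(3)[OF G(1) _ _ that])
    show "(1 * lam s 0 * lam s 0) *\<^sub>F m s \<in> G s 0" for s
      by (rule form.subspace_scale[OF homogeneous_decompositionD(1)[OF G(1)] m(2)])
    show "(\<Sum>s\<in>{0..n}. (1 * lam s 0 * lam s 0) *\<^sub>F m s) = 0" using z LLp by (simp only:)
  qed
  \<comment> \<open>A scalar with vanishing square is 0; this is where diagonalisability
    enters.\<close>
  then have "(1 * lam s 0) *\<^sub>F m s = 0" if "s \<in> {0..n}" for s
    using that form.scale_eq_0_iff by (metis mult_eq_0_iff)
  then show ?thesis unfolding Lp by (intro sum.neutral) blast
qed

text \<open>Applying \<kappa> removes \<kappa> q' and leaves \<kappa> d \<kappa> q = 0. Splitting q
  as d \<kappa> s + \<kappa> s' gives \<kappa> q = \<kappa> d (\<kappa> s), so the square of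
  \<kappa> d annihilates the function \<kappa> s. Hence \<kappa> d annihilates it too, and that
  value is \<kappa> q.\<close>

lemma poly_1_split_unique:
  assumes f: "f \<in> cells M" "cdim M f = 2" and q: "q \<in> poly_forms M f n 1" and q': "q' \<in> poly_forms M f (n - 1) 2"
    and z: "cell_d M f (koszul M f q) + koszul M f q' = 0"
  shows "koszul M f q = 0" "koszul M f q' = 0"
proof -
  let ?d = "cell_d M f" and ?k = "koszul M f"
  have klin: "?k (p + p') = ?k p + ?k p'" if "p \<in> poly_forms M f s l" "p' \<in> poly_forms M f s l" for p p' s l
    using polyD(7)[OF f(1) that, of 1 1] by (simp only: form.scale_one)
  have d0: "?d 0 = 0"
    using cell_d_lin[OF f, of 0 0 0 0] lin_closedD(2)[OF C1_closed_lin_closed] by (simp only: form_lin_zero)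
  have k0: "?k 0 = 0"
    using polyD(7)[OF f(1), of 0 n 1 0 0 0] lin_closedD(2)[OF polyD(6)[OF f(1)]] by (simp only: form_lin_zero)
  have \<mu>: "?k q \<in> poly_forms M f (n + 1) 0" using polyD(4)[OF f(1) q] by simp
  have d\<mu>: "?d (?k q) \<in> poly_forms M f n 1" using polyD(3)[OF f(1) \<mu>] by simp
  have \<nu>: "?k q' \<in> poly_forms M f n 1" using polyD(4)[OF f(1) q'] by simp
  have "?k (?d (?k q)) + ?k (?k q') = 0" using klin[OF d\<mu> \<nu>] z k0 by (simp only:)
  then have L: "?k (?d (?k q)) = 0" using polyD(5)[OF f(1) q'] by (simp only: add_0_right)
  obtain s s' where s: "s \<in> poly_forms M f n 1" "s' \<in> poly_forms M f (n - 1) 2" "q = ?d (?k s) + ?k s'"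
    using poly_1_split[OF f q] by blast
  have ks: "?k s \<in> poly_forms M f (n + 1) 0" using polyD(4)[OF f(1) s(1)] by simp
  have dks: "?d (?k s) \<in> poly_forms M f n 1" using polyD(3)[OF f(1) ks] by simp
  have ks': "?k s' \<in> poly_forms M f n 1" using polyD(4)[OF f(1) s(2)] by simp
  have "?k q = ?k (?d (?k s)) + ?k (?k s')" unfolding s(3) by (rule klin[OF dks ks'])
  then have kq: "?k q = ?k (?d (?k s))" using polyD(5)[OF f(1) s(2)] by (simp only: add_0_right)
  then show k: "?k q = 0" using koszul_d_square[OF f ks] L by (simp only:)
  show "?k q' = 0" using z unfolding k d0 by (simp only: add_0)
qed

end

context disc begin

section \<open>Linear structure of the discrete spaces\<close>

abbreviation clin :: "real \<Rightarrow> 'a cochain \<Rightarrow> real \<Rightarrow> 'a cochain \<Rightarrow> 'a cochain" where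
  "clin a \<omega> b \<omega>' \<equiv> \<lambda>f. a *\<^sub>F \<omega> f + b *\<^sub>F \<omega>' f"

lemma hodge_inv_space_lin:
  assumes f: "f \<in> cells M" "1 \<le> k" "k \<le> cdim M f" and S: "lin_closed S"
    and "\<omega> \<in> hodge_inv_space M f k S" "\<omega>' \<in> hodge_inv_space M f k S"
  shows "a *\<^sub>F \<omega> + b *\<^sub>F \<omega>' \<in> hodge_inv_space M f k S"
    "hodge M f k (a *\<^sub>F \<omega> + b *\<^sub>F \<omega>') = a *\<^sub>F hodge M f k \<omega> + b *\<^sub>F hodge M f k \<omega>'"
proof -
  have d: "cdim M f = 1 \<or> cdim M f = 2" using cellD(6)[OF f(1)] f(2,3) by linarith
  interpret cell M f by (rule cell_cell[OF f(1) d])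
  have w: "\<omega> \<in> forms M f (int k)" "\<omega>' \<in> forms M f (int k)" "hodge M f k \<omega> \<in> S" "hodge M f k \<omega>' \<in> S"
    using assms(5,6) by (simp_all add: hodge_inv_space_def)
  show h: "hodge M f k (a *\<^sub>F \<omega> + b *\<^sub>F \<omega>') = a *\<^sub>F hodge M f k \<omega> + b *\<^sub>F hodge M f k \<omega>'"
    by (rule hodge_lin[OF w(1,2) f(2,3)])
  show "a *\<^sub>F \<omega> + b *\<^sub>F \<omega>' \<in> hodge_inv_space M f k S"
    unfolding hodge_inv_space_def using forms_lin[OF w(1,2)] lin_closedD(1)[OF S w(3,4)] h by simp
qed

lemma hodge_inv_space_mono: "S \<subseteq> S' \<Longrightarrow> hodge_inv_space M f k S \<subseteq> hodge_inv_space M f k S'"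
  by (auto simp: hodge_inv_space_def)

lemma wedge_ip:
  assumes f: "f \<in> cells M" "cdim M f = 2" and k: "k = 1 \<or> k = 2"
    and \<omega>: "\<omega> \<in> hodge_inv_space M f k S" and \<mu>: "\<mu> \<in> C1_closed_forms M f (2 - int k)"
  shows "form_int M f (wedge \<omega> \<mu>) = ip f (hodge M f k \<omega>) \<mu>"
proof -
  have "\<mu> \<in> forms M f (int (cdim M f) - int k)"
    using \<mu> C1_closed_forms_forms[OF cellD(1)[OF f(1)]] f(2) by force
  moreover have "\<omega> \<in> forms M f (int k)" using \<omega> by (simp add: hodge_inv_space_def)
  ultimately show ?thesis unfolding ip_def using form_int_wedge[OF f(1), of k] k f(2) by fastforce
qed

lemma wedge_lin:
  assumes f: "f \<in> cells M" "cdim M f = 2" and k: "k = 1 \<or> k = 2"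
    and \<omega>: "\<omega> \<in> hodge_inv_space M f k (C1_closed_forms M f (2 - int k))"
      "\<omega>' \<in> hodge_inv_space M f k (C1_closed_forms M f (2 - int k))"
    and \<mu>: "\<mu> \<in> C1_closed_forms M f (2 - int k)" "\<mu>' \<in> C1_closed_forms M f (2 - int k)"
  shows "form_int M f (wedge (a *\<^sub>F \<omega> + b *\<^sub>F \<omega>') \<mu>) = a * form_int M f (wedge \<omega> \<mu>) + b * form_int M f (wedge \<omega>' \<mu>)"
    "form_int M f (wedge \<omega> (a *\<^sub>F \<mu> + b *\<^sub>F \<mu>')) = a * form_int M f (wedge \<omega> \<mu>) + b * form_int M f (wedge \<omega> \<mu>')"
proof -
  have k': "1 \<le> k" "k \<le> cdim M f" and l: "2 - int k = 0 \<or> 2 - int k = 1" using k f(2) by auto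
  note C = C1_closed_lin_closed[of f "2 - int k"]
  have h: "hodge M f k \<omega> \<in> C1_closed_forms M f (2 - int k)" "hodge M f k \<omega>' \<in> C1_closed_forms M f (2 - int k)"
    using \<omega> by (simp_all add: hodge_inv_space_def)
  show "form_int M f (wedge (a *\<^sub>F \<omega> + b *\<^sub>F \<omega>') \<mu>) = a * form_int M f (wedge \<omega> \<mu>) + b * form_int M f (wedge \<omega>' \<mu>)"
    unfolding wedge_ip[OF f k \<omega>(1) \<mu>(1)] wedge_ip[OF f k \<omega>(2) \<mu>(1)]
      wedge_ip[OF f k hodge_inv_space_lin(1)[OF f(1) k' C \<omega>] \<mu>(1)] hodge_inv_space_lin(2)[OF f(1) k' C \<omega>]
    by (rule ip_lin[OF f l h \<mu>(1)])
  show "form_int M f (wedge \<omega> (a *\<^sub>F \<mu> + b *\<^sub>F \<mu>')) = a * form_int M f (wedge \<omega> \<mu>) + b * form_int M f (wedge \<omega> \<mu>')"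
    unfolding wedge_ip[OF f k \<omega>(1) \<mu>(1)] wedge_ip[OF f k \<omega>(1) \<mu>(2)]
      wedge_ip[OF f k \<omega>(1) lin_closedD(1)[OF C \<mu>]]
    by (rule ip_lin_right[OF f l \<mu> h(1)])
qed

lemma trimmed_0: "trimmed M f s 0 = poly_forms M f s 0"
  by (simp add: trimmed_def)

text \<open>Both summands are again polynomial forms of degree 1, whence the regularity; closure
  under combinations is the linearity of d and \<kappa> on polynomials.\<close>

lemma trimmed_1:
  assumes "f \<in> cells M" "cdim M f = 2"
  shows "trimmed M f r 1 \<subseteq> C1_closed_forms M f 1" "lin_closed (trimmed M f r 1)"
proof -
  have T: "trimmed M f r 1 = {cell_d M f p + koszul M f q | p q. p \<in> poly_forms M f r 0 \<and> q \<in> poly_forms M f (r - 1) 2}"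
    by (simp add: trimmed_def)
  show "trimmed M f r 1 \<subseteq> C1_closed_forms M f 1"
  proof
    fix \<sigma> assume "\<sigma> \<in> trimmed M f r 1"
    then obtain p q where pq: "\<sigma> = cell_d M f p + koszul M f q" "p \<in> poly_forms M f r 0" "q \<in> poly_forms M f (r - 1) 2"
      unfolding T by blast
    have "cell_d M f p \<in> C1_closed_forms M f 1" "koszul M f q \<in> C1_closed_forms M f 1"
      using polyD(3)[OF assms(1) pq(2)] polyD(4)[OF assms(1) pq(3)] polyD(2)[OF assms(1)] by force+
    from lin_closedD(1)[OF C1_closed_lin_closed this, of 1 1]
    show "\<sigma> \<in> C1_closed_forms M f 1" unfolding pq(1) by (simp only: form.scale_one)
  qed
  show "lin_closed (trimmed M f r 1)"
    unfolding lin_closed_def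
  proof (intro conjI ballI allI)
    note P0 = lin_closedD[OF polyD(6)[OF assms(1), of r 0]] and P2 = lin_closedD[OF polyD(6)[OF assms(1), of "r - 1" 2]]
    have "cell_d M f 0 = 0"
      using cell_d_lin[OF assms, of 0 0 0 0] lin_closedD(2)[OF C1_closed_lin_closed] by (simp only: form_lin_zero)
    moreover have "koszul M f 0 = 0"
      using polyD(7)[OF assms(1) P2(2) P2(2), of 0 0] by (simp only: form_lin_zero)
    ultimately have "cell_d M f 0 + koszul M f 0 = 0" by (simp only: add_0)
    then show "0 \<in> trimmed M f r 1" unfolding T using P0(2) P2(2) by (metis (mono_tags, lifting) mem_Collect_eq)
    fix \<sigma> \<tau> a b assume "\<sigma> \<in> trimmed M f r 1" "\<tau> \<in> trimmed M f r 1"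
    then obtain p q p' q' where
      pq: "\<sigma> = cell_d M f p + koszul M f q" "p \<in> poly_forms M f r 0" "q \<in> poly_forms M f (r - 1) 2" and
      pq': "\<tau> = cell_d M f p' + koszul M f q'" "p' \<in> poly_forms M f r 0" "q' \<in> poly_forms M f (r - 1) 2"
      unfolding T by blast
    have "cell_d M f (a *\<^sub>F p + b *\<^sub>F p') = a *\<^sub>F cell_d M f p + b *\<^sub>F cell_d M f p'"
      by (rule cell_d_lin[OF assms]) (use pq(2) pq'(2) polyD(2)[OF assms(1)] in blast)+
    moreover have "koszul M f (a *\<^sub>F q + b *\<^sub>F q') = a *\<^sub>F koszul M f q + b *\<^sub>F koszul M f q'"
      by (rule polyD(7)[OF assms(1) pq(3) pq'(3)])
    ultimately have "a *\<^sub>F \<sigma> + b *\<^sub>F \<tau> = cell_d M f (a *\<^sub>F p + b *\<^sub>F p') + koszul M f (a *\<^sub>F q + b *\<^sub>F q')"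
      unfolding pq(1) pq'(1) by (simp add: form_scale_def fun_eq_iff algebra_simps)
    then show "a *\<^sub>F \<sigma> + b *\<^sub>F \<tau> \<in> trimmed M f r 1"
      unfolding T using P0(1)[OF pq(2) pq'(2)] P2(1)[OF pq(3) pq'(3)] by blast
  qed
qed

text \<open>On an edge the star has degree 0, where nothing is trimmed, so it is a polynomial
  function and therefore continuous and bounded.\<close>

lemma disc_space_1:
  assumes "\<omega> \<in> disc_space M r 1"
  shows "f \<in> cells M \<Longrightarrow> cdim M f = 2 \<Longrightarrow> \<omega> f \<in> hodge_inv_space M f 1 (C1_closed_forms M f 1)"
    "f' \<in> cells M \<Longrightarrow> cdim M f' = 1 \<Longrightarrow> \<omega> f' \<in> edge_forms f'"
proof -
  have w: "\<omega> f \<in> hodge_inv_space M f 1 (trimmed M f r (int (cdim M f) - int 1))"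
    if "f \<in> cells M" "1 \<le> cdim M f" for f
    using assms that unfolding disc_space_def mem_Collect_eq by metis
  show "\<omega> f \<in> hodge_inv_space M f 1 (C1_closed_forms M f 1)" if f: "f \<in> cells M" "cdim M f = 2"
    using w[OF f(1)] f(2) hodge_inv_space_mono[OF trimmed_1(1)[OF f]] by auto
  show "\<omega> f' \<in> edge_forms f'" if f: "f' \<in> cells M" "cdim M f' = 1"
  proof -
    have "\<omega> f' \<in> hodge_inv_space M f' 1 (poly_forms M f' r 0)"
      using w[OF f(1)] f(2) trimmed_0 by simp
    then have "\<omega> f' \<in> forms M f' 1" "hodge M f' 1 (\<omega> f') \<in> C1_closed_forms M f' 0"
      using polyD(2)[OF f(1)] by (auto simp: hodge_inv_space_def)
    then show ?thesis unfolding edge_forms_def using C1_closed_0_cbounded[OF f(1)] by blast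
  qed
qed

lemma disc_space_2:
  assumes "f \<in> cells M" "cdim M f = 2" "\<omega> \<in> disc_space M r 2"
  shows "\<omega> f \<in> hodge_inv_space M f 2 (C1_closed_forms M f 0)"
proof -
  have "\<omega> f \<in> hodge_inv_space M f 2 (trimmed M f r (int (cdim M f) - int 2))"
    using assms unfolding disc_space_def mem_Collect_eq by (metis order_refl)
  then have "\<omega> f \<in> hodge_inv_space M f 2 (poly_forms M f r 0)" using assms(2) trimmed_0 by simp
  then show ?thesis using hodge_inv_space_mono[OF polyD(2)[OF assms(1), of r 0]] by blast
qed

lemma disc_space_lin:
  assumes k: "k = 1 \<or> k = 2" and "\<omega> \<in> disc_space M r k" "\<omega>' \<in> disc_space M r k"
  shows "clin a \<omega> b \<omega>' \<in> disc_space M r k"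
  unfolding disc_space_def mem_Collect_eq
proof
  fix f
  let ?T = "trimmed M f r (int (cdim M f) - int k)"
  have w: "if f \<in> cells M \<and> k \<le> cdim M f then \<omega> f \<in> hodge_inv_space M f k ?T else \<omega> f = 0"
    "if f \<in> cells M \<and> k \<le> cdim M f then \<omega>' f \<in> hodge_inv_space M f k ?T else \<omega>' f = 0"
    using assms(2,3) unfolding disc_space_def by blast+
  show "if f \<in> cells M \<and> k \<le> cdim M f then clin a \<omega> b \<omega>' f \<in> hodge_inv_space M f k ?T else clin a \<omega> b \<omega>' f = 0"
  proof (cases "f \<in> cells M \<and> k \<le> cdim M f")
    case False
    then have "\<omega> f = 0" "\<omega>' f = 0" using w by (simp_all only: if_False)
    then show ?thesis using False by (simp only: if_False) simp
  next
    case True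
    then have f: "f \<in> cells M" "1 \<le> k" "k \<le> cdim M f" using k by auto
    \<comment> \<open>Degree 1 arises for k = 1 on a 2-cell alone.\<close>
    have "int (cdim M f) - int k = 0 \<or> int (cdim M f) - int k = 1 \<and> cdim M f = 2"
      using cellD(6)[OF f(1)] k f(3) by linarith
    then have "lin_closed ?T"
      using trimmed_1(2)[OF f(1)] polyD(6)[OF f(1)] trimmed_0 by metis
    then show ?thesis using hodge_inv_space_lin(1)[OF f] w True by (simp only: if_True simp_thms)
  qed
qed

section \<open>Boundary terms\<close>

text \<open>Turns the boundary term into integrals of products of functions, where linearity in
  either argument is that of the integral.\<close>

lemma boundary_int_eq:
  assumes f: "f \<in> cells M" "cdim M f = 2" and P: "\<forall>f'\<in>faces M 1 f. P f' \<in> edge_forms f'"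
    and \<mu>: "\<mu> \<in> C1_closed_forms M f 0"
  shows "boundary_int M f P \<mu> = (\<Sum>f'\<in>faces M 1 f. LINT x|cell_measure M f'.
      rel_orient M f f' x * (hodge M f' 1 (P f') x [] * trace_form M f f' \<mu> x []))"
proof -
  have sf: "submanifold M 2 f" using cellD(1)[OF f(1)] f(2) by simp
  have "form_int M f' (\<lambda>x vs. rel_orient M f f' x * wedge (P f') (trace_form M f f' \<mu>) x vs) =
      (LINT x|cell_measure M f'. rel_orient M f f' x * (hodge M f' 1 (P f') x [] * trace_form M f f' \<mu> x []))"
    if f': "f' \<in> faces M 1 f" for f'
  proof (rule edge_form_int(2)[OF faces_2(1,2)[OF f f']])
    show "P f' \<in> forms M f' 1" using P[THEN bspec, OF f'] by (simp add: edge_forms_def)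
    show "trace_form M f f' \<mu> \<in> forms M f' 0"
      using trace_form_C1_closed[OF sf faces_2(4,3)[OF f f'] \<mu>]
        C1_closed_forms_forms[OF cellD(1)[OF faces_2(1)[OF f f']]] by blast
  qed
  then show ?thesis unfolding boundary_int_def f(2) by simp
qed

lemma boundary_term_cbounded:
  assumes f: "f \<in> cells M" "cdim M f = 2" and f': "f' \<in> faces M 1 f"
    and P: "\<delta> \<in> edge_forms f'" and \<mu>: "\<mu> \<in> C1_closed_forms M f 0"
  shows "cbounded f' (\<lambda>x. rel_orient M f f' x * (hodge M f' 1 \<delta> x [] * trace_form M f f' \<mu> x []))"
proof -
  have sf: "submanifold M 2 f" using cellD(1)[OF f(1)] f(2) by simp
  note t = trace_form_C1_closed[OF sf faces_2(4,3)[OF f f'] \<mu>]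
  have "cbounded f' (\<lambda>x. hodge M f' 1 \<delta> x [])" using P by (simp add: edge_forms_def)
  from cbounded_mult[OF rel_orient_cbounded cbounded_mult[OF this C1_closed_0_cbounded[OF _ t]]] faces_2(1)[OF f f']
  show ?thesis by blast
qed

lemma boundary_int_lin_right:
  assumes f: "f \<in> cells M" "cdim M f = 2" and P: "\<forall>f'\<in>faces M 1 f. P f' \<in> edge_forms f'"
    and \<mu>: "\<mu> \<in> C1_closed_forms M f 0" "\<mu>' \<in> C1_closed_forms M f 0"
  shows "boundary_int M f P (a *\<^sub>F \<mu> + b *\<^sub>F \<mu>') = a * boundary_int M f P \<mu> + b * boundary_int M f P \<mu>'"
proof -
  have sf: "submanifold M 2 f" using cellD(1)[OF f(1)] f(2) by simp
  let ?t = "\<lambda>f' \<mu> x. rel_orient M f f' x * (hodge M f' 1 (P f') x [] * trace_form M f f' \<mu> x [])"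
  have "(LINT x|cell_measure M f'. ?t f' (a *\<^sub>F \<mu> + b *\<^sub>F \<mu>') x) =
      a * (LINT x|cell_measure M f'. ?t f' \<mu> x) + b * (LINT x|cell_measure M f'. ?t f' \<mu>' x)"
    if f': "f' \<in> faces M 1 f" for f'
  proof -
    have "?t f' (a *\<^sub>F \<mu> + b *\<^sub>F \<mu>') x = a * ?t f' \<mu> x + b * ?t f' \<mu>' x" for x
      unfolding trace_form_lin[OF sf faces_2(4,3)[OF f f'] \<mu>] form_lin_apply by (simp add: algebra_simps)
    then show ?thesis
      using LINT_lin[OF faces_2(1)[OF f f'] boundary_term_cbounded[OF f f' P[THEN bspec, OF f'] \<mu>(1)]
          boundary_term_cbounded[OF f f' P[THEN bspec, OF f'] \<mu>(2)], of a b] by (simp only:)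
  qed
  then show ?thesis
    unfolding boundary_int_eq[OF f P \<mu>(1)] boundary_int_eq[OF f P \<mu>(2)] boundary_int_eq[OF f P lin_closedD(1)[OF C1_closed_lin_closed \<mu>]]
    by (simp add: sum_distrib_left sum.distrib)
qed

lemma boundary_int_lin_left:
  assumes f: "f \<in> cells M" "cdim M f = 2" and P: "\<forall>f'\<in>faces M 1 f. P f' \<in> edge_forms f'"
    and Q: "\<forall>f'\<in>faces M 1 f. Q f' \<in> edge_forms f'" and \<mu>: "\<mu> \<in> C1_closed_forms M f 0"
  shows "boundary_int M f (clin a P b Q) \<mu> = a * boundary_int M f P \<mu> + b * boundary_int M f Q \<mu>"
proof -
  let ?t = "\<lambda>f' \<delta> x. rel_orient M f f' x * (hodge M f' 1 \<delta> x [] * trace_form M f f' \<mu> x [])"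
  have "(LINT x|cell_measure M f'. ?t f' (a *\<^sub>F P f' + b *\<^sub>F Q f') x) =
      a * (LINT x|cell_measure M f'. ?t f' (P f') x) + b * (LINT x|cell_measure M f'. ?t f' (Q f') x)"
    if f': "f' \<in> faces M 1 f" for f'
  proof -
    have "P f' \<in> forms M f' 1" "Q f' \<in> forms M f' 1" using P[THEN bspec, OF f'] Q[THEN bspec, OF f'] by (auto simp: edge_forms_def)
    then have "?t f' (a *\<^sub>F P f' + b *\<^sub>F Q f') x = a * ?t f' (P f') x + b * ?t f' (Q f') x" for x
      unfolding edge_hodge_lin[OF faces_2(1,2)[OF f f'] \<open>P f' \<in> forms M f' 1\<close> \<open>Q f' \<in> forms M f' 1\<close>] form_lin_apply
      by (simp add: algebra_simps)
    then show ?thesis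
      using LINT_lin[OF faces_2(1)[OF f f'] boundary_term_cbounded[OF f f' P[THEN bspec, OF f'] \<mu>]
          boundary_term_cbounded[OF f f' Q[THEN bspec, OF f'] \<mu>], of a b] by (simp only:)
  qed
  moreover have "\<forall>f'\<in>faces M 1 f. clin a P b Q f' \<in> edge_forms f'"
    using edge_forms_lin[OF faces_2(1,2)[OF f]] P Q by blast
  ultimately show ?thesis
    unfolding boundary_int_eq[OF f P \<mu>] boundary_int_eq[OF f Q \<mu>]
    by (subst boundary_int_eq[OF f _ \<mu>]) (assumption, simp add: sum_distrib_left sum.distrib)
qed

section \<open>The local exterior derivative\<close>

text \<open>The right-hand side of the relation defining the local derivative for k = 1, with
  \<omega> in place of the potential, since both agree on edges. The sign is kept as a power so that
  the term matches the definition by plain rewriting.\<close>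

definition stokes :: "'a set \<Rightarrow> 'a cochain \<Rightarrow> 'a form \<Rightarrow> real" where
  "stokes f \<omega> \<mu> = (-1) ^ 2 * form_int M f (wedge (\<omega> f) (cell_d M f \<mu>)) + boundary_int M f \<omega> \<mu>"

text \<open>The family P enters through the edges of f alone.\<close>

lemma local_d_from_eq:
  assumes f: "cdim M f = 2" and P: "\<And>f'. f' \<in> faces M 1 f \<Longrightarrow> P f' = \<omega> f'"
  shows "local_d_from M r 1 P \<omega> f = (THE \<eta>. \<eta> \<in> hodge_inv_space M f 2 (poly_forms M f r 0) \<and>
    (\<forall>\<mu>\<in>poly_forms M f r 0. form_int M f (wedge \<eta> \<mu>) = stokes f \<omega> \<mu>))"
proof -
  have "boundary_int M f P \<mu> = boundary_int M f \<omega> \<mu>" for \<mu>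
    unfolding boundary_int_def f by (rule sum.cong) (simp_all add: P)
  moreover have "int 2 - int 1 - 1 = 0" by simp
  ultimately show ?thesis
    unfolding local_d_from_def Let_def f stokes_def by (simp only: one_add_one)
qed

lemma stokes_lin_right:
  assumes f: "f \<in> cells M" "cdim M f = 2" and \<omega>: "\<omega> \<in> disc_space M r 1"
    and \<mu>: "\<mu> \<in> poly_forms M f r 0" "\<mu>' \<in> poly_forms M f r 0"
  shows "stokes f \<omega> (a *\<^sub>F \<mu> + b *\<^sub>F \<mu>') = a * stokes f \<omega> \<mu> + b * stokes f \<omega> \<mu>'"
proof -
  have C: "\<mu> \<in> C1_closed_forms M f 0" "\<mu>' \<in> C1_closed_forms M f 0" using \<mu> polyD(2)[OF f(1)] by blast+
  have dC: "cell_d M f \<mu> \<in> C1_closed_forms M f (2 - int 1)" "cell_d M f \<mu>' \<in> C1_closed_forms M f (2 - int 1)"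
    using polyD(3)[OF f(1) \<mu>(1)] polyD(3)[OF f(1) \<mu>(2)] polyD(2)[OF f(1)] by force+
  have w: "\<omega> f \<in> hodge_inv_space M f 1 (C1_closed_forms M f (2 - int 1))" using disc_space_1(1)[OF \<omega> f] by simp
  have e: "\<forall>f'\<in>faces M 1 f. \<omega> f' \<in> edge_forms f'"
    using disc_space_1(2)[OF \<omega>] faces_2(1,2)[OF f] by blast
  have "form_int M f (wedge (\<omega> f) (a *\<^sub>F cell_d M f \<mu> + b *\<^sub>F cell_d M f \<mu>')) =
      a * form_int M f (wedge (\<omega> f) (cell_d M f \<mu>)) + b * form_int M f (wedge (\<omega> f) (cell_d M f \<mu>'))"
    by (rule wedge_lin(2)[OF f _ w w dC]) simp
  then show ?thesis
    unfolding stokes_def cell_d_lin[OF f C] boundary_int_lin_right[where P = \<omega>, OF f e C] by (simp add: algebra_simps)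
qed

lemma stokes_lin_left:
  assumes f: "f \<in> cells M" "cdim M f = 2" and \<omega>: "\<omega> \<in> disc_space M r 1" "\<omega>' \<in> disc_space M r 1"
    and \<mu>: "\<mu> \<in> poly_forms M f r 0"
  shows "stokes f (clin a \<omega> b \<omega>') \<mu> = a * stokes f \<omega> \<mu> + b * stokes f \<omega>' \<mu>"
proof -
  have C: "\<mu> \<in> C1_closed_forms M f 0" using \<mu> polyD(2)[OF f(1)] by blast
  have dC: "cell_d M f \<mu> \<in> C1_closed_forms M f (2 - int 1)"
    using polyD(3)[OF f(1) \<mu>] polyD(2)[OF f(1)] by force
  have w: "\<omega> f \<in> hodge_inv_space M f 1 (C1_closed_forms M f (2 - int 1))"
    "\<omega>' f \<in> hodge_inv_space M f 1 (C1_closed_forms M f (2 - int 1))"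
    using disc_space_1(1)[OF \<omega>(1) f] disc_space_1(1)[OF \<omega>(2) f] by simp_all
  have e: "\<forall>f'\<in>faces M 1 f. \<omega> f' \<in> edge_forms f'" "\<forall>f'\<in>faces M 1 f. \<omega>' f' \<in> edge_forms f'"
    using disc_space_1(2)[OF \<omega>(1)] disc_space_1(2)[OF \<omega>(2)] faces_2(1,2)[OF f] by blast+
  have "form_int M f (wedge (a *\<^sub>F \<omega> f + b *\<^sub>F \<omega>' f) (cell_d M f \<mu>)) =
      a * form_int M f (wedge (\<omega> f) (cell_d M f \<mu>)) + b * form_int M f (wedge (\<omega>' f) (cell_d M f \<mu>))"
    by (rule wedge_lin(1)[OF f _ w dC dC]) simp
  then show ?thesis
    unfolding stokes_def boundary_int_lin_left[where P = \<omega> and Q = \<omega>', OF f e C] by (simp add: algebra_simps)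
qed

lemma local_d_ex1:
  assumes f: "f \<in> cells M" "cdim M f = 2" and \<omega>: "\<omega> \<in> disc_space M r 1"
  shows "\<exists>!\<eta>. \<eta> \<in> hodge_inv_space M f 2 (poly_forms M f r 0) \<and>
    (\<forall>\<mu>\<in>poly_forms M f r 0. form_int M f (wedge \<eta> \<mu>) = stokes f \<omega> \<mu>)"
proof -
  obtain B where B: "finite B" "poly_forms M f r 0 = form.span B" using polyD(1)[OF f(1)] by blast
  show ?thesis
    by (rule hodge_riesz[OF f _ B]) (use polyD(2)[OF f(1)] stokes_lin_right[OF f \<omega>] in auto)
qed

text \<open>Separates the local derivative from the recursion through which it and the potential are
  defined together.\<close>

definition Dloc :: "'a cochain \<Rightarrow> 'a set \<Rightarrow> 'a form" where
  "Dloc \<omega> f = local_d_from M r 1 \<omega> \<omega> f"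

lemma Dloc:
  assumes f: "f \<in> cells M" "cdim M f = 2" and \<omega>: "\<omega> \<in> disc_space M r 1"
  shows "Dloc \<omega> f \<in> hodge_inv_space M f 2 (poly_forms M f r 0)"
    "\<mu> \<in> poly_forms M f r 0 \<Longrightarrow> form_int M f (wedge (Dloc \<omega> f) \<mu>) = stokes f \<omega> \<mu>"
    "\<eta> \<in> hodge_inv_space M f 2 (poly_forms M f r 0) \<Longrightarrow>
      (\<And>\<mu>. \<mu> \<in> poly_forms M f r 0 \<Longrightarrow> form_int M f (wedge \<eta> \<mu>) = stokes f \<omega> \<mu>) \<Longrightarrow> \<eta> = Dloc \<omega> f"
    "(\<And>f'. f' \<in> faces M 1 f \<Longrightarrow> P f' = \<omega> f') \<Longrightarrow> local_d_from M r 1 P \<omega> f = Dloc \<omega> f"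
proof -
  note E = local_d_from_eq[where P = \<omega> and \<omega> = \<omega>, OF f(2) refl, folded Dloc_def]
  show "Dloc \<omega> f \<in> hodge_inv_space M f 2 (poly_forms M f r 0)"
    "\<mu> \<in> poly_forms M f r 0 \<Longrightarrow> form_int M f (wedge (Dloc \<omega> f) \<mu>) = stokes f \<omega> \<mu>"
    using theI'[OF local_d_ex1[OF f \<omega>]] unfolding E[symmetric] by blast+
  show "\<eta> = Dloc \<omega> f" if "\<eta> \<in> hodge_inv_space M f 2 (poly_forms M f r 0)"
      "\<And>\<mu>. \<mu> \<in> poly_forms M f r 0 \<Longrightarrow> form_int M f (wedge \<eta> \<mu>) = stokes f \<omega> \<mu>"
    using the1_equality[OF local_d_ex1[OF f \<omega>], of \<eta>] that unfolding E[symmetric] by blast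
  show "local_d_from M r 1 P \<omega> f = Dloc \<omega> f" if "\<And>f'. f' \<in> faces M 1 f \<Longrightarrow> P f' = \<omega> f'"
    unfolding E using that by (rule local_d_from_eq[OF f(2)])
qed

lemma Dloc_C1:
  assumes f: "f \<in> cells M" "cdim M f = 2" and \<omega>: "\<omega> \<in> disc_space M r 1"
  shows "Dloc \<omega> f \<in> hodge_inv_space M f 2 (C1_closed_forms M f (2 - int 2))"
proof -
  have "poly_forms M f r 0 \<subseteq> C1_closed_forms M f (2 - int 2)" using polyD(2)[OF f(1), of r 0] by simp
  then show ?thesis using Dloc(1)[OF f \<omega>] hodge_inv_space_mono by blast
qed

lemma Dloc_lin:
  assumes f: "f \<in> cells M" "cdim M f = 2" and \<omega>: "\<omega> \<in> disc_space M r 1" "\<omega>' \<in> disc_space M r 1"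
  shows "Dloc (clin a \<omega> b \<omega>') f = a *\<^sub>F Dloc \<omega> f + b *\<^sub>F Dloc \<omega>' f"
proof (rule Dloc(3)[OF f disc_space_lin[OF _ \<omega>], symmetric])
  show "a *\<^sub>F Dloc \<omega> f + b *\<^sub>F Dloc \<omega>' f \<in> hodge_inv_space M f 2 (poly_forms M f r 0)"
    by (rule hodge_inv_space_lin(1)[OF f(1) _ _ polyD(6)[OF f(1)] Dloc(1)[OF f \<omega>(1)] Dloc(1)[OF f \<omega>(2)]])
       (simp_all add: f(2))
  fix \<mu> assume \<mu>: "\<mu> \<in> poly_forms M f r 0"
  then have C: "\<mu> \<in> C1_closed_forms M f (2 - int 2)" using polyD(2)[OF f(1), of r 0] by auto
  have "form_int M f (wedge (a *\<^sub>F Dloc \<omega> f + b *\<^sub>F Dloc \<omega>' f) \<mu>) =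
      a * form_int M f (wedge (Dloc \<omega> f) \<mu>) + b * form_int M f (wedge (Dloc \<omega>' f) \<mu>)"
    by (rule wedge_lin(1)[OF f _ Dloc_C1[OF f \<omega>(1)] Dloc_C1[OF f \<omega>(2)] C C]) simp
  then show "form_int M f (wedge (a *\<^sub>F Dloc \<omega> f + b *\<^sub>F Dloc \<omega>' f) \<mu>) = stokes f (clin a \<omega> b \<omega>') \<mu>"
    unfolding stokes_lin_left[OF f \<omega> \<mu>] Dloc(2)[OF f \<omega>(1) \<mu>] Dloc(2)[OF f \<omega>(2) \<mu>] .
qed simp

end

lemma sum_linear:
  "(\<Sum>x\<in>A. a * g x + b * h x) = a * sum g A + b * (sum h A :: real)"
  by (simp add: sum.distrib sum_distrib_left)

context disc begin

section \<open>The potential\<close>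

text \<open>The difference of two splittings is a splitting of 0. The preimages under \<kappa> may
  still differ by elements of its kernel.\<close>

lemma split_unique:
  assumes f: "f \<in> cells M" "cdim M f = 2"
    and q: "q1 \<in> poly_forms M f n 1" "q2 \<in> poly_forms M f n 1"
    and q': "q1' \<in> poly_forms M f (n - 1) 2" "q2' \<in> poly_forms M f (n - 1) 2"
    and eq: "cell_d M f (koszul M f q1) + koszul M f q1' = cell_d M f (koszul M f q2) + koszul M f q2'"
  shows "koszul M f q1 = koszul M f q2" "koszul M f q1' = koszul M f q2'"
proof -
  define q where "q = 1 *\<^sub>F q1 + (-1) *\<^sub>F q2"
  define q' where "q' = 1 *\<^sub>F q1' + (-1) *\<^sub>F q2'"
  have p: "q \<in> poly_forms M f n 1" "q' \<in> poly_forms M f (n - 1) 2"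
    unfolding q_def q'_def by (rule lin_closedD(1)[OF polyD(6)[OF f(1)] assms(3,4)])
      (rule lin_closedD(1)[OF polyD(6)[OF f(1)] assms(5,6)])
  have k: "koszul M f q = 1 *\<^sub>F koszul M f q1 + (-1) *\<^sub>F koszul M f q2"
    "koszul M f q' = 1 *\<^sub>F koszul M f q1' + (-1) *\<^sub>F koszul M f q2'"
    unfolding q_def q'_def by (rule polyD(7)[OF f(1) assms(3,4)]) (rule polyD(7)[OF f(1) assms(5,6)])
  have C: "koszul M f q1 \<in> C1_closed_forms M f 0" "koszul M f q2 \<in> C1_closed_forms M f 0"
    using polyD(4)[OF f(1) assms(3)] polyD(4)[OF f(1) assms(4)] polyD(2)[OF f(1)] by force+
  have d: "cell_d M f (koszul M f q) = 1 *\<^sub>F cell_d M f (koszul M f q1) + (-1) *\<^sub>F cell_d M f (koszul M f q2)"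
    unfolding k(1) by (rule cell_d_lin[OF f C])
  have "cell_d M f (koszul M f q) + koszul M f q' =
      1 *\<^sub>F (cell_d M f (koszul M f q1) + koszul M f q1') + (-1) *\<^sub>F (cell_d M f (koszul M f q2) + koszul M f q2')"
    unfolding d k(2) by (simp add: form_scale_def fun_eq_iff algebra_simps)
  also have "\<dots> = 0" unfolding eq by (simp add: form_scale_def fun_eq_iff)
  finally have "koszul M f q = 0" "koszul M f q' = 0" using poly_1_split_unique[OF f p] by blast+
  then show "koszul M f q1 = koszul M f q2" "koszul M f q1' = koszul M f q2'"
    unfolding k by (simp_all add: form_scale_def fun_eq_iff)
qed

definition pot_rhs :: "'a set \<Rightarrow> 'a cochain \<Rightarrow> 'a form \<Rightarrow> 'a form \<Rightarrow> real" where
  "pot_rhs f \<omega> \<mu> \<nu> = form_int M f (wedge (Dloc \<omega> f) \<mu>) - boundary_int M f \<omega> \<mu>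
     + (-1) ^ 2 * form_int M f (wedge (\<omega> f) \<nu>)"

text \<open>The condition under the \<open>THE\<close> of \<open>potential_dim\<close> for k = 1 on
  a 2-cell, in the shape to which it unfolds.\<close>

definition pot_cond :: "'a set \<Rightarrow> 'a cochain \<Rightarrow> 'a form \<Rightarrow> bool" where
  "pot_cond f \<omega> p \<longleftrightarrow> p \<in> hodge_inv_space M f 1 (poly_forms M f r 1) \<and>
    (\<forall>\<mu>\<in>koszul M f ` poly_forms M f r 1. \<forall>\<nu>\<in>koszul M f ` poly_forms M f (r - 1) 2.
      (-1) ^ 2 * form_int M f (wedge p (cell_d M f \<mu> + \<nu>)) = pot_rhs f \<omega> \<mu> \<nu>)"

definition pot :: "'a set \<Rightarrow> 'a cochain \<Rightarrow> 'a form" where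
  "pot f \<omega> = (THE p. pot_cond f \<omega> p)"

lemma disc_space_1_faces:
  assumes "f \<in> cells M" "cdim M f = 2" "\<omega> \<in> disc_space M r 1"
  shows "\<forall>f'\<in>faces M 1 f. \<omega> f' \<in> edge_forms f'"
  using disc_space_1(2)[OF assms(3)] faces_2(1,2)[OF assms(1,2)] by blast

lemma disc_space_1_cell:
  assumes "f \<in> cells M" "cdim M f = 2" "\<omega> \<in> disc_space M r 1"
  shows "\<omega> f \<in> hodge_inv_space M f 1 (C1_closed_forms M f (2 - int 1))"
  using disc_space_1(1)[OF assms(3,1,2)] by simp

lemma pot_rhs_lin_right:
  assumes f: "f \<in> cells M" "cdim M f = 2" and \<omega>: "\<omega> \<in> disc_space M r 1"
    and \<mu>: "\<mu> \<in> C1_closed_forms M f 0" "\<mu>' \<in> C1_closed_forms M f 0"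
    and \<nu>: "\<nu> \<in> C1_closed_forms M f 1" "\<nu>' \<in> C1_closed_forms M f 1"
  shows "pot_rhs f \<omega> (a *\<^sub>F \<mu> + b *\<^sub>F \<mu>') (a *\<^sub>F \<nu> + b *\<^sub>F \<nu>') = a * pot_rhs f \<omega> \<mu> \<nu> + b * pot_rhs f \<omega> \<mu>' \<nu>'"
proof -
  have \<mu>2: "\<mu> \<in> C1_closed_forms M f (2 - int 2)" "\<mu>' \<in> C1_closed_forms M f (2 - int 2)" using \<mu> by simp_all
  have \<nu>1: "\<nu> \<in> C1_closed_forms M f (2 - int 1)" "\<nu>' \<in> C1_closed_forms M f (2 - int 1)" using \<nu> by simp_all
  have 1: "form_int M f (wedge (Dloc \<omega> f) (a *\<^sub>F \<mu> + b *\<^sub>F \<mu>')) =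
      a * form_int M f (wedge (Dloc \<omega> f) \<mu>) + b * form_int M f (wedge (Dloc \<omega> f) \<mu>')"
    by (rule wedge_lin(2)[OF f _ Dloc_C1[OF f \<omega>] Dloc_C1[OF f \<omega>] \<mu>2]) simp
  have 2: "form_int M f (wedge (\<omega> f) (a *\<^sub>F \<nu> + b *\<^sub>F \<nu>')) =
      a * form_int M f (wedge (\<omega> f) \<nu>) + b * form_int M f (wedge (\<omega> f) \<nu>')"
    by (rule wedge_lin(2)[OF f _ disc_space_1_cell[OF f \<omega>] disc_space_1_cell[OF f \<omega>] \<nu>1]) simp
  show ?thesis
    unfolding pot_rhs_def 1 2 boundary_int_lin_right[OF f disc_space_1_faces[OF f \<omega>] \<mu>] by (simp add: algebra_simps)
qed

lemma pot_rhs_lin_left: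
  assumes f: "f \<in> cells M" "cdim M f = 2" and \<omega>: "\<omega> \<in> disc_space M r 1" "\<omega>' \<in> disc_space M r 1"
    and \<mu>: "\<mu> \<in> C1_closed_forms M f 0" and \<nu>: "\<nu> \<in> C1_closed_forms M f 1"
  shows "pot_rhs f (clin a \<omega> b \<omega>') \<mu> \<nu> = a * pot_rhs f \<omega> \<mu> \<nu> + b * pot_rhs f \<omega>' \<mu> \<nu>"
proof -
  have \<mu>2: "\<mu> \<in> C1_closed_forms M f (2 - int 2)" using \<mu> by simp
  have \<nu>1: "\<nu> \<in> C1_closed_forms M f (2 - int 1)" using \<nu> by simp
  have 1: "form_int M f (wedge (a *\<^sub>F Dloc \<omega> f + b *\<^sub>F Dloc \<omega>' f) \<mu>) =
      a * form_int M f (wedge (Dloc \<omega> f) \<mu>) + b * form_int M f (wedge (Dloc \<omega>' f) \<mu>)"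
    by (rule wedge_lin(1)[OF f _ Dloc_C1[OF f \<omega>(1)] Dloc_C1[OF f \<omega>(2)] \<mu>2 \<mu>2]) simp
  have 2: "form_int M f (wedge (a *\<^sub>F \<omega> f + b *\<^sub>F \<omega>' f) \<nu>) =
      a * form_int M f (wedge (\<omega> f) \<nu>) + b * form_int M f (wedge (\<omega>' f) \<nu>)"
    by (rule wedge_lin(1)[OF f _ disc_space_1_cell[OF f \<omega>(1)] disc_space_1_cell[OF f \<omega>(2)] \<nu>1 \<nu>1]) simp
  show ?thesis
    unfolding pot_rhs_def Dloc_lin[OF f \<omega>] 1 2
      boundary_int_lin_left[OF f disc_space_1_faces[OF f \<omega>(1)] disc_space_1_faces[OF f \<omega>(2)] \<mu>]
    by (simp add: algebra_simps)
qed

lemma koszul_C1: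
  assumes "f \<in> cells M"
  shows "q \<in> poly_forms M f r 1 \<Longrightarrow> koszul M f q \<in> C1_closed_forms M f 0"
    "q \<in> poly_forms M f r 1 \<Longrightarrow> cell_d M f (koszul M f q) \<in> poly_forms M f r 1"
    "q' \<in> poly_forms M f (r - 1) 2 \<Longrightarrow> koszul M f q' \<in> poly_forms M f r 1"
proof -
  show "koszul M f q \<in> C1_closed_forms M f 0" if "q \<in> poly_forms M f r 1"
    using polyD(4)[OF assms that] polyD(2)[OF assms] by force
  show "cell_d M f (koszul M f q) \<in> poly_forms M f r 1" if "q \<in> poly_forms M f r 1"
    using polyD(3)[OF assms polyD(4)[OF assms that]] by simp
  show "koszul M f q' \<in> poly_forms M f r 1" if "q' \<in> poly_forms M f (r - 1) 2"
    using polyD(4)[OF assms that] by simp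
qed

text \<open>The test pairs correspond to the polynomial forms \<sigma> = d \<mu> + \<nu>: existence
  of the splitting covers every \<sigma>, and uniqueness makes the right-hand side a function \<Phi>
  of \<sigma>. The condition then says that the star of p represents \<Phi>.\<close>

lemma pot_ex1:
  assumes f: "f \<in> cells M" "cdim M f = 2" and \<omega>: "\<omega> \<in> disc_space M r 1"
  shows "\<exists>!p. pot_cond f \<omega> p"
proof -
  let ?S = "poly_forms M f r 1"
  let ?S' = "poly_forms M f (r - 1) 2"
  let ?k = "koszul M f" and ?d = "cell_d M f"
  have "\<forall>\<sigma>\<in>?S. \<exists>q q'. q \<in> ?S \<and> q' \<in> ?S' \<and> \<sigma> = ?d (?k q) + ?k q'"
    using poly_1_split[OF f] by blast
  \<comment> \<open>These choices need not be linear, but \<kappa> m and \<kappa> n are, by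
    uniqueness of the splitting, and \<Phi> depends on nothing else.\<close>
  then obtain m n where mn: "\<And>\<sigma>. \<sigma> \<in> ?S \<Longrightarrow> m \<sigma> \<in> ?S" "\<And>\<sigma>. \<sigma> \<in> ?S \<Longrightarrow> n \<sigma> \<in> ?S'"
    "\<And>\<sigma>. \<sigma> \<in> ?S \<Longrightarrow> \<sigma> = ?d (?k (m \<sigma>)) + ?k (n \<sigma>)"
    by metis
  define \<Phi> where "\<Phi> \<sigma> = pot_rhs f \<omega> (?k (m \<sigma>)) (?k (n \<sigma>))" for \<sigma>
  have SC: "?S \<subseteq> C1_closed_forms M f 1" by (rule polyD(2)[OF f(1)])
  have Slin: "\<And>p q a b. p \<in> ?S \<Longrightarrow> q \<in> ?S \<Longrightarrow> a *\<^sub>F p + b *\<^sub>F q \<in> ?S" by (rule lin_closedD(1)[OF polyD(6)[OF f(1)]])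
  have \<Phi>: "\<Phi> (a *\<^sub>F p + b *\<^sub>F q) = a * \<Phi> p + b * \<Phi> q" if pq: "p \<in> ?S" "q \<in> ?S" for p q a b
  proof -
    let ?s = "a *\<^sub>F p + b *\<^sub>F q"
    let ?m = "a *\<^sub>F m p + b *\<^sub>F m q" and ?n = "a *\<^sub>F n p + b *\<^sub>F n q"
    have s: "?s \<in> ?S" by (rule Slin[OF pq])
    have M: "?m \<in> ?S" by (rule Slin[OF mn(1)[OF pq(1)] mn(1)[OF pq(2)]])
    have N: "?n \<in> ?S'" by (rule lin_closedD(1)[OF polyD(6)[OF f(1)] mn(2)[OF pq(1)] mn(2)[OF pq(2)]])
    have km: "?k ?m = a *\<^sub>F ?k (m p) + b *\<^sub>F ?k (m q)" by (rule polyD(7)[OF f(1) mn(1)[OF pq(1)] mn(1)[OF pq(2)]])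
    have kn: "?k ?n = a *\<^sub>F ?k (n p) + b *\<^sub>F ?k (n q)" by (rule polyD(7)[OF f(1) mn(2)[OF pq(1)] mn(2)[OF pq(2)]])
    have C: "?k (m p) \<in> C1_closed_forms M f 0" "?k (m q) \<in> C1_closed_forms M f 0"
      "?k (n p) \<in> C1_closed_forms M f 1" "?k (n q) \<in> C1_closed_forms M f 1"
      by (rule koszul_C1(1)[OF f(1) mn(1)[OF pq(1)]] koszul_C1(1)[OF f(1) mn(1)[OF pq(2)]]
          subsetD[OF SC koszul_C1(3)[OF f(1) mn(2)[OF pq(1)]]] subsetD[OF SC koszul_C1(3)[OF f(1) mn(2)[OF pq(2)]]])+
    have "?s = a *\<^sub>F (?d (?k (m p)) + ?k (n p)) + b *\<^sub>F (?d (?k (m q)) + ?k (n q))"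
      using mn(3)[OF pq(1)] mn(3)[OF pq(2)] by (simp only:)
    also have "\<dots> = ?d (?k ?m) + ?k ?n"
      unfolding km kn cell_d_lin[OF f C(1,2)] by (simp add: form_scale_def fun_eq_iff algebra_simps)
    finally have "?d (?k (m ?s)) + ?k (n ?s) = ?d (?k ?m) + ?k ?n" using mn(3)[OF s] by (simp only:)
    from split_unique[OF f mn(1)[OF s] M mn(2)[OF s] N this]
    have "?k (m ?s) = a *\<^sub>F ?k (m p) + b *\<^sub>F ?k (m q)" "?k (n ?s) = a *\<^sub>F ?k (n p) + b *\<^sub>F ?k (n q)"
      unfolding km kn .
    then show ?thesis unfolding \<Phi>_def using pot_rhs_lin_right[OF f \<omega> C, of a b] by (simp only:)
  qed
  obtain B where B: "finite B" "?S = form.span B" using polyD(1)[OF f(1)] by blast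
  have ex1: "\<exists>!p. p \<in> hodge_inv_space M f 1 ?S \<and> (\<forall>\<sigma>\<in>?S. form_int M f (wedge p \<sigma>) = \<Phi> \<sigma>)"
    by (rule hodge_riesz[OF f _ B]) (use SC \<Phi> in auto)
  have "(\<forall>\<sigma>\<in>?S. form_int M f (wedge p \<sigma>) = \<Phi> \<sigma>) \<longleftrightarrow>
      (\<forall>\<mu>\<in>?k ` ?S. \<forall>\<nu>\<in>?k ` ?S'. (-1) ^ 2 * form_int M f (wedge p (?d \<mu> + \<nu>)) = pot_rhs f \<omega> \<mu> \<nu>)" for p
  proof (intro iffI ballI)
    fix \<mu> \<nu> assume *: "\<forall>\<sigma>\<in>?S. form_int M f (wedge p \<sigma>) = \<Phi> \<sigma>" "\<mu> \<in> ?k ` ?S" "\<nu> \<in> ?k ` ?S'"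
    then obtain q q' where q: "q \<in> ?S" "\<mu> = ?k q" "q' \<in> ?S'" "\<nu> = ?k q'" by blast
    have s: "?d \<mu> + \<nu> \<in> ?S" unfolding q
      using Slin[OF koszul_C1(2)[OF f(1) q(1)] koszul_C1(3)[OF f(1) q(3)], of 1 1] by (simp only: form.scale_one)
    have "?d (?k (m (?d \<mu> + \<nu>))) + ?k (n (?d \<mu> + \<nu>)) = ?d (?k q) + ?k q'"
      using mn(3)[OF s] q by (simp only:)
    from split_unique[OF f mn(1)[OF s] q(1) mn(2)[OF s] q(3) this]
    have "\<Phi> (?d \<mu> + \<nu>) = pot_rhs f \<omega> \<mu> \<nu>" unfolding \<Phi>_def q by (simp only:)
    moreover have "form_int M f (wedge p (?d \<mu> + \<nu>)) = \<Phi> (?d \<mu> + \<nu>)" using *(1) s by blast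
    ultimately show "(-1) ^ 2 * form_int M f (wedge p (?d \<mu> + \<nu>)) = pot_rhs f \<omega> \<mu> \<nu>" by simp
  next
    fix \<sigma> assume *: "\<forall>\<mu>\<in>?k ` ?S. \<forall>\<nu>\<in>?k ` ?S'. (-1) ^ 2 * form_int M f (wedge p (?d \<mu> + \<nu>)) = pot_rhs f \<omega> \<mu> \<nu>"
      and s: "\<sigma> \<in> ?S"
    have "(-1) ^ 2 * form_int M f (wedge p (?d (?k (m \<sigma>)) + ?k (n \<sigma>))) = pot_rhs f \<omega> (?k (m \<sigma>)) (?k (n \<sigma>))"
      using * mn(1,2)[OF s] by blast
    then show "form_int M f (wedge p \<sigma>) = \<Phi> \<sigma>"
      unfolding \<Phi>_def mn(3)[OF s, symmetric] by simp
  qed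
  then show ?thesis using ex1 unfolding pot_cond_def by (simp only:)
qed

lemma pot_cond_pot:
  assumes "f \<in> cells M" "cdim M f = 2" "\<omega> \<in> disc_space M r 1"
  shows "pot_cond f \<omega> (pot f \<omega>)" "pot_cond f \<omega> p \<Longrightarrow> p = pot f \<omega>"
proof -
  show *: "pot_cond f \<omega> (pot f \<omega>)" unfolding pot_def by (rule theI'[OF pot_ex1[OF assms]])
  show "p = pot f \<omega>" if "pot_cond f \<omega> p"
    using pot_ex1[OF assms] * that by blast
qed

text \<open>The last conclusion, about the potential itself rather than its star, is the one that
  the trace requires.\<close>

lemma pot_space:
  assumes "f \<in> cells M" "cdim M f = 2" "\<omega> \<in> disc_space M r 1"
  shows "pot f \<omega> \<in> hodge_inv_space M f 1 (poly_forms M f r 1)"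
    "pot f \<omega> \<in> hodge_inv_space M f 1 (C1_closed_forms M f (2 - int 1))" "pot f \<omega> \<in> C1_closed_forms M f 1"
proof -
  show p: "pot f \<omega> \<in> hodge_inv_space M f 1 (poly_forms M f r 1)"
    using pot_cond_pot(1)[OF assms] unfolding pot_cond_def by blast
  have "poly_forms M f r 1 \<subseteq> C1_closed_forms M f (2 - int 1)" using polyD(2)[OF assms(1), of r 1] by simp
  then show "pot f \<omega> \<in> hodge_inv_space M f 1 (C1_closed_forms M f (2 - int 1))"
    using p hodge_inv_space_mono by blast
  have "pot f \<omega> \<in> forms M f 1" "hodge M f 1 (pot f \<omega>) \<in> C1_closed_forms M f 1"
    using p polyD(2)[OF assms(1), of r 1] unfolding hodge_inv_space_def by auto
  then show "pot f \<omega> \<in> C1_closed_forms M f 1" by (rule hodge_inv_C1_closed[OF assms(1,2)])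
qed

lemma pot_lin:
  assumes f: "f \<in> cells M" "cdim M f = 2" and \<omega>: "\<omega> \<in> disc_space M r 1" "\<omega>' \<in> disc_space M r 1"
  shows "pot f (clin a \<omega> b \<omega>') = a *\<^sub>F pot f \<omega> + b *\<^sub>F pot f \<omega>'"
proof (rule pot_cond_pot(2)[OF f disc_space_lin[OF _ \<omega>], symmetric])
  let ?p = "a *\<^sub>F pot f \<omega> + b *\<^sub>F pot f \<omega>'"
  show "pot_cond f (clin a \<omega> b \<omega>') ?p"
    unfolding pot_cond_def
  proof (intro conjI ballI)
    show "?p \<in> hodge_inv_space M f 1 (poly_forms M f r 1)"
      by (rule hodge_inv_space_lin(1)[OF f(1) _ _ polyD(6)[OF f(1)] pot_space(1)[OF f \<omega>(1)] pot_space(1)[OF f \<omega>(2)]])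
         (simp_all add: f(2))
    fix \<mu> \<nu> assume *: "\<mu> \<in> koszul M f ` poly_forms M f r 1" "\<nu> \<in> koszul M f ` poly_forms M f (r - 1) 2"
    then obtain q q' where q: "q \<in> poly_forms M f r 1" "\<mu> = koszul M f q" "q' \<in> poly_forms M f (r - 1) 2" "\<nu> = koszul M f q'"
      by blast
    have C: "\<mu> \<in> C1_closed_forms M f 0" "\<nu> \<in> C1_closed_forms M f 1" "cell_d M f \<mu> \<in> C1_closed_forms M f 1"
      using koszul_C1[OF f(1)] q polyD(2)[OF f(1)] by blast+
    have s: "cell_d M f \<mu> + \<nu> \<in> C1_closed_forms M f (2 - int 1)"
      using lin_closedD(1)[OF C1_closed_lin_closed C(3,2), of 1 1] by (simp only: form.scale_one) simp
    have "form_int M f (wedge ?p (cell_d M f \<mu> + \<nu>)) =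
        a * form_int M f (wedge (pot f \<omega>) (cell_d M f \<mu> + \<nu>)) + b * form_int M f (wedge (pot f \<omega>') (cell_d M f \<mu> + \<nu>))"
      by (rule wedge_lin(1)[OF f _ pot_space(2)[OF f \<omega>(1)] pot_space(2)[OF f \<omega>(2)] s s]) simp
    moreover have "(-1) ^ 2 * form_int M f (wedge (pot f \<omega>) (cell_d M f \<mu> + \<nu>)) = pot_rhs f \<omega> \<mu> \<nu>"
      "(-1) ^ 2 * form_int M f (wedge (pot f \<omega>') (cell_d M f \<mu> + \<nu>)) = pot_rhs f \<omega>' \<mu> \<nu>"
      using pot_cond_pot(1)[OF f \<omega>(1)] pot_cond_pot(1)[OF f \<omega>(2)] * unfolding pot_cond_def by blast+
    ultimately show "(-1) ^ 2 * form_int M f (wedge ?p (cell_d M f \<mu> + \<nu>)) = pot_rhs f (clin a \<omega> b \<omega>') \<mu> \<nu>"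
      unfolding pot_rhs_lin_left[OF f \<omega> C(1,2)] by simp
  qed
qed simp

lemma potential_low:
  assumes "cdim M f \<le> k"
  shows "potential M r k \<omega> f = \<omega> f"
  unfolding potential_def using assms by (cases "cdim M f") auto

lemma potential_cell:
  assumes f: "cdim M f = 2"
  shows "potential M r 1 \<omega> f = pot f \<omega>"
proof -
  \<comment> \<open>For k = 1 the level \<open>Suc 0\<close> of the recursion is the identity on
    every cell, whatever its dimension, so a single unfolding remains.\<close>
  have P1: "potential_dim M r 1 (Suc 0) \<omega> = \<omega>" by (rule ext) simp
  have n: "\<not> Suc (Suc 0) \<le> 1" by simp
  have i: "int (Suc (Suc 0)) - int 1 = 1" "(1::int) + 1 = 2" by simp_all
  have "potential M r 1 \<omega> f = potential_dim M r 1 (Suc (Suc 0)) \<omega> f"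
    by (simp only: potential_def f numeral_2_eq_2)
  also have "\<dots> = pot f \<omega>"
    unfolding pot_def pot_cond_def pot_rhs_def Dloc_def
    by (simp only: potential_dim.simps(2)[where d = "Suc 0"] n if_False Let_def P1 i one_add_one)
  finally show ?thesis .
qed

section \<open>The discrete inner products\<close>

definition jump :: "'a set \<Rightarrow> 'a set \<Rightarrow> 'a cochain \<Rightarrow> 'a form" where
  "jump f f' \<omega> = \<omega> f' - trace_form M f f' (pot f \<omega>)"

lemma jump_edge_forms:
  assumes f: "f \<in> cells M" "cdim M f = 2" "f' \<in> faces M 1 f" and \<omega>: "\<omega> \<in> disc_space M r 1"
  shows "jump f f' \<omega> \<in> edge_forms f'"
proof -
  have sf: "submanifold M 2 f" using cellD(1)[OF f(1)] f(2) by simp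
  have "trace_form M f f' (pot f \<omega>) \<in> edge_forms f'"
    by (rule edge_forms_C1_closed[OF faces_2(1,2)[OF f]
        trace_form_C1_closed[OF sf faces_2(4,3)[OF f] pot_space(3)[OF f(1,2) \<omega>]]])
  then show ?thesis unfolding jump_def form_diff_lin
    by (rule edge_forms_lin[OF faces_2(1,2)[OF f] disc_space_1(2)[OF \<omega> faces_2(1,2)[OF f]]])
qed

lemma jump_lin:
  assumes f: "f \<in> cells M" "cdim M f = 2" "f' \<in> faces M 1 f" and \<omega>: "\<omega> \<in> disc_space M r 1" "\<omega>' \<in> disc_space M r 1"
  shows "jump f f' (clin a \<omega> b \<omega>') = a *\<^sub>F jump f f' \<omega> + b *\<^sub>F jump f f' \<omega>'"
proof -
  have sf: "submanifold M 2 f" using cellD(1)[OF f(1)] f(2) by simp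
  show ?thesis
    unfolding jump_def pot_lin[OF f(1,2) \<omega>]
      trace_form_lin[OF sf faces_2(4,3)[OF f] pot_space(3)[OF f(1,2) \<omega>(1)] pot_space(3)[OF f(1,2) \<omega>(2)]]
    by (simp add: form_scale_def fun_eq_iff algebra_simps)
qed

text \<open>For k = 1 the stabilisation runs over edges alone, with exponent 2 - 1 = 1 of the cell
  diameter.\<close>

lemma disc_inner_1:
  assumes "\<omega> \<in> disc_space M r 1" "\<mu> \<in> disc_space M r 1"
  shows "disc_inner M r 1 \<omega> \<mu> = (\<Sum>f | f \<in> cells M \<and> cdim M f = 2.
    ip f (hodge M f 1 (pot f \<omega>)) (hodge M f 1 (pot f \<mu>)) +
    cell_diam M f * (\<Sum>f'\<in>faces M 1 f. edge_ip f' (jump f f' \<omega>) (jump f f' \<mu>)))"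
  unfolding disc_inner_def
proof (rule sum.cong[OF refl])
  fix f assume "f \<in> {f. f \<in> cells M \<and> cdim M f = 2}"
  then have f: "f \<in> cells M" "cdim M f = 2" by auto
  have i: "{1::nat..<2} = {1}" by auto
  have h: "hodge M f 1 (pot f \<mu>) \<in> C1_closed_forms M f (2 - int 1)"
    using pot_space(2)[OF f assms(2)] by (simp add: hodge_inv_space_def)
  have "form_int M f (wedge (potential M r 1 \<omega> f) (hodge M f 1 (potential M r 1 \<mu> f))) =
      ip f (hodge M f 1 (pot f \<omega>)) (hodge M f 1 (pot f \<mu>))"
    unfolding potential_cell[OF f(2)] by (rule wedge_ip[OF f _ pot_space(2)[OF f assms(1)] h]) simp
  moreover have "(\<Sum>d\<in>{1..<2}. cell_diam M f ^ (2 - d) *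
           (\<Sum>f'\<in>faces M d f. form_int M f'
              (wedge (potential M r 1 \<omega> f' - trace_form M f f' (potential M r 1 \<omega> f))
                 (hodge M f' 1 (potential M r 1 \<mu> f' - trace_form M f f' (potential M r 1 \<mu> f)))))) =
      cell_diam M f * (\<Sum>f'\<in>faces M 1 f. edge_ip f' (jump f f' \<omega>) (jump f f' \<mu>))"
  proof -
    have "form_int M f' (wedge (potential M r 1 \<omega> f' - trace_form M f f' (potential M r 1 \<omega> f))
                 (hodge M f' 1 (potential M r 1 \<mu> f' - trace_form M f f' (potential M r 1 \<mu> f)))) =
        edge_ip f' (jump f f' \<omega>) (jump f f' \<mu>)" if f': "f' \<in> faces M 1 f" for f'
    proof -
      have "cdim M f' \<le> 1" using faces_2(2)[OF f f'] by simp
      from potential_low[OF this] show ?thesis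
        unfolding potential_cell[OF f(2)] edge_ip_def jump_def by (simp only:)
    qed
    then have "(\<Sum>f'\<in>faces M 1 f. form_int M f'
              (wedge (potential M r 1 \<omega> f' - trace_form M f f' (potential M r 1 \<omega> f))
                 (hodge M f' 1 (potential M r 1 \<mu> f' - trace_form M f f' (potential M r 1 \<mu> f))))) =
        (\<Sum>f'\<in>faces M 1 f. edge_ip f' (jump f f' \<omega>) (jump f f' \<mu>))"
      by (rule sum.cong[OF refl])
    then show ?thesis unfolding i by simp
  qed
  ultimately show "form_int M f (wedge (potential M r 1 \<omega> f) (hodge M f 1 (potential M r 1 \<mu> f))) +
      (\<Sum>d\<in>{1..<2}. cell_diam M f ^ (2 - d) *
           (\<Sum>f'\<in>faces M d f. form_int M f'
              (wedge (potential M r 1 \<omega> f' - trace_form M f f' (potential M r 1 \<omega> f))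
                 (hodge M f' 1 (potential M r 1 \<mu> f' - trace_form M f f' (potential M r 1 \<mu> f)))))) =
      ip f (hodge M f 1 (pot f \<omega>)) (hodge M f 1 (pot f \<mu>)) +
      cell_diam M f * (\<Sum>f'\<in>faces M 1 f. edge_ip f' (jump f f' \<omega>) (jump f f' \<mu>))" by (simp only:)
qed

lemma disc_inner_1_sym:
  assumes "\<omega> \<in> disc_space M r 1" "\<mu> \<in> disc_space M r 1"
  shows "disc_inner M r 1 \<omega> \<mu> = disc_inner M r 1 \<mu> \<omega>"
  unfolding disc_inner_1[OF assms] disc_inner_1[OF assms(2,1)]
proof (rule sum.cong[OF refl])
  fix f assume "f \<in> {f. f \<in> cells M \<and> cdim M f = 2}"
  then have f: "f \<in> cells M" "cdim M f = 2" by auto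
  have "(\<Sum>f'\<in>faces M 1 f. edge_ip f' (jump f f' \<omega>) (jump f f' \<mu>)) =
      (\<Sum>f'\<in>faces M 1 f. edge_ip f' (jump f f' \<mu>) (jump f f' \<omega>))"
    by (rule sum.cong[OF refl], rule edge_ip_sym) (use faces_2[OF f] jump_edge_forms[OF f] assms in blast)+
  moreover have "ip f (hodge M f 1 (pot f \<omega>)) (hodge M f 1 (pot f \<mu>)) = ip f (hodge M f 1 (pot f \<mu>)) (hodge M f 1 (pot f \<omega>))"
    by (rule ip_sym)
  ultimately show "ip f (hodge M f 1 (pot f \<omega>)) (hodge M f 1 (pot f \<mu>)) +
      cell_diam M f * (\<Sum>f'\<in>faces M 1 f. edge_ip f' (jump f f' \<omega>) (jump f f' \<mu>)) =
      ip f (hodge M f 1 (pot f \<mu>)) (hodge M f 1 (pot f \<omega>)) +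
      cell_diam M f * (\<Sum>f'\<in>faces M 1 f. edge_ip f' (jump f f' \<mu>) (jump f f' \<omega>))" by (simp only:)
qed

lemma disc_inner_1_lin:
  assumes \<omega>: "\<omega> \<in> disc_space M r 1" "\<omega>' \<in> disc_space M r 1" and \<mu>: "\<mu> \<in> disc_space M r 1"
  shows "disc_inner M r 1 (clin a \<omega> b \<omega>') \<mu> = a * disc_inner M r 1 \<omega> \<mu> + b * disc_inner M r 1 \<omega>' \<mu>"
proof -
  have s: "clin a \<omega> b \<omega>' \<in> disc_space M r 1" by (rule disc_space_lin[OF _ \<omega>]) simp
  let ?t = "\<lambda>\<omega> f. ip f (hodge M f 1 (pot f \<omega>)) (hodge M f 1 (pot f \<mu>)) +
      cell_diam M f * (\<Sum>f'\<in>faces M 1 f. edge_ip f' (jump f f' \<omega>) (jump f f' \<mu>))"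
  have "?t (clin a \<omega> b \<omega>') f = a * ?t \<omega> f + b * ?t \<omega>' f" if f: "f \<in> cells M" "cdim M f = 2" for f
  proof -
    have k: "1 \<le> (1::nat)" "1 \<le> cdim M f" using f(2) by simp_all
    have h: "hodge M f 1 (pot f \<nu>) \<in> C1_closed_forms M f 1" if "\<nu> \<in> disc_space M r 1" for \<nu>
      using pot_space(2)[OF f that] by (simp add: hodge_inv_space_def)
    have "ip f (hodge M f 1 (pot f (clin a \<omega> b \<omega>'))) (hodge M f 1 (pot f \<mu>)) =
        a * ip f (hodge M f 1 (pot f \<omega>)) (hodge M f 1 (pot f \<mu>)) + b * ip f (hodge M f 1 (pot f \<omega>')) (hodge M f 1 (pot f \<mu>))"
      unfolding pot_lin[OF f \<omega>]
        hodge_inv_space_lin(2)[OF f(1) k C1_closed_lin_closed pot_space(2)[OF f \<omega>(1)] pot_space(2)[OF f \<omega>(2)]]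
      by (rule ip_lin[OF f _ h[OF \<omega>(1)] h[OF \<omega>(2)] h[OF \<mu>]]) simp
    moreover have "edge_ip f' (jump f f' (clin a \<omega> b \<omega>')) (jump f f' \<mu>) =
        a * edge_ip f' (jump f f' \<omega>) (jump f f' \<mu>) + b * edge_ip f' (jump f f' \<omega>') (jump f f' \<mu>)"
      if f': "f' \<in> faces M 1 f" for f'
      unfolding jump_lin[OF f f' \<omega>]
      by (rule edge_ip_lin[OF faces_2(1,2)[OF f f'] jump_edge_forms[OF f f' \<omega>(1)] jump_edge_forms[OF f f' \<omega>(2)] jump_edge_forms[OF f f' \<mu>]])
    then have "(\<Sum>f'\<in>faces M 1 f. edge_ip f' (jump f f' (clin a \<omega> b \<omega>')) (jump f f' \<mu>)) =
        a * (\<Sum>f'\<in>faces M 1 f. edge_ip f' (jump f f' \<omega>) (jump f f' \<mu>)) +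
        b * (\<Sum>f'\<in>faces M 1 f. edge_ip f' (jump f f' \<omega>') (jump f f' \<mu>))"
      by (simp add: sum.distrib sum_distrib_left)
    ultimately show ?thesis by (simp add: algebra_simps)
  qed
  then have "(\<Sum>f | f \<in> cells M \<and> cdim M f = 2. ?t (clin a \<omega> b \<omega>') f) =
      (\<Sum>f | f \<in> cells M \<and> cdim M f = 2. a * ?t \<omega> f + b * ?t \<omega>' f)"
    by (intro sum.cong[OF refl]) blast
  also have "\<dots> = a * (\<Sum>f | f \<in> cells M \<and> cdim M f = 2. ?t \<omega> f) + b * (\<Sum>f | f \<in> cells M \<and> cdim M f = 2. ?t \<omega>' f)"
    by (rule sum_linear)
  finally show ?thesis unfolding disc_inner_1[OF s \<mu>] disc_inner_1[OF \<omega>(1) \<mu>] disc_inner_1[OF \<omega>(2) \<mu>] .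
qed

lemma disc_inner_2:
  assumes "\<omega> \<in> disc_space M r 2" "\<mu> \<in> disc_space M r 2"
  shows "disc_inner M r 2 \<omega> \<mu> = (\<Sum>f | f \<in> cells M \<and> cdim M f = 2. ip f (hodge M f 2 (\<omega> f)) (hodge M f 2 (\<mu> f)))"
  unfolding disc_inner_def
proof (rule sum.cong[OF refl])
  fix f assume "f \<in> {f. f \<in> cells M \<and> cdim M f = 2}"
  then have f: "f \<in> cells M" "cdim M f = 2" by auto
  have p: "potential M r 2 \<nu> f = \<nu> f" for \<nu> by (rule potential_low) (simp add: f(2))
  have h: "hodge M f 2 (\<mu> f) \<in> C1_closed_forms M f (2 - int 2)"
    using disc_space_2[OF f assms(2)] by (simp add: hodge_inv_space_def)
  have "form_int M f (wedge (\<omega> f) (hodge M f 2 (\<mu> f))) = ip f (hodge M f 2 (\<omega> f)) (hodge M f 2 (\<mu> f))"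
    by (rule wedge_ip[OF f _ disc_space_2[OF f assms(1)] h]) simp
  then show "form_int M f (wedge (potential M r 2 \<omega> f) (hodge M f 2 (potential M r 2 \<mu> f))) +
      (\<Sum>d\<in>{2..<2}. cell_diam M f ^ (2 - d) *
           (\<Sum>f'\<in>faces M d f. form_int M f'
              (wedge (potential M r 2 \<omega> f' - trace_form M f f' (potential M r 2 \<omega> f))
                 (hodge M f' 2 (potential M r 2 \<mu> f' - trace_form M f f' (potential M r 2 \<mu> f)))))) =
      ip f (hodge M f 2 (\<omega> f)) (hodge M f 2 (\<mu> f))"
    unfolding p by simp
qed

lemma disc_inner_2_sym:
  assumes "\<omega> \<in> disc_space M r 2" "\<mu> \<in> disc_space M r 2"
  shows "disc_inner M r 2 \<omega> \<mu> = disc_inner M r 2 \<mu> \<omega>"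
  unfolding disc_inner_2[OF assms] disc_inner_2[OF assms(2,1)] by (rule sum.cong[OF refl ip_sym])

lemma disc_inner_2_lin:
  assumes \<omega>: "\<omega> \<in> disc_space M r 2" "\<omega>' \<in> disc_space M r 2" and \<mu>: "\<mu> \<in> disc_space M r 2"
  shows "disc_inner M r 2 (clin a \<omega> b \<omega>') \<mu> = a * disc_inner M r 2 \<omega> \<mu> + b * disc_inner M r 2 \<omega>' \<mu>"
proof -
  have s: "clin a \<omega> b \<omega>' \<in> disc_space M r 2" by (rule disc_space_lin[OF _ \<omega>]) simp
  have "ip f (hodge M f 2 (a *\<^sub>F \<omega> f + b *\<^sub>F \<omega>' f)) (hodge M f 2 (\<mu> f)) =
      a * ip f (hodge M f 2 (\<omega> f)) (hodge M f 2 (\<mu> f)) + b * ip f (hodge M f 2 (\<omega>' f)) (hodge M f 2 (\<mu> f))"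
    if f: "f \<in> cells M" "cdim M f = 2" for f
  proof -
    have k: "1 \<le> (2::nat)" "2 \<le> cdim M f" using f(2) by simp_all
    have h: "hodge M f 2 (\<nu> f) \<in> C1_closed_forms M f 0" if "\<nu> \<in> disc_space M r 2" for \<nu>
      using disc_space_2[OF f that] by (simp add: hodge_inv_space_def)
    show ?thesis
      unfolding hodge_inv_space_lin(2)[OF f(1) k C1_closed_lin_closed disc_space_2[OF f \<omega>(1)] disc_space_2[OF f \<omega>(2)]]
      by (rule ip_lin[OF f _ h[OF \<omega>(1)] h[OF \<omega>(2)] h[OF \<mu>]]) simp
  qed
  then have "(\<Sum>f | f \<in> cells M \<and> cdim M f = 2. ip f (hodge M f 2 (a *\<^sub>F \<omega> f + b *\<^sub>F \<omega>' f)) (hodge M f 2 (\<mu> f))) =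
      (\<Sum>f | f \<in> cells M \<and> cdim M f = 2.
        a * ip f (hodge M f 2 (\<omega> f)) (hodge M f 2 (\<mu> f)) + b * ip f (hodge M f 2 (\<omega>' f)) (hodge M f 2 (\<mu> f)))"
    by (intro sum.cong[OF refl]) blast
  then show ?thesis unfolding disc_inner_2[OF s \<mu>] disc_inner_2[OF \<omega>(1) \<mu>] disc_inner_2[OF \<omega>(2) \<mu>]
    by (simp only: sum.distrib sum_distrib_left)
qed

section \<open>The global exterior derivative\<close>

text \<open>In degree 0 the trimmed space is the full polynomial space, so h itself satisfies the
  orthogonality; definiteness excludes any other candidate.\<close>

lemma trimmed_proj_0:
  assumes f: "f \<in> cells M" "cdim M f = 2" and h: "h \<in> poly_forms M f r 0"
  shows "trimmed_proj M f r 0 h = h"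
  unfolding trimmed_proj_def trimmed_0
proof (rule the_equality)
  have ipd: "(LINT x|cell_measure M f. cov_inner M f x ((h - p) x) (q x)) = ip f (1 *\<^sub>F h + (-1) *\<^sub>F p) q" for p q
    unfolding ip_def form_diff_lin ..
  have hC: "h \<in> C1_closed_forms M f 0" using h polyD(2)[OF f(1)] by blast
  have "ip f (1 *\<^sub>F h + (-1) *\<^sub>F h) q = 0" if "q \<in> poly_forms M f r 0" for q
  proof -
    have "q \<in> C1_closed_forms M f 0" using that polyD(2)[OF f(1)] by blast
    then show ?thesis using ip_lin[OF f _ hC hC, of q 1 "-1"] by simp
  qed
  then show "h \<in> poly_forms M f r 0 \<and> (\<forall>q\<in>poly_forms M f r 0. (LINT x|cell_measure M f. cov_inner M f x ((h - h) x) (q x)) = 0)"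
    unfolding ipd using h by blast
  fix p assume "p \<in> poly_forms M f r 0 \<and> (\<forall>q\<in>poly_forms M f r 0. (LINT x|cell_measure M f. cov_inner M f x ((h - p) x) (q x)) = 0)"
  then have p: "p \<in> poly_forms M f r 0" "\<forall>q\<in>poly_forms M f r 0. ip f (1 *\<^sub>F h + (-1) *\<^sub>F p) q = 0"
    unfolding ipd by blast+
  have d: "1 *\<^sub>F h + (-1) *\<^sub>F p \<in> poly_forms M f r 0" by (rule lin_closedD(1)[OF polyD(6)[OF f(1)] h p(1)])
  have "1 *\<^sub>F h + (-1) *\<^sub>F p = 0"
    by (rule ip_definite[OF f, of 0]) (use d p(2) polyD(2)[OF f(1)] in auto)
  then show "p = h" by (simp add: form_scale_def fun_eq_iff)
qed

text \<open>On 2-cells the projector fixes the polynomial star of the local derivative, and the star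
  cancels with its inverse, so the component is \<open>Dloc\<close>, which already lies in the right
  space.\<close>

lemma global_d_disc_space:
  assumes \<omega>: "\<omega> \<in> disc_space M r 1"
  shows "global_d M r 1 \<omega> \<in> disc_space M r 2"
  unfolding disc_space_def mem_Collect_eq
proof
  fix f
  show "if f \<in> cells M \<and> 2 \<le> cdim M f then global_d M r 1 \<omega> f \<in> hodge_inv_space M f 2 (trimmed M f r (int (cdim M f) - int 2))
      else global_d M r 1 \<omega> f = 0"
  proof (cases "f \<in> cells M \<and> 2 \<le> cdim M f")
    case False
    then show ?thesis unfolding global_d_def by (simp only: one_add_one if_False)
  next
    case True
    then have f: "f \<in> cells M" "cdim M f = 2" using cellD(6)[of f] by auto
    interpret cell M f using cell_cell f by blast
    have P: "potential M r 1 \<omega> f' = \<omega> f'" if "f' \<in> faces M 1 f" for f'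
      by (rule potential_low) (simp add: faces_2(2)[OF f that])
    have ld: "local_d M r 1 \<omega> f = Dloc \<omega> f"
      unfolding local_d_def by (rule Dloc(4)[OF f \<omega> P])
    have i: "int 2 - int 1 - 1 = 0" "int 2 - int 2 = 0" by simp_all
    have D: "Dloc \<omega> f \<in> forms M f (int 2)" "hodge M f 2 (Dloc \<omega> f) \<in> poly_forms M f r 0"
      using Dloc(1)[OF f \<omega>] by (auto simp: hodge_inv_space_def)
    have "global_d M r 1 \<omega> f = hodge_inv M f 2 (trimmed_proj M f r 0 (hodge M f 2 (Dloc \<omega> f)))"
      unfolding global_d_def ld using True by (simp only: f(2) i one_add_one if_True simp_thms)
    also have "\<dots> = hodge_inv M f 2 (hodge M f 2 (Dloc \<omega> f))" unfolding trimmed_proj_0[OF f D(2)] ..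
    also have "\<dots> = Dloc \<omega> f" by (rule hodge_inv_hodge[OF D(1)]) (simp_all add: f(2))
    finally show ?thesis using Dloc(1)[OF f \<omega>] True by (simp only: f(2) i trimmed_0 if_True simp_thms)
  qed
qed

end

section \<open>Quadratic energies along curves\<close>

definition csum :: "nat \<Rightarrow> (nat \<Rightarrow> real) \<Rightarrow> (nat \<Rightarrow> 'a cochain) \<Rightarrow> 'a cochain" where
  "csum N c e = (\<lambda>f x vs. \<Sum>i<N. c i * e i f x vs)"

lemma csum_Suc: "csum (Suc N) c e = (\<lambda>f. 1 *\<^sub>F csum N c e f + c N *\<^sub>F e N f)"
  by (simp add: csum_def form_scale_def fun_eq_iff)

text \<open>Linearity is available on X alone, so membership in X and the value of L are carried
  through the induction together.\<close>

lemma csum_lin: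
  fixes L :: "'a cochain \<Rightarrow> real"
  assumes X: "\<And>a b \<omega> \<omega>'. \<omega> \<in> X \<Longrightarrow> \<omega>' \<in> X \<Longrightarrow> (\<lambda>f. a *\<^sub>F \<omega> f + b *\<^sub>F \<omega>' f) \<in> X" "(\<lambda>f. 0) \<in> X"
    and L: "\<And>a b \<omega> \<omega>'. \<omega> \<in> X \<Longrightarrow> \<omega>' \<in> X \<Longrightarrow> L (\<lambda>f. a *\<^sub>F \<omega> f + b *\<^sub>F \<omega>' f) = a * L \<omega> + b * L \<omega>'"
    and e: "\<And>i. i < N \<Longrightarrow> e i \<in> X"
  shows "csum N c e \<in> X" "L (csum N c e) = (\<Sum>i<N. c i * L (e i))"
proof -
  have "csum N c e \<in> X \<and> L (csum N c e) = (\<Sum>i<N. c i * L (e i))"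
    using e
  proof (induction N)
    case 0
    have z: "csum 0 c e = (\<lambda>f. 0)" by (simp add: csum_def fun_eq_iff)
    have "L (\<lambda>f. 0 *\<^sub>F 0 + 0 *\<^sub>F 0) = 0 * L (\<lambda>f. 0) + 0 * L (\<lambda>f. 0)" by (rule L[OF X(2) X(2)])
    then have "L (\<lambda>f. 0) = 0" by (simp only: form_lin_zero mult_zero_left add_0)
    then show ?case unfolding z using X(2) by (simp only: lessThan_0 sum.empty simp_thms)
  next
    case (Suc N)
    have IH: "csum N c e \<in> X" "L (csum N c e) = (\<Sum>i<N. c i * L (e i))" "e N \<in> X" using Suc by simp_all
    show ?case unfolding csum_Suc
      using X(1)[OF IH(1,3)] L[OF IH(1,3), of 1 "c N"] IH(2) by (simp only: sum.lessThan_Suc mult_1 simp_thms)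
  qed
  then show "csum N c e \<in> X" "L (csum N c e) = (\<Sum>i<N. c i * L (e i))" by blast+
qed

definition sym_bilinear_on :: "'a cochain set \<Rightarrow> ('a cochain \<Rightarrow> 'a cochain \<Rightarrow> real) \<Rightarrow> bool" where
  "sym_bilinear_on X Q \<longleftrightarrow>
     (\<forall>\<omega>\<in>X. \<forall>\<omega>'\<in>X. \<forall>a b. (\<lambda>f. a *\<^sub>F \<omega> f + b *\<^sub>F \<omega>' f) \<in> X) \<and>
     (\<forall>\<omega>\<in>X. \<forall>\<omega>'\<in>X. \<forall>\<mu>\<in>X. \<forall>a b. Q (\<lambda>f. a *\<^sub>F \<omega> f + b *\<^sub>F \<omega>' f) \<mu> = a * Q \<omega> \<mu> + b * Q \<omega>' \<mu>) \<and>
     (\<forall>\<omega>\<in>X. \<forall>\<mu>\<in>X. Q \<omega> \<mu> = Q \<mu> \<omega>)"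

text \<open>In the fixed vectors e the energy is a quadratic polynomial in the coefficients, and
  \<open>time_deriv\<close> is the combination with their derivatives; symmetry of Q merges the two
  halves of the product rule.\<close>

lemma energy_derivative:
  fixes Q :: "'a cochain \<Rightarrow> 'a cochain \<Rightarrow> real"
  assumes XQ: "sym_bilinear_on X Q"
    and u: "C1_curve T X u" and T: "T > 0"
  shows "continuous_on {0..T} (\<lambda>t. Q (u t) (u t))"
    "\<And>t. t \<in> {0<..<T} \<Longrightarrow> ((\<lambda>s. Q (u s) (u s)) has_real_derivative 2 * Q (time_deriv u t) (u t)) (at t)"
    "\<And>t. t \<in> {0..T} \<Longrightarrow> u t \<in> X"
proof -
  have X: "\<And>a b \<omega> \<omega>'. \<omega> \<in> X \<Longrightarrow> \<omega>' \<in> X \<Longrightarrow> (\<lambda>f. a *\<^sub>F \<omega> f + b *\<^sub>F \<omega>' f) \<in> X"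
    and lin: "\<And>a b \<omega> \<omega>' \<mu>. \<omega> \<in> X \<Longrightarrow> \<omega>' \<in> X \<Longrightarrow> \<mu> \<in> X \<Longrightarrow>
      Q (\<lambda>f. a *\<^sub>F \<omega> f + b *\<^sub>F \<omega>' f) \<mu> = a * Q \<omega> \<mu> + b * Q \<omega>' \<mu>"
    and sym: "\<And>\<omega> \<mu>. \<omega> \<in> X \<Longrightarrow> \<mu> \<in> X \<Longrightarrow> Q \<omega> \<mu> = Q \<mu> \<omega>"
    using XQ unfolding sym_bilinear_on_def by simp_all
  obtain N and e :: "nat \<Rightarrow> 'a cochain" and c where
    ec: "\<forall>i<N. e i \<in> X \<and> C1_on_Icc T (c i)"
      "\<forall>t\<in>{0..T}. u t \<in> X \<and> (\<forall>f x vs. u t f x vs = (\<Sum>i<N. c i t * e i f x vs))"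
    using u unfolding C1_curve_def by blast
  show uX: "u t \<in> X" if "t \<in> {0..T}" for t using ec(2) that by blast
  have eX: "\<And>i. i < N \<Longrightarrow> e i \<in> X" using ec(1) by blast
  have "u 0 \<in> X" using uX T by simp
  \<comment> \<open>X contains the zero family as a combination of u 0 with itself with zero
    coefficients.\<close>
  from X[OF this this, of 0 0] have Z: "(\<lambda>f. 0) \<in> X" by (simp only: form_lin_zero)
  obtain c' where c': "\<And>i t. i < N \<Longrightarrow> t \<in> {0..T} \<Longrightarrow> (c i has_real_derivative c' i t) (at t within {0..T})"
    using ec(1) unfolding C1_on_Icc_def by metis
  have us: "u t = csum N (\<lambda>i. c i t) e" if "t \<in> {0..T}" for t
    using ec(2) that by (simp add: csum_def fun_eq_iff)
  have Qs: "Q (csum N a e) (csum N b e) = (\<Sum>i<N. \<Sum>j<N. a i * b j * Q (e i) (e j))" for a b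
  proof -
    have bX: "csum N b e \<in> X" by (rule csum_lin(1)[where L = "\<lambda>_. 0"]) (use X Z eX in auto)
    have "Q (csum N a e) (csum N b e) = (\<Sum>i<N. a i * Q (e i) (csum N b e))"
      by (rule csum_lin(2)[where L = "\<lambda>\<omega>. Q \<omega> (csum N b e)" and X = X]) (use X Z eX lin bX in auto)
    also have "\<dots> = (\<Sum>i<N. a i * (\<Sum>j<N. b j * Q (e i) (e j)))"
    proof (rule sum.cong[OF refl])
      fix i assume "i \<in> {..<N}"
      then have i: "e i \<in> X" using eX by simp
      have "Q (csum N b e) (e i) = (\<Sum>j<N. b j * Q (e j) (e i))"
        by (rule csum_lin(2)[where L = "\<lambda>\<omega>. Q \<omega> (e i)" and X = X]) (use X Z eX lin i in auto)
      also have "\<dots> = (\<Sum>j<N. b j * Q (e i) (e j))"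
        by (rule sum.cong[OF refl]) (use sym i eX in simp)
      finally show "a i * Q (e i) (csum N b e) = a i * (\<Sum>j<N. b j * Q (e i) (e j))"
        using sym[OF i bX] by simp
    qed
    finally show ?thesis by (simp add: sum_distrib_left mult.assoc)
  qed
  let ?F = "\<lambda>t. \<Sum>i<N. \<Sum>j<N. c i t * c j t * Q (e i) (e j)"
  have F: "Q (u t) (u t) = ?F t" if "t \<in> {0..T}" for t
    unfolding us[OF that] by (rule Qs)
  have cc: "continuous_on {0..T} (c i)" if "i < N" for i
    unfolding continuous_on_eq_continuous_within using c'[OF that] DERIV_continuous by blast
  have "continuous_on {0..T} ?F" by (intro continuous_intros cc) auto
  then show "continuous_on {0..T} (\<lambda>t. Q (u t) (u t))"
    by (rule continuous_on_eq) (simp add: F)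
  fix t assume t: "t \<in> {0<..<T}"
  then have tT: "t \<in> {0..T}" by auto
  \<comment> \<open>The representation by coefficients holds on [0, T]; at an interior point it
    holds near t, which \<open>deriv\<close> requires.\<close>
  have ev: "\<forall>\<^sub>F s in nhds t. s \<in> {0..T}"
    using t eventually_nhds_in_open[of "{0<..<T}" t] by (auto elim: eventually_mono)
  have cd: "(c i has_real_derivative c' i t) (at t)" if "i < N" for i
    using c'[OF that tT] at_within_interior[of t "{0..T}"] t by (simp add: interior_atLeastAtMost_real)
  have td: "time_deriv u t = csum N (\<lambda>i. c' i t) e"
  proof (intro ext)
    fix f x vs
    have D: "((\<lambda>s. \<Sum>i<N. c i s * e i f x vs) has_real_derivative (\<Sum>i<N. c' i t * e i f x vs)) (at t)"
      by (intro DERIV_sum DERIV_cmult_right cd) simp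
    have "\<forall>\<^sub>F s in nhds t. (\<Sum>i<N. c i s * e i f x vs) = u s f x vs"
      using ev by eventually_elim (use ec(2) in simp)
    from DERIV_cong_ev[THEN iffD1, OF refl this refl D]
    have "((\<lambda>s. u s f x vs) has_real_derivative (\<Sum>i<N. c' i t * e i f x vs)) (at t)" .
    then show "time_deriv u t f x vs = csum N (\<lambda>i. c' i t) e f x vs"
      by (simp add: time_deriv_def csum_def DERIV_imp_deriv)
  qed
  have "(?F has_real_derivative (\<Sum>i<N. \<Sum>j<N. (c' i t * c j t + c' j t * c i t) * Q (e i) (e j))) (at t)"
    by (intro DERIV_sum DERIV_cmult_right DERIV_mult cd) simp_all
  moreover have "(\<Sum>i<N. \<Sum>j<N. (c' i t * c j t + c' j t * c i t) * Q (e i) (e j)) = 2 * Q (time_deriv u t) (u t)"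
  proof -
    \<comment> \<open>Exchanging i and j and using symmetry turns this half of the product rule into
      the other.\<close>
    have "(\<Sum>i<N. \<Sum>j<N. c' j t * c i t * Q (e i) (e j)) = (\<Sum>j<N. \<Sum>i<N. c' j t * c i t * Q (e i) (e j))"
      by (rule sum.swap)
    also have "\<dots> = (\<Sum>j<N. \<Sum>i<N. c' j t * c i t * Q (e j) (e i))"
      by (intro sum.cong refl) (use sym eX in simp)
    finally show ?thesis
      unfolding td us[OF tT] Qs by (simp add: distrib_right sum.distrib)
  qed
  ultimately have D: "(?F has_real_derivative 2 * Q (time_deriv u t) (u t)) (at t)" by (simp only:)
  have "\<forall>\<^sub>F s in nhds t. ?F s = Q (u s) (u s)"
    using ev by eventually_elim (simp add: F)
  from DERIV_cong_ev[THEN iffD1, OF refl this refl D]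
  show "((\<lambda>s. Q (u s) (u s)) has_real_derivative 2 * Q (time_deriv u t) (u t)) (at t)" .
qed

section \<open>Conservation of the energy\<close>

theorem lemma30:
  fixes M :: "('a::t2_space) poly_mesh"
    and r :: int and T :: real
    and E B :: "real \<Rightarrow> 'a cochain"
  assumes "compact_riemannian_surface M"
    and "mesh M"
    and "poly_spaces M"
    and "hypothesis_H M"
    and "hypothesis_T M"
    and "r \<ge> 0"
    and "T > 0"
    and "C1_curve T (disc_space M r 1) E"
    and "C1_curve T (disc_space M r 2) B"
    and "\<And>v1 v2 t. v1 \<in> disc_space M r 1 \<Longrightarrow> v2 \<in> disc_space M r 2 \<Longrightarrow> t \<in> {0<..<T} \<Longrightarrow>
           disc_inner M r 2 (global_d M r 1 (E t)) v2 = - disc_inner M r 2 (time_deriv B t) v2 \<and>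
           disc_inner M r 2 (B t) (global_d M r 1 v1) = disc_inner M r 1 (time_deriv E t) v1"
  shows "\<forall>t\<in>{0..T}. ((\<lambda>s. disc_inner M r 1 (E s) (E s) + disc_inner M r 2 (B s) (B s))
           has_real_derivative 0) (at t within {0..T})"
proof -
  interpret disc M r by unfold_locales (rule assms)+
  have "sym_bilinear_on (disc_space M r 1) (disc_inner M r 1)"
    using disc_space_lin[of 1] disc_inner_1_lin disc_inner_1_sym unfolding sym_bilinear_on_def by simp
  note E = energy_derivative[OF this assms(8,7)]
  have "sym_bilinear_on (disc_space M r 2) (disc_inner M r 2)"
    using disc_space_lin[of 2] disc_inner_2_lin disc_inner_2_sym unfolding sym_bilinear_on_def by simp
  note B = energy_derivative[OF this assms(9,7)]
  let ?F = "\<lambda>s. disc_inner M r 1 (E s) (E s) + disc_inner M r 2 (B s) (B s)"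
  have cont: "continuous_on {0..T} ?F" by (intro continuous_on_add E(1) B(1))
  have deriv: "(?F has_real_derivative 0) (at t)" if t: "t \<in> {0<..<T}" for t
  proof -
    have tT: "t \<in> {0..T}" using t by auto
    have "disc_inner M r 1 (time_deriv E t) (E t) = disc_inner M r 2 (B t) (global_d M r 1 (E t))"
      using assms(10)[OF E(3)[OF tT] B(3)[OF tT] t] by simp
    also have "\<dots> = disc_inner M r 2 (global_d M r 1 (E t)) (B t)"
      by (rule disc_inner_2_sym[OF B(3)[OF tT] global_d_disc_space[OF E(3)[OF tT]]])
    also have "\<dots> = - disc_inner M r 2 (time_deriv B t) (B t)"
      using assms(10)[OF E(3)[OF tT] B(3)[OF tT] t] by simp
    finally show ?thesis using DERIV_add[OF E(2)[OF t] B(2)[OF t]] by simp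
  qed
  \<comment> \<open>The scheme is given on the open interval, so the one-sided derivatives at 0 and
    T come from constancy up to the end points.\<close>
  have const: "?F t = ?F 0" if t: "t \<in> {0..T}" for t
  proof (rule DERIV_isconst2[OF assms(7) cont])
    show "(?F has_real_derivative 0) (at x)" if "0 < x" "x < T" for x
      by (rule deriv) (simp add: that)
    show "0 \<le> t" "t \<le> T" using t by (simp_all only: atLeastAtMost_iff)
  qed
  show ?thesis
  proof
    fix t assume t: "t \<in> {0..T}"
    show "(?F has_real_derivative 0) (at t within {0..T})"
    proof (rule has_field_derivative_transform_within[OF DERIV_const[of "?F 0"] zero_less_one t])
      show "?F 0 = ?F s" if "s \<in> {0..T}" for s by (rule const[OF that, symmetric])
    qed
  qed
qed

end
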